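(* Let $G$ be a group without elements of finite order (other than the identity). Then the action of $G$ on the unit sphere $\mathbf{S}(l_2(G))$ given by $gx=x\circ R_g$, that is $(gx)(h)=x(hg)$ for $g,h\in G$ and $x\in \mathbf{S}(l_2(G))$, is properly discontinuous. Moreover, $\mathbf{S}(l_2(G))/G$ has a complete Riemannian metric with constant sectional curvature $1$.
   Context: For a group $G$, $l_2(G)=\{x:G\to\mathbb{R} : \sum_{g\in G} x(g)^2<\infty\}$ (unordered summation), a real Hilbert space with inner product $\langle x,y\rangle=\sum_{g\in G}x(g)y(g)$; $\mathbf{S}(l_2(G))$ is its unit sphere. $R_g:G\to G$ is right translation, $R_g(h)=hg$. A group $G$ acts properly discontinuously on a topological space $X$ if: (1) whenever $x,y\in X$ and $y\notin Gx$, there are neighborhoods $U$ of $x$ and $V$ of $y$ such that $gU\cap V=\emptyset$ for every $g\in G$; (2) for every $x\in X$ the stabilizer $G_x=\{g\in G: gx=x\}$ is finite; (3) every $x\in X$ has a neighborhood $U$, stable under $G_x$, such that $gU\cap U=\emptyset$ for every $g\in G\setminus G_x$. A Hilbert manifold is a manifold modeled on a Hilbert space $\mathbb{H}$ equipped with an inner product on each tangent space $T_pM\cong\mathbb{H}$, depending smoothly on $p$ and inducing a norm equivalent to that of $\mathbb{H}$ (a Riemannian metric). It is complete if it is a complete metric space for the distance induced by the Riemannian metric. The quotient $\mathbf{S}(l_2(G))/G$ carries the manifold structure for which the projection is a covering map and a local diffeomorphism. *)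

theory Defs
  imports "HOL-Analysis.Analysis" "HOL-Algebra.Group_Action"
begin

section \<open>Square-summable families and the translation action\<close>

text \<open>
  The type \<open>'a l2\<close> consists of the square-summable families indexed by a whole type. The space
  of a group whose carrier may be a proper subset of its type is the closed subspace
  \<open>l2_space G\<close> of the families that vanish off the carrier.
\<close>

typedef 'a l2 = "{x :: 'a \<Rightarrow> real. (\<lambda>g. (x g)\<^sup>2) summable_on UNIV}"
  morphisms l2_apply Abs_l2
  by (rule exI[of _ "\<lambda>_. 0"]) simp

lemma l2_eqI: "(\<And>g. l2_apply x g = l2_apply y g) \<Longrightarrow> x = y"
  by (metis ext l2_apply_inject)

lemma l2_square_summable: "(\<lambda>g. (l2_apply x g)\<^sup>2) summable_on UNIV"
  using l2_apply[of x] by simp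

lemma l2_mult_summable: "(\<lambda>g. l2_apply x g * l2_apply y g) summable_on UNIV"
proof -
  have bound: "norm (l2_apply x g * l2_apply y g) \<le> (l2_apply x g)\<^sup>2 + (l2_apply y g)\<^sup>2" for g
  proof -
    have "2 * (\<bar>l2_apply x g\<bar> * \<bar>l2_apply y g\<bar>) \<le> (l2_apply x g)\<^sup>2 + (l2_apply y g)\<^sup>2"
      using sum_squares_bound[of "\<bar>l2_apply x g\<bar>" "\<bar>l2_apply y g\<bar>"] by simp
    moreover have "0 \<le> \<bar>l2_apply x g\<bar> * \<bar>l2_apply y g\<bar>" by simp
    ultimately show ?thesis unfolding real_norm_def abs_mult by linarith
  qed
  have "(\<lambda>g. (l2_apply x g)\<^sup>2 + (l2_apply y g)\<^sup>2) summable_on UNIV"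
    by (intro summable_on_add l2_square_summable)
  then have "(\<lambda>g. norm (l2_apply x g * l2_apply y g)) summable_on UNIV"
    by (rule summable_on_comparison_test) (use bound in auto)
  then show ?thesis by (rule abs_summable_summable)
qed

instantiation l2 :: (type) real_inner
begin

definition "(0 :: 'a l2) = Abs_l2 (\<lambda>_. 0)"
definition "x + (y :: 'a l2) = Abs_l2 (\<lambda>g. l2_apply x g + l2_apply y g)"
definition "x - (y :: 'a l2) = Abs_l2 (\<lambda>g. l2_apply x g - l2_apply y g)"
definition "- (x :: 'a l2) = Abs_l2 (\<lambda>g. - l2_apply x g)"
definition "a *\<^sub>R (x :: 'a l2) = Abs_l2 (\<lambda>g. a * l2_apply x g)"
definition "inner x (y :: 'a l2) = (\<Sum>\<^sub>\<infinity>g. l2_apply x g * l2_apply y g)"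
definition "norm (x :: 'a l2) = sqrt (inner x x)"
definition "sgn (x :: 'a l2) = inverse (norm x) *\<^sub>R x"
definition "dist (x :: 'a l2) y = norm (x - y)"
definition [code del]:
  "(uniformity :: ('a l2 \<times> 'a l2) filter) = (INF e\<in>{0 <..}. principal {(x, y). dist x y < e})"
definition [code del]:
  "open (U :: 'a l2 set) \<longleftrightarrow> (\<forall>x\<in>U. eventually (\<lambda>(x', y). x' = x \<longrightarrow> y \<in> U) uniformity)"

lemma l2_apply_zero: "l2_apply (0 :: 'a l2) g = 0"
  by (simp add: zero_l2_def Abs_l2_inverse)

lemma l2_apply_scaleR: "l2_apply (a *\<^sub>R x) g = a * l2_apply (x :: 'a l2) g"
proof -
  have "(\<lambda>g. (a * l2_apply x g)\<^sup>2) summable_on UNIV"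
    unfolding power_mult_distrib by (intro summable_on_cmult_right l2_square_summable)
  then show ?thesis by (simp add: scaleR_l2_def Abs_l2_inverse)
qed

lemma l2_apply_add: "l2_apply (x + y) g = l2_apply x g + l2_apply (y :: 'a l2) g"
proof -
  have "(\<lambda>g. (l2_apply x g)\<^sup>2 + (l2_apply y g)\<^sup>2 + 2 * (l2_apply x g * l2_apply y g)) summable_on UNIV"
    by (intro summable_on_add summable_on_cmult_right l2_square_summable l2_mult_summable)
  then have "(\<lambda>g. (l2_apply x g + l2_apply y g)\<^sup>2) summable_on UNIV"
    by (simp add: power2_sum mult.assoc)
  then show ?thesis by (simp add: plus_l2_def Abs_l2_inverse)
qed

lemma l2_apply_uminus: "l2_apply (- x) g = - l2_apply (x :: 'a l2) g"
  by (simp add: uminus_l2_def Abs_l2_inverse l2_square_summable)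

lemma l2_apply_diff: "l2_apply (x - y) g = l2_apply x g - l2_apply (y :: 'a l2) g"
proof -
  have "x - y = x + - y"
    unfolding minus_l2_def plus_l2_def l2_apply_uminus by simp
  then show ?thesis by (simp add: l2_apply_add l2_apply_uminus)
qed

lemmas l2_apply_simps =
  l2_apply_zero l2_apply_scaleR l2_apply_add l2_apply_uminus l2_apply_diff

instance
proof
  fix x y z :: "'a l2" and a b :: real
  show "x + y + z = x + (y + z)" "x + y = y + x" "0 + x = x" "- x + x = 0" "x - y = x + - y"
    "a *\<^sub>R (x + y) = a *\<^sub>R x + a *\<^sub>R y" "(a + b) *\<^sub>R x = a *\<^sub>R x + b *\<^sub>R x"
    "a *\<^sub>R b *\<^sub>R x = (a * b) *\<^sub>R x" "1 *\<^sub>R x = x"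
    by (rule l2_eqI; simp add: l2_apply_simps algebra_simps)+
  show "sgn x = inverse (norm x) *\<^sub>R x" by (rule sgn_l2_def)
  show "dist x y = norm (x - y)" by (rule dist_l2_def)
  show "inner x y = inner y x"
    by (simp add: inner_l2_def mult.commute)
  show "inner (x + y) z = inner x z + inner y z"
    by (simp add: inner_l2_def l2_apply_simps distrib_right infsum_add l2_mult_summable)
  show "inner (a *\<^sub>R x) y = a * inner x y"
    by (simp add: inner_l2_def l2_apply_simps mult.assoc infsum_cmult_right l2_mult_summable)
  show "0 \<le> inner x x"
    unfolding inner_l2_def by (intro infsum_nonneg) simp
  show "inner x x = 0 \<longleftrightarrow> x = 0"
  proof
    assume eq: "inner x x = 0"
    have "l2_apply x g * l2_apply x g = 0" for g
      by (rule nonneg_infsum_le_0D[of "\<lambda>g. l2_apply x g * l2_apply x g" UNIV])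
        (use eq l2_mult_summable in \<open>auto simp: inner_l2_def\<close>)
    then show "x = 0" by (intro l2_eqI) (simp add: l2_apply_simps)
  qed (simp add: inner_l2_def l2_apply_simps)
  show "norm x = sqrt (inner x x)" by (rule norm_l2_def)
qed (rule uniformity_l2_def open_l2_def)+

end

definition l2_space :: "('a, 'b) monoid_scheme \<Rightarrow> 'a l2 set" where
  "l2_space G = {x. \<forall>h. h \<notin> carrier G \<longrightarrow> l2_apply x h = 0}"

definition l2_sphere :: "('a, 'b) monoid_scheme \<Rightarrow> 'a l2 set" where
  "l2_sphere G = {x \<in> l2_space G. norm x = 1}"

definition translate :: "('a, 'b) monoid_scheme \<Rightarrow> 'a \<Rightarrow> 'a l2 \<Rightarrow> 'a l2" where
  "translate G g x = Abs_l2 (\<lambda>h. if h \<in> carrier G then l2_apply x (h \<otimes>\<^bsub>G\<^esub> g) else 0)"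

text \<open>The family inside \<open>Abs_l2\<close> is square-summable, so that \<open>translate\<close> has the intended values.\<close>

lemma l2_apply_translate:
  assumes "group G" and g: "g \<in> carrier G"
  shows "l2_apply (translate G g x) h =
    (if h \<in> carrier G then l2_apply x (h \<otimes>\<^bsub>G\<^esub> g) else 0)"
proof -
  interpret group G by fact
  have inj: "inj_on (\<lambda>h. h \<otimes>\<^bsub>G\<^esub> g) (carrier G)"
    using g by (auto intro!: inj_onI)
  have "(\<lambda>h. (l2_apply x h)\<^sup>2) summable_on (\<lambda>h. h \<otimes>\<^bsub>G\<^esub> g) ` carrier G"
    by (rule summable_on_subset_banach[OF l2_square_summable]) simp
  then have "(\<lambda>h. (l2_apply x (h \<otimes>\<^bsub>G\<^esub> g))\<^sup>2) summable_on carrier G"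
    by (simp add: summable_on_reindex[OF inj] comp_def)
  then have "(\<lambda>h. (if h \<in> carrier G then l2_apply x (h \<otimes>\<^bsub>G\<^esub> g) else 0)\<^sup>2) summable_on UNIV"
    by (subst summable_on_cong_neutral[where T = "carrier G"]) (auto cong: summable_on_cong)
  then show ?thesis by (simp add: translate_def Abs_l2_inverse)
qed

text \<open>Restriction to the sphere: \<open>group_action\<close> requires extensional bijections.\<close>

definition sphere_action :: "('a, 'b) monoid_scheme \<Rightarrow> 'a \<Rightarrow> 'a l2 \<Rightarrow> 'a l2" where
  "sphere_action G g = restrict (translate G g) (l2_sphere G)"

section \<open>Properly discontinuous actions, quotients, coverings\<close>

definition neighbourhood :: "'x topology \<Rightarrow> 'x \<Rightarrow> 'x set \<Rightarrow> bool" where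
  "neighbourhood X x U \<longleftrightarrow> U \<subseteq> topspace X \<and> x \<in> X interior_of U"

definition properly_discontinuous ::
  "('a, 'b) monoid_scheme \<Rightarrow> 'x topology \<Rightarrow> ('a \<Rightarrow> 'x \<Rightarrow> 'x) \<Rightarrow> bool" where
  "properly_discontinuous G X \<phi> \<longleftrightarrow>
     group_action G (topspace X) \<phi> \<and>
     (\<forall>g\<in>carrier G. homeomorphic_map X X (\<phi> g)) \<and>
     (\<forall>x\<in>topspace X. \<forall>y\<in>topspace X. y \<notin> orbit G \<phi> x \<longrightarrow>
        (\<exists>U V. neighbourhood X x U \<and> neighbourhood X y V \<and>
           (\<forall>g\<in>carrier G. \<phi> g ` U \<inter> V = {}))) \<and>
     (\<forall>x\<in>topspace X. finite (stabilizer G \<phi> x)) \<and>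
     (\<forall>x\<in>topspace X. \<exists>U. neighbourhood X x U \<and>
        (\<forall>g\<in>stabilizer G \<phi> x. \<phi> g ` U = U) \<and>
        (\<forall>g\<in>carrier G - stabilizer G \<phi> x. \<phi> g ` U \<inter> U = {}))"

definition quotient_topology :: "'x topology \<Rightarrow> ('x \<Rightarrow> 'y) \<Rightarrow> 'y topology" where
  "quotient_topology X p =
     topology (\<lambda>V. V \<subseteq> p ` topspace X \<and> openin X {x \<in> topspace X. p x \<in> V})"

lemma openin_quotient_topology:
  "openin (quotient_topology X p) V \<longleftrightarrow>
     V \<subseteq> p ` topspace X \<and> openin X {x \<in> topspace X. p x \<in> V}"
proof -
  have "istopology (\<lambda>V. V \<subseteq> p ` topspace X \<and> openin X {x \<in> topspace X. p x \<in> V})"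
    unfolding istopology_def
  proof (intro conjI allI impI)
    fix S T
    assume S: "S \<subseteq> p ` topspace X \<and> openin X {x \<in> topspace X. p x \<in> S}"
      and T: "T \<subseteq> p ` topspace X \<and> openin X {x \<in> topspace X. p x \<in> T}"
    have "{x \<in> topspace X. p x \<in> S \<inter> T} =
        {x \<in> topspace X. p x \<in> S} \<inter> {x \<in> topspace X. p x \<in> T}" by auto
    with S T show "openin X {x \<in> topspace X. p x \<in> S \<inter> T}" by (simp add: openin_Int)
    from S show "S \<inter> T \<subseteq> p ` topspace X" by blast
  next
    fix \<K>
    assume K: "\<forall>K\<in>\<K>. K \<subseteq> p ` topspace X \<and> openin X {x \<in> topspace X. p x \<in> K}"
    have "{x \<in> topspace X. p x \<in> \<Union>\<K>} = (\<Union>K\<in>\<K>. {x \<in> topspace X. p x \<in> K})" by blast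
    moreover have "openin X (\<Union>K\<in>\<K>. {x \<in> topspace X. p x \<in> K})"
      using K by (intro openin_Union) auto
    ultimately show "openin X {x \<in> topspace X. p x \<in> \<Union>\<K>}" by (simp only:)
    from K show "\<Union>\<K> \<subseteq> p ` topspace X" by blast
  qed
  then show ?thesis unfolding quotient_topology_def by (simp only: topology_inverse')
qed

definition covering_map :: "'x topology \<Rightarrow> 'y topology \<Rightarrow> ('x \<Rightarrow> 'y) \<Rightarrow> bool" where
  "covering_map X Y p \<longleftrightarrow>
     continuous_map X Y p \<and> p ` topspace X = topspace Y \<and>
     (\<forall>y\<in>topspace Y. \<exists>V \<U>. openin Y V \<and> y \<in> V \<and>
        \<Union>\<U> = {x \<in> topspace X. p x \<in> V} \<and> pairwise disjnt \<U> \<and>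
        (\<forall>U\<in>\<U>. openin X U \<and> homeomorphic_map (subtopology X U) (subtopology Y V) p))"

section \<open>Smooth maps\<close>

text \<open>
  \<open>D x [v\<^sub>1, \<dots>, v\<^sub>n]\<close> is the value of the \<open>n\<close>-th Frechet derivative at \<open>x\<close>: a bounded
  \<open>n\<close>-linear map, differentiable in \<open>x\<close> for the norm of bounded \<open>n\<close>-linear maps, with the
  direction of differentiation put first.
\<close>

definition smooth_on_open ::
  "'h::real_normed_vector set \<Rightarrow> ('h \<Rightarrow> 'k::real_normed_vector) \<Rightarrow> bool" where
  "smooth_on_open W f \<longleftrightarrow> open W \<and>
     (\<exists>D :: 'h \<Rightarrow> 'h list \<Rightarrow> 'k. \<forall>x\<in>W.
        D x [] = f x \<and>
        (\<forall>us ws. linear (\<lambda>v. D x (us @ v # ws))) \<and>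
        (\<forall>n. \<exists>C. \<forall>vs. length vs = n \<longrightarrow> norm (D x vs) \<le> C * (\<Prod>v\<leftarrow>vs. norm v)) \<and>
        (\<forall>n. \<forall>e>0. \<forall>\<^sub>F y in nhds x. \<forall>vs. length vs = n \<longrightarrow>
           norm (D y vs - D x vs - D x ((y - x) # vs)) \<le> e * norm (y - x) * (\<Prod>v\<leftarrow>vs. norm v)))"

text \<open>
  On an arbitrary subset, smoothness means local extendability to smooth maps on open sets. For
  relatively open subsets of a complete subspace this is ordinary smoothness on that subspace
  (extend along the orthogonal projection), and for submanifolds it is smoothness for the
  submanifold structure.
\<close>

definition smooth_on ::
  "'h::real_normed_vector set \<Rightarrow> ('h \<Rightarrow> 'k::real_normed_vector) \<Rightarrow> bool" where
  "smooth_on S f \<longleftrightarrow>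
     (\<forall>x\<in>S. \<exists>W F. x \<in> W \<and> smooth_on_open W F \<and> (\<forall>y\<in>W \<inter> S. F y = f y))"

definition dir_deriv ::
  "('h::real_normed_vector \<Rightarrow> 'k::real_normed_vector) \<Rightarrow> 'h \<Rightarrow> 'h \<Rightarrow> 'k" where
  "dir_deriv f x v = vector_derivative (\<lambda>t. f (x + t *\<^sub>R v)) (at 0)"

section \<open>Hilbert manifolds\<close>

text \<open>
  The model space is a complete subspace \<open>E\<close> of an inner product space, so that every Hilbert
  space, of any dimension, is allowed. A chart \<open>(U, \<phi>)\<close> has domain \<open>U\<close>; the values of \<open>\<phi>\<close>
  outside of \<open>U\<close> are irrelevant.
\<close>

type_synonym ('m, 'h) chart = "'m set \<times> ('m \<Rightarrow> 'h)"

abbreviation chart_image :: "('m, 'h) chart \<Rightarrow> 'h set" where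
  "chart_image c \<equiv> snd c ` fst c"

abbreviation chart_inv :: "('m, 'h) chart \<Rightarrow> 'h \<Rightarrow> 'm" where
  "chart_inv c \<equiv> inv_into (fst c) (snd c)"

definition hilbert_manifold ::
  "'m topology \<Rightarrow> 'h::real_inner set \<Rightarrow> ('m, 'h) chart set \<Rightarrow> bool" where
  "hilbert_manifold X E A \<longleftrightarrow>
     subspace E \<and> complete E \<and> Hausdorff_space X \<and>
     (\<Union>c\<in>A. fst c) = topspace X \<and>
     (\<forall>c\<in>A. openin X (fst c) \<and> openin (top_of_set E) (chart_image c) \<and>
        homeomorphic_map (subtopology X (fst c)) (top_of_set (chart_image c)) (snd c)) \<and>
     (\<forall>c\<in>A. \<forall>d\<in>A. smooth_on (snd c ` (fst c \<inter> fst d)) (snd d \<circ> chart_inv c))"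

definition smooth_map_on ::
  "('m, 'h::real_inner) chart set \<Rightarrow> ('n, 'k::real_inner) chart set \<Rightarrow> 'm set \<Rightarrow> ('m \<Rightarrow> 'n) \<Rightarrow> bool"
  where
  "smooth_map_on A B U f \<longleftrightarrow>
     (\<forall>c\<in>A. \<forall>d\<in>B. smooth_on (snd c ` {x \<in> U \<inter> fst c. f x \<in> fst d}) (snd d \<circ> f \<circ> chart_inv c))"

definition local_diffeomorphism ::
  "'m topology \<Rightarrow> ('m, 'h::real_inner) chart set \<Rightarrow>
   'n topology \<Rightarrow> ('n, 'k::real_inner) chart set \<Rightarrow> ('m \<Rightarrow> 'n) \<Rightarrow> bool" where
  "local_diffeomorphism X A Y B f \<longleftrightarrow>
     (\<forall>x\<in>topspace X. \<exists>U. openin X U \<and> x \<in> U \<and> openin Y (f ` U) \<and>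
        homeomorphic_map (subtopology X U) (subtopology Y (f ` U)) f \<and>
        smooth_map_on A B U f \<and> smooth_map_on B A (f ` U) (inv_into U f))"

text \<open>
  The maximal atlas, modeled on \<open>E\<close>, of a subset \<open>S\<close> of an inner product space: all
  diffeomorphisms from relatively open subsets of \<open>S\<close> onto open subsets of \<open>E\<close>.
\<close>

definition submanifold_atlas :: "'h::real_inner set \<Rightarrow> 'h set \<Rightarrow> ('h, 'h) chart set" where
  "submanifold_atlas S E =
     {c. openin (top_of_set S) (fst c) \<and> openin (top_of_set E) (chart_image c) \<and>
         inj_on (snd c) (fst c) \<and>
         smooth_on (fst c) (snd c) \<and> smooth_on (chart_image c) (chart_inv c)}"

section \<open>Riemannian metrics\<close>

text \<open>
  A tangent vector at \<open>p\<close> is an equivalence class of pairs (chart around \<open>p\<close>, vector of \<open>E\<close>),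
  two pairs being equivalent if the derivative of the change of charts maps one vector to the
  other. \<open>tangent_vector A p c v\<close> is the class of \<open>(c, v)\<close>; thus \<open>tangent_vector A p c\<close> is the
  isomorphism of \<open>E\<close> with the tangent space at \<open>p\<close> that is given by the chart \<open>c\<close>.
\<close>

type_synonym ('m, 'h) tangent = "(('m, 'h) chart \<times> 'h) set"

definition tangent_vector ::
  "('m, 'h::real_inner) chart set \<Rightarrow> 'm \<Rightarrow> ('m, 'h) chart \<Rightarrow> 'h \<Rightarrow> ('m, 'h) tangent" where
  "tangent_vector A p c v =
     {(d, w). d \<in> A \<and> p \<in> fst d \<and> w = dir_deriv (snd d \<circ> chart_inv c) (snd c p) v}"

text \<open>
  A metric \<open>g\<close> takes a point and two tangent vectors at this point; \<open>metric_rep A g c x\<close> is the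
  corresponding form on \<open>E\<close> at the point of the chart \<open>c\<close> with coordinate \<open>x\<close>.
\<close>

type_synonym ('m, 'h) metric = "'m \<Rightarrow> ('m, 'h) tangent \<Rightarrow> ('m, 'h) tangent \<Rightarrow> real"

definition metric_rep ::
  "('m, 'h::real_inner) chart set \<Rightarrow> ('m, 'h) metric \<Rightarrow> ('m, 'h) chart \<Rightarrow> 'h \<Rightarrow> 'h \<Rightarrow> 'h \<Rightarrow> real"
  where
  "metric_rep A g c x v w =
     g (chart_inv c x) (tangent_vector A (chart_inv c x) c v) (tangent_vector A (chart_inv c x) c w)"

definition inner_product_on :: "'h::real_vector set \<Rightarrow> ('h \<Rightarrow> 'h \<Rightarrow> real) \<Rightarrow> bool" where
  "inner_product_on E B \<longleftrightarrow>
     (\<forall>u\<in>E. \<forall>v\<in>E. B u v = B v u) \<and>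
     (\<forall>u\<in>E. \<forall>v\<in>E. \<forall>w\<in>E. \<forall>a b. B (a *\<^sub>R u + b *\<^sub>R v) w = a * B u w + b * B v w) \<and>
     (\<forall>u\<in>E. u \<noteq> 0 \<longrightarrow> B u u > 0)"

text \<open>
  Smooth dependence on the base point is joint smoothness in the point and the two vectors, which
  for bilinear forms is the same as smoothness into the space of bounded bilinear forms.
\<close>

definition riemannian_metric ::
  "'h::real_inner set \<Rightarrow> ('m, 'h) chart set \<Rightarrow> ('m, 'h) metric \<Rightarrow> bool" where
  "riemannian_metric E A g \<longleftrightarrow>
     (\<forall>c\<in>A.
        (\<forall>x\<in>chart_image c.
           inner_product_on E (metric_rep A g c x) \<and>
           (\<exists>m>0. \<exists>M. \<forall>v\<in>E. m * norm v \<le> sqrt (metric_rep A g c x v v) \<and>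
              sqrt (metric_rep A g c x v v) \<le> M * norm v)) \<and>
        smooth_on (chart_image c \<times> E \<times> E) (\<lambda>(x, v, w). metric_rep A g c x v w))"

subsection \<open>Distance and completeness\<close>

definition C1_curve_on ::
  "'m topology \<Rightarrow> ('m, 'h::real_inner) chart set \<Rightarrow> real \<Rightarrow> real \<Rightarrow> (real \<Rightarrow> 'm) \<Rightarrow> bool" where
  "C1_curve_on X A a b \<gamma> \<longleftrightarrow>
     continuous_map (top_of_set {a..b}) X \<gamma> \<and>
     (\<forall>c\<in>A. \<exists>D.
        (\<forall>t\<in>{a..b}. \<gamma> t \<in> fst c \<longrightarrow> ((snd c \<circ> \<gamma>) has_vector_derivative D t) (at t within {a..b})) \<and>
        continuous_on {t \<in> {a..b}. \<gamma> t \<in> fst c} D)"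

definition piecewise_C1_curve ::
  "'m topology \<Rightarrow> ('m, 'h::real_inner) chart set \<Rightarrow> (real \<Rightarrow> 'm) \<Rightarrow> bool" where
  "piecewise_C1_curve X A \<gamma> \<longleftrightarrow>
     continuous_map (top_of_set {0..1}) X \<gamma> \<and>
     (\<exists>S. finite S \<and>
        (\<forall>a b. 0 \<le> a \<and> a < b \<and> b \<le> 1 \<and> {a<..<b} \<inter> S = {} \<longrightarrow> C1_curve_on X A a b \<gamma>))"

definition velocity ::
  "('m, 'h::real_inner) chart set \<Rightarrow> (real \<Rightarrow> 'm) \<Rightarrow> real \<Rightarrow> ('m, 'h) tangent" where
  "velocity A \<gamma> t =
     {(d, w). d \<in> A \<and> \<gamma> t \<in> fst d \<and> w = vector_derivative (snd d \<circ> \<gamma>) (at t)}"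

text \<open>The finitely many times at which the velocity is not defined do not affect the integral.\<close>

definition curve_length ::
  "('m, 'h::real_inner) chart set \<Rightarrow> ('m, 'h) metric \<Rightarrow> (real \<Rightarrow> 'm) \<Rightarrow> real" where
  "curve_length A g \<gamma> =
     integral {0..1} (\<lambda>t. sqrt (g (\<gamma> t) (velocity A \<gamma> t) (velocity A \<gamma> t)))"

text \<open>The distance of points in different components is infinite.\<close>

definition riemannian_dist ::
  "'m topology \<Rightarrow> ('m, 'h::real_inner) chart set \<Rightarrow> ('m, 'h) metric \<Rightarrow> 'm \<Rightarrow> 'm \<Rightarrow> ereal" where
  "riemannian_dist X A g p q =
     (INF \<gamma>\<in>{\<gamma>. piecewise_C1_curve X A \<gamma> \<and> \<gamma> 0 = p \<and> \<gamma> 1 = q}. ereal (curve_length A g \<gamma>))"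

text \<open>
  Symmetry and the triangle inequality are automatic (reverse and concatenate curves); the first
  conjunct is what remains of the distance being a (possibly infinite) metric.
\<close>

definition riemannian_complete ::
  "'m topology \<Rightarrow> ('m, 'h::real_inner) chart set \<Rightarrow> ('m, 'h) metric \<Rightarrow> bool" where
  "riemannian_complete X A g \<longleftrightarrow>
     (\<forall>p\<in>topspace X. \<forall>q\<in>topspace X. riemannian_dist X A g p q = 0 \<longleftrightarrow> p = q) \<and>
     (\<forall>\<sigma> :: nat \<Rightarrow> 'm. range \<sigma> \<subseteq> topspace X \<and>
        (\<forall>e>0. \<exists>N. \<forall>m\<ge>N. \<forall>n\<ge>N. riemannian_dist X A g (\<sigma> m) (\<sigma> n) < ereal e) \<longrightarrow>
        (\<exists>p\<in>topspace X. (\<lambda>n. riemannian_dist X A g (\<sigma> n) p) \<longlonglongrightarrow> 0))"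

subsection \<open>Sectional curvature\<close>

text \<open>
  Below, \<open>B x\<close> is the local representative of a metric at the point \<open>x\<close> of a chart. The
  Christoffel symbol of the Levi-Civita connection is given by the Koszul formula for constant
  vector fields, and \<open>riemann_tensor E B x u v w\<close> is \<open>R(u,v)w\<close> with the convention
  \<open>R(u,v) = [\<nabla>\<^sub>u, \<nabla>\<^sub>v]\<close> for constant \<open>u\<close> and \<open>v\<close>.
\<close>

definition christoffel ::
  "'h::real_inner set \<Rightarrow> ('h \<Rightarrow> 'h \<Rightarrow> 'h \<Rightarrow> real) \<Rightarrow> 'h \<Rightarrow> 'h \<Rightarrow> 'h \<Rightarrow> 'h" where
  "christoffel E B x v w =
     (THE z. z \<in> E \<and> (\<forall>u\<in>E. 2 * B x z u =
        dir_deriv (\<lambda>y. B y w u) x v + dir_deriv (\<lambda>y. B y v u) x w - dir_deriv (\<lambda>y. B y v w) x u))"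

definition riemann_tensor ::
  "'h::real_inner set \<Rightarrow> ('h \<Rightarrow> 'h \<Rightarrow> 'h \<Rightarrow> real) \<Rightarrow> 'h \<Rightarrow> 'h \<Rightarrow> 'h \<Rightarrow> 'h \<Rightarrow> 'h" where
  "riemann_tensor E B x u v w =
     dir_deriv (\<lambda>y. christoffel E B y v w) x u - dir_deriv (\<lambda>y. christoffel E B y u w) x v
     + christoffel E B x u (christoffel E B x v w) - christoffel E B x v (christoffel E B x u w)"

definition sectional_curvature ::
  "'h::real_inner set \<Rightarrow> ('h \<Rightarrow> 'h \<Rightarrow> 'h \<Rightarrow> real) \<Rightarrow> 'h \<Rightarrow> 'h \<Rightarrow> 'h \<Rightarrow> real" where
  "sectional_curvature E B x u v =
     B x (riemann_tensor E B x u v v) u / (B x u u * B x v v - (B x u v)\<^sup>2)"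

definition constant_sectional_curvature ::
  "'h::real_inner set \<Rightarrow> ('m, 'h) chart set \<Rightarrow> ('m, 'h) metric \<Rightarrow> real \<Rightarrow> bool" where
  "constant_sectional_curvature E A g k \<longleftrightarrow>
     (\<forall>c\<in>A. \<forall>x\<in>chart_image c. \<forall>u\<in>E. \<forall>v\<in>E. u \<noteq> v \<and> independent {u, v} \<longrightarrow>
        sectional_curvature E (metric_rep A g c) x u v = k)"

end

theory Submission
  imports Defs
begin

text \<open>
  A square-summable family exceeds a given positive bound at finitely many places only.
  If \<open>y\<close> does not vanish at \<open>h\<close> and \<open>x \<circ> R\<^sub>g\<close> is close to \<open>y\<close>, then \<open>x\<close> is large at \<open>h \<otimes> g\<close>, so that
  there are finitely many such \<open>g\<close> (\<open>finite_translates_near\<close>). Hence the orbit of \<open>x\<close> keeps a positive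
  distance from every point different from its own elements (\<open>translates_separated\<close>). Stabilizers are
  finite for the same reason, and therefore trivial in a group without torsion (\<open>translate_free\<close>).
  Translations act as linear isometries, so these two facts yield proper discontinuity.

  The rest of the proof uses nothing else about the action, and it is carried out in the
  locale \<open>free_isometric_action\<close>: a group acts by linear isometries on a complete subspace \<open>H\<close>, freely
  and with separated orbits on the unit sphere \<open>S\<close>. Stereographic projections from two opposite poles
  \<open>e\<close> and \<open>- e\<close> are charts of \<open>S\<close> with values in the same hyperplane \<open>E\<close>. Restricted to open sets on
  which the projection \<open>proj\<close> is injective, they are charts of the quotient. Near each point, \<open>proj\<close>
  followed by a local inverse of \<open>proj\<close> is one of the isometries (\<open>local_lift\<close>), so all changes of
  charts are compositions of smooth maps.

  In every chart the metric that comes from the sphere is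
  \<open>4 / (1 + |y|\<^sup>2)\<^sup>2 * \<langle>v, w\<rangle>\<close>. Its Christoffel symbols and its curvature tensor are computed explicitly
  (\<open>riemann_tensor_eq\<close>).

  A curve in the quotient lifts in small pieces, whence a curve from \<open>p\<close> to \<open>q\<close> of
  length \<open>L\<close> leads from every \<open>x \<in> p\<close> to some \<open>y \<in> q\<close> with \<open>dist x y \<le> L\<close>
  (\<open>curve_length_bound\<close>). Conversely, close points of \<open>S\<close> are joined by arcs whose length is at most
  \<open>sqrt 2\<close> times the chordal distance (\<open>riemannian_dist_le\<close>). A Cauchy sequence of the quotient
  therefore lifts, along a subsequence, to a Cauchy sequence of the complete set \<open>S\<close>.

  A map is smooth if it has a jet: multilinear maps \<open>D x vs\<close> that are obtained from
  each other by differentiation. It suffices to verify pointwise differentiability and local bounds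
  (\<open>smooth_on_open_of_jet_on\<close>). The jet of a composition is built by a recursive form of the formula of
  Faa di Bruno (\<open>smooth_on_open_compose\<close>).
\<close>

section \<open>Smooth maps through their jets\<close>

abbreviation prod_norm :: "'h::real_normed_vector list \<Rightarrow> real" where
  "prod_norm vs \<equiv> (\<Prod>v\<leftarrow>vs. norm v)"

text \<open>
  Each member of a jet is only required to be differentiable for fixed directions, with locally
  bounded norms. Uniformity in the directions, which smoothness demands, is then automatic
  (\<open>jet_on_uniform\<close>), whereas pointwise derivatives are easy to compute.
\<close>

definition jet_on ::
  "'h::real_normed_vector set \<Rightarrow> ('h \<Rightarrow> 'h list \<Rightarrow> 'k::real_normed_vector) \<Rightarrow> bool" where
  "jet_on W D \<longleftrightarrow> open W \<and>
     (\<forall>x\<in>W.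
        (\<forall>us ws. linear (\<lambda>v. D x (us @ v # ws))) \<and>
        (\<forall>n. \<exists>C. \<forall>\<^sub>F y in nhds x. \<forall>vs. length vs = n \<longrightarrow> norm (D y vs) \<le> C * prod_norm vs) \<and>
        (\<forall>vs. ((\<lambda>y. D y vs) has_derivative (\<lambda>v. D x (v # vs))) (at x)))"

lemma prod_norm_nonneg: "0 \<le> prod_norm vs"
  by (induction vs) auto

text \<open>
  The uniform first-order expansion at \<open>x\<close> bounds \<open>D y vs\<close> for \<open>y\<close> near \<open>x\<close> by the bounds at \<open>x\<close>
  in the orders \<open>n\<close> and \<open>n + 1\<close>; the derivative for fixed \<open>vs\<close> is the special case of one list.
\<close>

lemma jet_on_of_smooth_on_open:
  assumes "smooth_on_open W f"
  obtains D where "jet_on W D" "\<And>x. x \<in> W \<Longrightarrow> D x [] = f x"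
proof -
  obtain D where W: "open W" and D: "\<forall>x\<in>W.
        D x [] = f x \<and>
        (\<forall>us ws. linear (\<lambda>v. D x (us @ v # ws))) \<and>
        (\<forall>n. \<exists>C. \<forall>vs. length vs = n \<longrightarrow> norm (D x vs) \<le> C * prod_norm vs) \<and>
        (\<forall>n. \<forall>e>0. \<forall>\<^sub>F y in nhds x. \<forall>vs. length vs = n \<longrightarrow>
           norm (D y vs - D x vs - D x ((y - x) # vs)) \<le> e * norm (y - x) * prod_norm vs)"
    using assms unfolding smooth_on_open_def by blast
  have "jet_on W D"
    unfolding jet_on_def
  proof (intro conjI ballI allI W)
    fix x us ws assume "x \<in> W"
    then show "linear (\<lambda>v. D x (us @ v # ws))" using D by blast
  next
    fix x n assume x: "x \<in> W"
    obtain C0 where C0: "\<And>vs. length vs = n \<Longrightarrow> norm (D x vs) \<le> C0 * prod_norm vs"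
      using D x by blast
    obtain C1 where C1: "\<And>vs. length vs = Suc n \<Longrightarrow> norm (D x vs) \<le> C1 * prod_norm vs"
      using D x by blast
    have ev: "\<forall>\<^sub>F y in nhds x. \<forall>vs. length vs = n \<longrightarrow>
           norm (D y vs - D x vs - D x ((y - x) # vs)) \<le> 1 * norm (y - x) * prod_norm vs"
      using D x zero_less_one by blast
    have near: "\<forall>\<^sub>F y in nhds x. norm (y - x) < 1"
      using eventually_nhds_ball[of 1 x] by (auto elim!: eventually_mono simp: dist_norm norm_minus_commute)
    have "\<forall>\<^sub>F y in nhds x. \<forall>vs. length vs = n \<longrightarrow> norm (D y vs) \<le> (C0 + \<bar>C1\<bar> + 1) * prod_norm vs"
      using ev near
    proof eventually_elim
      case (elim y)
      show ?case
      proof (intro allI impI)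
        fix vs :: "'a list" assume len: "length vs = n"
        have P: "0 \<le> prod_norm vs" by (rule prod_norm_nonneg)
        have "norm (D y vs - D x vs - D x ((y - x) # vs)) \<le> norm (y - x) * prod_norm vs"
          using elim(1) len by auto
        also have "\<dots> \<le> 1 * prod_norm vs"
          using elim(2) P by (intro mult_right_mono) auto
        finally have 1: "norm (D y vs - D x vs - D x ((y - x) # vs)) \<le> prod_norm vs" by simp
        have "norm (D x ((y - x) # vs)) \<le> C1 * (norm (y - x) * prod_norm vs)"
          using C1[of "(y - x) # vs"] len by simp
        also have "\<dots> \<le> \<bar>C1\<bar> * (1 * prod_norm vs)"
          using elim(2) P by (intro mult_mono) auto
        finally have 2: "norm (D x ((y - x) # vs)) \<le> \<bar>C1\<bar> * prod_norm vs" by simp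
        have "norm (D y vs) \<le> norm (D y vs - D x vs - D x ((y - x) # vs)) + norm (D x vs)
            + norm (D x ((y - x) # vs))"
          using norm_triangle_ineq[of "D y vs - D x vs - D x ((y - x) # vs)" "D x vs + D x ((y - x) # vs)"]
            norm_triangle_ineq[of "D x vs" "D x ((y - x) # vs)"] by simp
        then show "norm (D y vs) \<le> (C0 + \<bar>C1\<bar> + 1) * prod_norm vs"
          using 1 2 C0[OF len] by (simp add: algebra_simps)
      qed
    qed
    then show "\<exists>C. \<forall>\<^sub>F y in nhds x. \<forall>vs. length vs = n \<longrightarrow> norm (D y vs) \<le> C * prod_norm vs"
      by blast
  next
    fix x and vs :: "'a list" assume x: "x \<in> W"
    obtain C where C: "\<And>us. length us = Suc (length vs) \<Longrightarrow> norm (D x us) \<le> C * prod_norm us"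
      using D x by blast
    have "linear (\<lambda>v. D x ([] @ v # vs))" using D x by blast
    then have lin: "linear (\<lambda>v. D x (v # vs))" by simp
    have bl: "bounded_linear (\<lambda>v. D x (v # vs))"
    proof (rule bounded_linear_intro[where K = "C * prod_norm vs"])
      show "D x ((u + v) # vs) = D x (u # vs) + D x (v # vs)" for u v by (rule linear_add[OF lin])
      show "D x ((r *\<^sub>R v) # vs) = r *\<^sub>R D x (v # vs)" for r v by (rule linear_scale[OF lin])
      show "norm (D x (v # vs)) \<le> norm v * (C * prod_norm vs)" for v
        using C[of "v # vs"] by (simp add: mult_ac)
    qed
    show "((\<lambda>y. D y vs) has_derivative (\<lambda>v. D x (v # vs))) (at x)"
      unfolding has_derivative_within_alt
    proof (intro conjI bl allI impI)
      fix e :: real assume e: "0 < e"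
      let ?e = "e / (prod_norm vs + 1)"
      have P: "0 \<le> prod_norm vs" by (rule prod_norm_nonneg)
      have "0 < ?e" using e P by auto
      then have "\<forall>\<^sub>F y in nhds x. \<forall>us. length us = length vs \<longrightarrow>
           norm (D y us - D x us - D x ((y - x) # us)) \<le> ?e * norm (y - x) * prod_norm us"
        using D x by blast
      then obtain d where d: "d > 0" "\<And>y. dist y x < d \<Longrightarrow>
           norm (D y vs - D x vs - D x ((y - x) # vs)) \<le> ?e * norm (y - x) * prod_norm vs"
        unfolding eventually_nhds_metric by blast
      have "?e * norm (y - x) * prod_norm vs \<le> e * norm (y - x)" for y
      proof -
        have "?e * prod_norm vs \<le> e" using e P by (simp add: field_simps)
        then have "(?e * prod_norm vs) * norm (y - x) \<le> e * norm (y - x)"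
          by (rule mult_right_mono) simp
        then show ?thesis by (simp only: mult_ac)
      qed
      then show "\<exists>d>0. \<forall>y\<in>UNIV. norm (y - x) < d \<longrightarrow>
          norm (D y vs - D x vs - D x ((y - x) # vs)) \<le> e * norm (y - x)"
        using d unfolding dist_norm by (intro exI[of _ d]) (auto intro: order_trans)
    qed
  qed
  with D that show thesis by blast
qed

lemma jet_on_bound:
  assumes "jet_on W D" "x \<in> W"
  obtains C where "C \<ge> 0" "\<And>vs. length vs = n \<Longrightarrow> norm (D x vs) \<le> C * prod_norm vs"
proof -
  obtain C where "\<forall>\<^sub>F y in nhds x. \<forall>vs. length vs = n \<longrightarrow> norm (D y vs) \<le> C * prod_norm vs"
    using assms unfolding jet_on_def by blast
  then have C: "\<And>vs. length vs = n \<Longrightarrow> norm (D x vs) \<le> C * prod_norm vs"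
    using eventually_nhds_x_imp_x by fastforce
  have "norm (D x vs) \<le> \<bar>C\<bar> * prod_norm vs" if "length vs = n" for vs
    using C[OF that] by (meson abs_ge_self mult_right_mono order_trans prod_norm_nonneg)
  then show ?thesis using that[of "\<bar>C\<bar>"] by simp
qed

lemma jet_on_linear:
  assumes "jet_on W D" "x \<in> W"
  shows "linear (\<lambda>v. D x (us @ v # ws))"
  using assms unfolding jet_on_def by blast

lemma jet_on_deriv:
  assumes "jet_on W D" "x \<in> W"
  shows "((\<lambda>y. D y vs) has_derivative (\<lambda>v. D x (v # vs))) (at x)"
  using assms unfolding jet_on_def by blast

text \<open>
  The mean value theorem, applied twice: the local bound in order \<open>n + 2\<close> makes the members of
  order \<open>n + 1\<close> Lipschitz, and this bounds the derivative of the remainder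
  \<open>z \<mapsto> D z vs - D x ((z - x) # vs)\<close>, always uniformly in \<open>vs\<close>.
\<close>

lemma jet_on_uniform:
  fixes D :: "'h::real_normed_vector \<Rightarrow> 'h list \<Rightarrow> 'k::real_normed_vector"
  assumes jet: "jet_on W D" and x: "x \<in> W" and e: "e > 0"
  shows "\<forall>\<^sub>F y in nhds x. \<forall>vs. length vs = n \<longrightarrow>
           norm (D y vs - D x vs - D x ((y - x) # vs)) \<le> e * norm (y - x) * prod_norm vs"
proof -
  obtain C where "\<forall>\<^sub>F y in nhds x. \<forall>vs. length vs = n + 2 \<longrightarrow> norm (D y vs) \<le> C * prod_norm vs"
    using jet x unfolding jet_on_def by blast
  moreover have "\<forall>\<^sub>F y in nhds x. y \<in> W"
    using jet x unfolding jet_on_def by (simp add: eventually_nhds_in_open)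
  ultimately have "\<forall>\<^sub>F y in nhds x. y \<in> W \<and> (\<forall>vs. length vs = n + 2 \<longrightarrow> norm (D y vs) \<le> C * prod_norm vs)"
    by eventually_elim blast
  then obtain r where r: "r > 0" and W: "\<And>y. y \<in> ball x r \<Longrightarrow> y \<in> W"
    and C: "\<And>y vs. y \<in> ball x r \<Longrightarrow> length vs = n + 2 \<Longrightarrow> norm (D y vs) \<le> C * prod_norm vs"
    unfolding eventually_nhds_metric by (metis dist_commute mem_ball)
  define d where "d = min r (e / (\<bar>C\<bar> + 1))"
  have d: "d > 0" "d \<le> r" "\<bar>C\<bar> * d \<le> e"
  proof -
    show "d > 0" "d \<le> r" using r e by (auto simp: d_def)
    have "\<bar>C\<bar> * d \<le> \<bar>C\<bar> * (e / (\<bar>C\<bar> + 1))" by (intro mult_left_mono) (auto simp: d_def)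
    also have "\<dots> \<le> e" using e by (simp add: field_simps)
    finally show "\<bar>C\<bar> * d \<le> e" .
  qed
  have lip: "norm (D y (v # vs) - D x (v # vs)) \<le> \<bar>C\<bar> * norm v * prod_norm vs * norm (y - x)"
    if y: "y \<in> ball x d" and len: "length vs = n" for y v vs
  proof (rule differentiable_bound[where f' = "\<lambda>y u. D y (u # v # vs)" and S = "ball x d"])
    fix z assume z: "z \<in> ball x d"
    then have zr: "z \<in> ball x r" using d by auto
    show "((\<lambda>y. D y (v # vs)) has_derivative (\<lambda>u. D z (u # v # vs))) (at z within ball x d)"
      using jet_on_deriv[OF jet W[OF zr]] has_derivative_at_withinI by blast
    show "onorm (\<lambda>u. D z (u # v # vs)) \<le> \<bar>C\<bar> * norm v * prod_norm vs"
    proof (rule onorm_bound)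
      show "0 \<le> \<bar>C\<bar> * norm v * prod_norm vs" using prod_norm_nonneg[of vs] by simp
      fix u
      have "norm (D z (u # v # vs)) \<le> C * prod_norm (u # v # vs)"
        by (rule C[OF zr]) (simp add: len)
      also have "\<dots> \<le> \<bar>C\<bar> * prod_norm (u # v # vs)" by (intro mult_right_mono prod_norm_nonneg) simp
      finally show "norm (D z (u # v # vs)) \<le> \<bar>C\<bar> * norm v * prod_norm vs * norm u"
        by (simp add: mult_ac)
    qed
  qed (use y d in auto)
  have main: "norm (D y vs - D x vs - D x ((y - x) # vs)) \<le> e * norm (y - x) * prod_norm vs"
    if y: "y \<in> ball x d" and len: "length vs = n" for y vs
  proof -
    have P: "0 \<le> prod_norm vs" by (rule prod_norm_nonneg)
    have bl: "bounded_linear (\<lambda>v. D z (v # vs))" if "z \<in> ball x d" for z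
      using has_derivative_bounded_linear[OF jet_on_deriv[OF jet W]] that d by auto
    have xd: "x \<in> ball x d" using d by auto
    let ?\<phi> = "\<lambda>z. D z vs - D x ((z - x) # vs)"
    have "norm (?\<phi> y - ?\<phi> x) \<le> e * prod_norm vs * norm (y - x)"
    proof (rule differentiable_bound[where f' = "\<lambda>z v. D z (v # vs) - D x (v # vs)" and S = "ball x d"])
      fix z assume z: "z \<in> ball x d"
      have "((\<lambda>z. D x ((z - x) # vs)) has_derivative (\<lambda>v. D x (v # vs))) (at z within ball x d)"
        by (rule bounded_linear.has_derivative[OF bl[OF xd]]) (auto intro!: derivative_eq_intros)
      moreover have "((\<lambda>y. D y vs) has_derivative (\<lambda>u. D z (u # vs))) (at z within ball x d)"
        by (rule has_derivative_at_withinI[OF jet_on_deriv[OF jet W]]) (use z d in auto)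
      ultimately show "(?\<phi> has_derivative (\<lambda>v. D z (v # vs) - D x (v # vs))) (at z within ball x d)"
        by (rule has_derivative_diff[rotated])
      show "onorm (\<lambda>v. D z (v # vs) - D x (v # vs)) \<le> e * prod_norm vs"
      proof (rule onorm_bound)
        show "0 \<le> e * prod_norm vs" using e P by simp
        fix v
        have "norm (D z (v # vs) - D x (v # vs)) \<le> \<bar>C\<bar> * norm v * prod_norm vs * norm (z - x)"
          using lip[OF z len] .
        also have "\<dots> \<le> \<bar>C\<bar> * norm v * prod_norm vs * d"
          using z P by (intro mult_left_mono) (auto simp: dist_norm norm_minus_commute)
        also have "\<dots> = (\<bar>C\<bar> * d) * (norm v * prod_norm vs)" by simp
        also have "\<dots> \<le> e * (norm v * prod_norm vs)"
          using d(3) P by (intro mult_right_mono) auto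
        finally show "norm (D z (v # vs) - D x (v # vs)) \<le> e * prod_norm vs * norm v"
          by (simp add: mult_ac)
      qed
    qed (use y xd in auto)
    moreover have "D x (0 # vs) = 0" using bl[OF xd] linear_0[OF bounded_linear.linear] by blast
    ultimately show ?thesis by (simp add: mult_ac algebra_simps)
  qed
  show ?thesis
    unfolding eventually_nhds_metric using main d by (metis dist_commute mem_ball)
qed

lemma smooth_on_open_of_jet_on:
  assumes jet: "jet_on W D" and D: "\<And>x. x \<in> W \<Longrightarrow> D x [] = f x"
  shows "smooth_on_open W f"
  unfolding smooth_on_open_def
proof (intro conjI exI[of _ D] ballI allI impI)
  show "open W" using jet by (simp add: jet_on_def)
  fix x assume x: "x \<in> W"
  show "D x [] = f x" by (rule D[OF x])
  show "linear (\<lambda>v. D x (us @ v # ws))" for us ws by (rule jet_on_linear[OF jet x])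
  show "\<exists>C. \<forall>vs. length vs = n \<longrightarrow> norm (D x vs) \<le> C * prod_norm vs" for n
    using jet_on_bound[OF jet x] by metis
  show "\<forall>\<^sub>F y in nhds x. \<forall>vs. length vs = n \<longrightarrow>
      norm (D y vs - D x vs - D x ((y - x) # vs)) \<le> e * norm (y - x) * prod_norm vs" if "e > 0" for n e
    by (rule jet_on_uniform[OF jet x that])
qed

section \<open>The chain rule for jets\<close>

text \<open>
  All ways of putting a new direction into one of the blocks of directions. In the chain rule these
  are the terms in which one of the inner derivatives is differentiated once more.
\<close>

primrec inserts :: "'h \<Rightarrow> 'h list list \<Rightarrow> 'h list list list" where
  "inserts v [] = []"
| "inserts v (B # Bs) = ((v # B) # Bs) # map ((#) B) (inserts v Bs)"

text \<open>
  The derivative at \<open>x\<close> of a family of multilinear maps, uniformly in the arguments. Uniformity is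
  what allows the arguments to be replaced by functions of the base point, one after the other
  (\<open>multilinear_derivative_Cons\<close>).
\<close>

definition multilinear_derivative ::
  "('h::real_normed_vector \<Rightarrow> 'k::real_normed_vector list \<Rightarrow> 'l::real_normed_vector) \<Rightarrow>
   ('h \<Rightarrow> 'k list \<Rightarrow> 'l) \<Rightarrow> 'h \<Rightarrow> bool" where
  "multilinear_derivative \<Psi> \<Psi>' x \<longleftrightarrow>
     (\<forall>us ws. linear (\<lambda>w. \<Psi> x (us @ w # ws))) \<and>
     (\<forall>v us ws. linear (\<lambda>w. \<Psi>' v (us @ w # ws))) \<and>
     (\<forall>vs. linear (\<lambda>v. \<Psi>' v vs)) \<and>
     (\<forall>n. \<exists>C\<ge>0. \<forall>vs. length vs = n \<longrightarrow> norm (\<Psi> x vs) \<le> C * prod_norm vs) \<and>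
     (\<forall>n. \<exists>C\<ge>0. \<forall>v vs. length vs = n \<longrightarrow> norm (\<Psi>' v vs) \<le> C * norm v * prod_norm vs) \<and>
     (\<forall>n. \<forall>e>0. \<forall>\<^sub>F y in nhds x. \<forall>vs. length vs = n \<longrightarrow>
        norm (\<Psi> y vs - \<Psi> x vs - \<Psi>' (y - x) vs) \<le> e * norm (y - x) * prod_norm vs)"

lemma multilinear_derivativeD:
  assumes "multilinear_derivative \<Psi> \<Psi>' x"
  shows "linear (\<lambda>w. \<Psi> x (us @ w # ws))"
    and "linear (\<lambda>w. \<Psi>' v (us @ w # ws))"
    and "linear (\<lambda>v. \<Psi>' v vs)"
    and "\<exists>C\<ge>0. \<forall>vs. length vs = n \<longrightarrow> norm (\<Psi> x vs) \<le> C * prod_norm vs"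
    and "\<exists>C\<ge>0. \<forall>v vs. length vs = n \<longrightarrow> norm (\<Psi>' v vs) \<le> C * norm v * prod_norm vs"
    and "e > 0 \<Longrightarrow> \<forall>\<^sub>F y in nhds x. \<forall>vs. length vs = n \<longrightarrow>
        norm (\<Psi> y vs - \<Psi> x vs - \<Psi>' (y - x) vs) \<le> e * norm (y - x) * prod_norm vs"
  using assms unfolding multilinear_derivative_def by simp_all

lemma has_derivative_nhds_bound:
  assumes "(f has_derivative f') (at x)" "e > 0"
  shows "\<forall>\<^sub>F y in nhds x. norm (f y - f x - f' (y - x)) \<le> e * norm (y - x)"
  using assms unfolding has_derivative_within_alt eventually_nhds_metric by (auto simp: dist_norm)

lemma has_derivative_nhds_lipschitz:
  assumes "(f has_derivative f') (at x)"
  obtains L where "L \<ge> 0" "\<forall>\<^sub>F y in nhds x. norm (f y - f x) \<le> L * norm (y - x)"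
proof -
  interpret bounded_linear f' using assms by (rule has_derivative_bounded_linear)
  obtain K where K: "K \<ge> 0" "\<And>v. norm (f' v) \<le> norm v * K" using nonneg_bounded by blast
  have "\<forall>\<^sub>F y in nhds x. norm (f y - f x) \<le> (1 + K) * norm (y - x)"
    using has_derivative_nhds_bound[OF assms zero_less_one]
  proof eventually_elim
    case (elim y)
    have "norm (f y - f x) \<le> norm (f y - f x - f' (y - x)) + norm (f' (y - x))"
      by (metis add.commute norm_triangle_sub)
    then show ?case using elim K(2)[of "y - x"] by (simp add: algebra_simps)
  qed
  with that K(1) show ?thesis by (metis add_nonneg_nonneg zero_le_one)
qed

text \<open>
  The product rule for a multilinear map and its first argument. The remainder has three parts: the
  remainder of \<open>\<Psi>\<close>, the mixed second-order term, and the remainder of \<open>a\<close>.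
\<close>

lemma multilinear_derivative_Cons:
  fixes a :: "'h::real_normed_vector \<Rightarrow> 'k::real_normed_vector"
    and \<Psi> :: "'h \<Rightarrow> 'k list \<Rightarrow> 'l::real_normed_vector"
  assumes \<Psi>: "multilinear_derivative \<Psi> \<Psi>' x" and a: "(a has_derivative a') (at x)"
  shows "multilinear_derivative (\<lambda>y ws. \<Psi> y (a y # ws)) (\<lambda>v ws. \<Psi>' v (a x # ws) + \<Psi> x (a' v # ws)) x"
proof -
  have lin1: "linear (\<lambda>w. \<Psi> x (us @ w # ws))"
    and lin2: "linear (\<lambda>w. \<Psi>' v (us @ w # ws))"
    and lin3: "linear (\<lambda>v. \<Psi>' v vs)" for us ws v vs
    by (rule multilinear_derivativeD[OF \<Psi>])+
  have lin_a: "linear a'" using a by (simp add: bounded_linear.linear has_derivative_bounded_linear)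
  obtain K where K: "K \<ge> 0" "\<And>v. norm (a' v) \<le> norm v * K"
    using bounded_linear.nonneg_bounded[OF has_derivative_bounded_linear[OF a]] by blast
  have est: "\<forall>\<^sub>F y in nhds x. \<forall>vs. length vs = n \<longrightarrow>
        norm (\<Psi> y (a y # vs) - \<Psi> x (a x # vs) - (\<Psi>' (y - x) (a x # vs) + \<Psi> x (a' (y - x) # vs)))
        \<le> e * norm (y - x) * prod_norm vs" if e: "e > 0" for n e
  proof -
    obtain C where C: "C \<ge> 0" "\<And>vs. length vs = Suc n \<Longrightarrow> norm (\<Psi> x vs) \<le> C * prod_norm vs"
      using multilinear_derivativeD(4)[OF \<Psi>, of "Suc n"] by blast
    obtain C' where C': "C' \<ge> 0" "\<And>v vs. length vs = Suc n \<Longrightarrow> norm (\<Psi>' v vs) \<le> C' * norm v * prod_norm vs"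
      using multilinear_derivativeD(5)[OF \<Psi>, of "Suc n"] by blast
    obtain L where L: "L \<ge> 0" "\<forall>\<^sub>F y in nhds x. norm (a y - a x) \<le> L * norm (y - x)"
      using has_derivative_nhds_lipschitz[OF a] .
    \<comment> \<open>The three parts of the remainder get \<open>e / 3\<close> each; \<open>e3\<close> also ensures \<open>norm (a y) \<le> norm (a x) + 1\<close>.\<close>
    define e1 where "e1 = e / (3 * (norm (a x) + 1))"
    define e2 where "e2 = e / (3 * (C + 1))"
    define e3 where "e3 = min (e / (3 * (C' * L + 1))) (1 / (L + 1))"
    have pos: "e1 > 0" "e2 > 0" "e3 > 0"
      using e C(1) C'(1) L(1) by (auto simp: e1_def e2_def e3_def add_nonneg_pos)
    have ev1: "\<forall>\<^sub>F y in nhds x. \<forall>vs. length vs = Suc n \<longrightarrow>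
        norm (\<Psi> y vs - \<Psi> x vs - \<Psi>' (y - x) vs) \<le> e1 * norm (y - x) * prod_norm vs"
      by (rule multilinear_derivativeD(6)[OF \<Psi> pos(1)])
    have ev2: "\<forall>\<^sub>F y in nhds x. norm (a y - a x - a' (y - x)) \<le> e2 * norm (y - x)"
      by (rule has_derivative_nhds_bound[OF a pos(2)])
    have ev3: "\<forall>\<^sub>F y in nhds x. norm (y - x) < e3"
      using pos(3) unfolding eventually_nhds_metric dist_norm by blast
    show ?thesis
      using ev1 ev2 ev3 L(2)
    proof eventually_elim
      case (elim y)
      show ?case
      proof (intro allI impI)
        fix vs :: "'k list" assume len: "length vs = n"
        have P: "0 \<le> prod_norm vs" by (rule prod_norm_nonneg)
        let ?N = "norm (y - x) * prod_norm vs"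
        have N: "0 \<le> ?N" using P by simp
        have small: "L * norm (y - x) \<le> 1" "C' * L * norm (y - x) \<le> e / 3"
        proof -
          have "L * norm (y - x) \<le> L * (1 / (L + 1))"
            using elim(3) L(1) by (intro mult_left_mono) (auto simp: e3_def)
          also have "\<dots> \<le> 1" using L(1) by (simp add: field_simps)
          finally show "L * norm (y - x) \<le> 1" .
          have CL: "0 \<le> C' * L" using L(1) C'(1) by simp
          have "C' * L * norm (y - x) \<le> C' * L * (e / (3 * (C' * L + 1)))"
            using elim(3) CL by (intro mult_left_mono) (auto simp: e3_def)
          also have "\<dots> \<le> e / 3" using CL e by (simp add: field_simps add_nonneg_pos)
          finally show "C' * L * norm (y - x) \<le> e / 3" .
        qed
        have ay: "norm (a y) \<le> norm (a x) + 1"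
          using elim(4) small(1) norm_triangle_sub[of "a y" "a x"] by linarith
        have "norm (\<Psi> y (a y # vs) - \<Psi> x (a y # vs) - \<Psi>' (y - x) (a y # vs))
            \<le> e1 * norm (y - x) * (norm (a y) * prod_norm vs)"
          using elim(1)[rule_format, of "a y # vs"] len by simp
        also have "\<dots> = (e1 * norm (a y)) * ?N" by simp
        also have "\<dots> \<le> (e1 * (norm (a x) + 1)) * ?N"
          using ay pos(1) N by (intro mult_right_mono mult_left_mono) auto
        also have "e1 * (norm (a x) + 1) = e / 3"
          using norm_ge_zero[of "a x"] by (simp add: e1_def field_simps add_nonneg_eq_0_iff)
        finally have t1: "norm (\<Psi> y (a y # vs) - \<Psi> x (a y # vs) - \<Psi>' (y - x) (a y # vs)) \<le> e / 3 * ?N" .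
        have "norm (\<Psi>' (y - x) ((a y - a x) # vs)) \<le> C' * norm (y - x) * (norm (a y - a x) * prod_norm vs)"
          using C'(2)[of "(a y - a x) # vs" "y - x"] len by simp
        also have "\<dots> = (C' * norm (a y - a x)) * ?N" by simp
        also have "\<dots> \<le> (C' * (L * norm (y - x))) * ?N"
          using elim(4) C'(1) N by (intro mult_right_mono mult_left_mono) auto
        also have "\<dots> \<le> e / 3 * ?N"
          using small(2) N by (intro mult_right_mono) (auto simp: mult.assoc)
        finally have t2: "norm (\<Psi>' (y - x) ((a y - a x) # vs)) \<le> e / 3 * ?N" .
        have "norm (\<Psi> x ((a y - a x - a' (y - x)) # vs)) \<le> C * (norm (a y - a x - a' (y - x)) * prod_norm vs)"
          using C(2)[of "(a y - a x - a' (y - x)) # vs"] len by simp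
        also have "\<dots> \<le> C * ((e2 * norm (y - x)) * prod_norm vs)"
          using elim(2) C(1) P by (intro mult_right_mono mult_left_mono) auto
        also have "\<dots> = (C * e2) * ?N" by simp
        also have "\<dots> \<le> e / 3 * ?N"
          using N C(1) e by (intro mult_right_mono) (auto simp: e2_def field_simps)
        finally have t3: "norm (\<Psi> x ((a y - a x - a' (y - x)) # vs)) \<le> e / 3 * ?N" .
        have d1: "\<Psi>' (y - x) ((a y - a x) # vs) = \<Psi>' (y - x) (a y # vs) - \<Psi>' (y - x) (a x # vs)"
          using linear_diff[OF lin2[of "y - x" "[]" vs]] by simp
        have d2: "\<Psi> x ((a y - a x - a' (y - x)) # vs) = \<Psi> x (a y # vs) - \<Psi> x (a x # vs) - \<Psi> x (a' (y - x) # vs)"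
          using linear_diff[OF lin1[of "[]" vs]] by simp
        have "\<Psi> y (a y # vs) - \<Psi> x (a x # vs) - (\<Psi>' (y - x) (a x # vs) + \<Psi> x (a' (y - x) # vs))
            = (\<Psi> y (a y # vs) - \<Psi> x (a y # vs) - \<Psi>' (y - x) (a y # vs))
              + \<Psi>' (y - x) ((a y - a x) # vs) + \<Psi> x ((a y - a x - a' (y - x)) # vs)"
          unfolding d1 d2 by simp
        also have "norm \<dots> \<le> e / 3 * ?N + e / 3 * ?N + e / 3 * ?N"
          by (intro norm_triangle_le add_mono t1 t2 t3)
        finally show "norm (\<Psi> y (a y # vs) - \<Psi> x (a x # vs) - (\<Psi>' (y - x) (a x # vs) + \<Psi> x (a' (y - x) # vs)))
            \<le> e * norm (y - x) * prod_norm vs" by (simp add: algebra_simps)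
      qed
    qed
  qed
  have b1: "\<exists>C\<ge>0. \<forall>vs. length vs = n \<longrightarrow> norm (\<Psi> x (a x # vs)) \<le> C * prod_norm vs" for n
  proof -
    obtain C where C: "C \<ge> 0" "\<And>vs. length vs = Suc n \<Longrightarrow> norm (\<Psi> x vs) \<le> C * prod_norm vs"
      using multilinear_derivativeD(4)[OF \<Psi>, of "Suc n"] by blast
    show ?thesis
      using C(1) C(2)[of "a x # _"] by (intro exI[of _ "C * norm (a x)"]) (simp add: mult.assoc)
  qed
  have b2: "\<exists>C\<ge>0. \<forall>v vs. length vs = n \<longrightarrow>
      norm (\<Psi>' v (a x # vs) + \<Psi> x (a' v # vs)) \<le> C * norm v * prod_norm vs" for n
  proof -
    obtain C where C: "C \<ge> 0" "\<And>vs. length vs = Suc n \<Longrightarrow> norm (\<Psi> x vs) \<le> C * prod_norm vs"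
      using multilinear_derivativeD(4)[OF \<Psi>, of "Suc n"] by blast
    obtain C' where C': "C' \<ge> 0" "\<And>v vs. length vs = Suc n \<Longrightarrow> norm (\<Psi>' v vs) \<le> C' * norm v * prod_norm vs"
      using multilinear_derivativeD(5)[OF \<Psi>, of "Suc n"] by blast
    have "norm (\<Psi>' v (a x # vs) + \<Psi> x (a' v # vs)) \<le> (C' * norm (a x) + C * K) * norm v * prod_norm vs"
      if len: "length vs = n" for v vs
    proof -
      have 1: "norm (\<Psi>' v (a x # vs)) \<le> C' * norm v * (norm (a x) * prod_norm vs)"
        using C'(2)[of "a x # vs" v] len by simp
      have "norm (\<Psi> x (a' v # vs)) \<le> C * (norm (a' v) * prod_norm vs)"
        using C(2)[of "a' v # vs"] len by simp
      also have "\<dots> \<le> C * ((norm v * K) * prod_norm vs)"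
        using K C(1) prod_norm_nonneg[of vs] by (intro mult_left_mono mult_right_mono) auto
      finally show ?thesis
        using 1 norm_triangle_ineq[of "\<Psi>' v (a x # vs)" "\<Psi> x (a' v # vs)"]
        by (simp add: algebra_simps)
    qed
    then show ?thesis using C(1) C'(1) K(1) by (intro exI[of _ "C' * norm (a x) + C * K"]) auto
  qed
  have l3: "linear (\<lambda>v. \<Psi> x (a' v # vs))" for vs
    using linear_compose[OF lin_a lin1[of "[]" vs]] by (simp add: comp_def)
  show ?thesis
    unfolding multilinear_derivative_def
  proof (intro conjI allI impI)
    show "linear (\<lambda>w. \<Psi> x (a x # us @ w # ws))" for us ws
      using lin1[of "a x # us" ws] by simp
    show "linear (\<lambda>w. \<Psi>' v (a x # us @ w # ws) + \<Psi> x (a' v # us @ w # ws))" for v us ws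
      using linear_compose_add[OF lin2[of v "a x # us" ws] lin1[of "a' v # us" ws]] by simp
    show "linear (\<lambda>v. \<Psi>' v (a x # vs) + \<Psi> x (a' v # vs))" for vs
      by (intro linear_compose_add lin3 l3)
  qed (fact b1, fact b2, rule est)
qed

text \<open>
  The arguments \<open>Df y B\<close> are consumed from the left by \<open>multilinear_derivative_Cons\<close>, each of them
  contributing the term in which the new direction enters its block.
\<close>

lemma multilinear_derivative_blocks:
  fixes \<Psi> :: "'h::real_normed_vector \<Rightarrow> 'k::real_normed_vector list \<Rightarrow> 'l::real_normed_vector"
  assumes "multilinear_derivative \<Psi> \<Psi>' x" and Df: "jet_on W Df" and x: "x \<in> W"
  shows "((\<lambda>y. \<Psi> y (map (Df y) Bs)) has_derivative
           (\<lambda>v. \<Psi>' v (map (Df x) Bs) + (\<Sum>Cs\<leftarrow>inserts v Bs. \<Psi> x (map (Df x) Cs)))) (at x)"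
  using assms(1)
proof (induction Bs arbitrary: \<Psi> \<Psi>')
  case Nil
  have "\<exists>C\<ge>0. \<forall>v vs. length vs = 0 \<longrightarrow> norm (\<Psi>' v vs) \<le> C * norm v * prod_norm vs"
    by (rule multilinear_derivativeD(5)[OF Nil])
  then obtain C where C: "\<And>v. norm (\<Psi>' v []) \<le> C * norm v" by force
  have lin: "linear (\<lambda>v. \<Psi>' v [])" by (rule multilinear_derivativeD(3)[OF Nil])
  have "((\<lambda>y. \<Psi> y []) has_derivative (\<lambda>v. \<Psi>' v [])) (at x)"
    unfolding has_derivative_within_alt
  proof (intro conjI allI impI)
    show "bounded_linear (\<lambda>v. \<Psi>' v [])"
      unfolding bounded_linear_def bounded_linear_axioms_def
      using lin C by (auto simp: mult.commute)
    fix e :: real assume "0 < e"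
    from multilinear_derivativeD(6)[OF Nil this, of 0]
    have "\<forall>\<^sub>F y in nhds x. \<forall>vs. length vs = 0 \<longrightarrow>
        norm (\<Psi> y vs - \<Psi> x vs - \<Psi>' (y - x) vs) \<le> e * norm (y - x) * prod_norm vs" .
    then show "\<exists>d>0. \<forall>y\<in>UNIV. norm (y - x) < d \<longrightarrow> norm (\<Psi> y [] - \<Psi> x [] - \<Psi>' (y - x) []) \<le> e * norm (y - x)"
      unfolding eventually_nhds_metric dist_norm by fastforce
  qed
  then show ?case by simp
next
  case (Cons B Bs)
  have a: "((\<lambda>y. Df y B) has_derivative (\<lambda>v. Df x (v # B))) (at x)"
    by (rule jet_on_deriv[OF Df x])
  from Cons.IH[OF multilinear_derivative_Cons[OF Cons.prems a]]
  show ?case by (simp add: comp_def add.assoc)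
qed

lemma multilinear_derivative_jet_compose:
  fixes Df :: "'h::real_normed_vector \<Rightarrow> 'h list \<Rightarrow> 'k::real_normed_vector"
    and Dg :: "'k \<Rightarrow> 'k list \<Rightarrow> 'l::real_normed_vector"
  assumes Df: "jet_on W Df" and x: "x \<in> W" and Dg: "jet_on V Dg" and fx: "Df x [] \<in> V"
  shows "multilinear_derivative (\<lambda>y. Dg (Df y [])) (\<lambda>v vs. Dg (Df x []) (Df x [v] # vs)) x"
proof -
  let ?f = "\<lambda>y. Df y []"
  note lin = jet_on_linear[OF Dg fx]
  have f: "(?f has_derivative (\<lambda>v. Df x [v])) (at x)" by (rule jet_on_deriv[OF Df x])
  obtain K where K: "K \<ge> 0" "\<And>v. norm (Df x [v]) \<le> norm v * K"
    using bounded_linear.nonneg_bounded[OF has_derivative_bounded_linear[OF f]] by blast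
  have est: "\<forall>\<^sub>F y in nhds x. \<forall>vs. length vs = n \<longrightarrow>
        norm (Dg (?f y) vs - Dg (?f x) vs - Dg (?f x) (Df x [y - x] # vs))
        \<le> e * norm (y - x) * prod_norm vs" if e: "e > 0" for n e
  proof -
    obtain C where C: "C \<ge> 0" "\<And>vs. length vs = Suc n \<Longrightarrow> norm (Dg (?f x) vs) \<le> C * prod_norm vs"
      using jet_on_bound[OF Dg fx] by metis
    obtain L where L: "L \<ge> 0" "\<forall>\<^sub>F y in nhds x. norm (?f y - ?f x) \<le> L * norm (y - x)"
      using has_derivative_nhds_lipschitz[OF f] .
    define e1 where "e1 = e / (2 * (L + 1))"
    define e2 where "e2 = e / (2 * (C + 1))"
    have pos: "e1 > 0" "e2 > 0" using e L(1) C(1) by (auto simp: e1_def e2_def)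
    have "?f \<midarrow>x\<rightarrow> ?f x" using has_derivative_continuous[OF f] by (simp add: continuous_at)
    then have "filterlim ?f (nhds (?f x)) (nhds x)" by (rule tendsto_at_iff_tendsto_nhds[of ?f x, THEN iffD1])
    from this[unfolded filterlim_iff, rule_format, OF jet_on_uniform[OF Dg fx pos(1), of n]]
    have ev1: "\<forall>\<^sub>F y in nhds x. \<forall>vs. length vs = n \<longrightarrow>
      norm (Dg (?f y) vs - Dg (?f x) vs - Dg (?f x) ((?f y - ?f x) # vs)) \<le> e1 * norm (?f y - ?f x) * prod_norm vs" .
    show ?thesis
      using ev1 L(2) has_derivative_nhds_bound[OF f pos(2)]
    proof eventually_elim
      case (elim y)
      show ?case
      proof (intro allI impI)
        fix vs :: "'k list" assume len: "length vs = n"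
        have P: "0 \<le> prod_norm vs" by (rule prod_norm_nonneg)
        let ?N = "norm (y - x) * prod_norm vs"
        have N: "0 \<le> ?N" using P by simp
        have "norm (Dg (?f y) vs - Dg (?f x) vs - Dg (?f x) ((?f y - ?f x) # vs)) \<le> e1 * norm (?f y - ?f x) * prod_norm vs"
          using elim(1) len by blast
        also have "\<dots> \<le> e1 * (L * norm (y - x)) * prod_norm vs"
          using elim(2) pos P by (intro mult_right_mono mult_left_mono) auto
        also have "\<dots> = (e1 * L) * ?N" by simp
        also have "\<dots> \<le> e / 2 * ?N"
          using N L(1) e by (intro mult_right_mono) (auto simp: e1_def field_simps)
        finally have t1: "norm (Dg (?f y) vs - Dg (?f x) vs - Dg (?f x) ((?f y - ?f x) # vs)) \<le> e / 2 * ?N" .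
        have "norm (Dg (?f x) ((?f y - ?f x - Df x [y - x]) # vs)) \<le> C * (norm (?f y - ?f x - Df x [y - x]) * prod_norm vs)"
          using C(2)[of "(?f y - ?f x - Df x [y - x]) # vs"] len by simp
        also have "\<dots> \<le> C * ((e2 * norm (y - x)) * prod_norm vs)"
          using elim(3) C(1) P by (intro mult_right_mono mult_left_mono) auto
        also have "\<dots> = (C * e2) * ?N" by simp
        also have "\<dots> \<le> e / 2 * ?N"
          using N C(1) e by (intro mult_right_mono) (auto simp: e2_def field_simps)
        finally have t2: "norm (Dg (?f x) ((?f y - ?f x - Df x [y - x]) # vs)) \<le> e / 2 * ?N" .
        have d: "Dg (?f x) ((?f y - ?f x - Df x [y - x]) # vs)
            = Dg (?f x) ((?f y - ?f x) # vs) - Dg (?f x) (Df x [y - x] # vs)"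
          using linear_diff[OF lin[of "[]" vs]] by simp
        have "Dg (?f y) vs - Dg (?f x) vs - Dg (?f x) (Df x [y - x] # vs)
            = (Dg (?f y) vs - Dg (?f x) vs - Dg (?f x) ((?f y - ?f x) # vs)) + Dg (?f x) ((?f y - ?f x - Df x [y - x]) # vs)"
          unfolding d by simp
        also have "norm \<dots> \<le> e / 2 * ?N + e / 2 * ?N" by (intro norm_triangle_le add_mono t1 t2)
        finally show "norm (Dg (?f y) vs - Dg (?f x) vs - Dg (?f x) (Df x [y - x] # vs))
            \<le> e * norm (y - x) * prod_norm vs" by (simp add: algebra_simps)
      qed
    qed
  qed
  have b2: "\<exists>C\<ge>0. \<forall>v vs. length vs = n \<longrightarrow> norm (Dg (?f x) (Df x [v] # vs)) \<le> C * norm v * prod_norm vs" for n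
  proof -
    obtain C where C: "C \<ge> 0" "\<And>vs. length vs = Suc n \<Longrightarrow> norm (Dg (?f x) vs) \<le> C * prod_norm vs"
      using jet_on_bound[OF Dg fx] by metis
    have "norm (Dg (?f x) (Df x [v] # vs)) \<le> (C * K) * norm v * prod_norm vs" if len: "length vs = n" for v vs
    proof -
      have "norm (Dg (?f x) (Df x [v] # vs)) \<le> C * (norm (Df x [v]) * prod_norm vs)"
        using C(2)[of "Df x [v] # vs"] len by simp
      also have "\<dots> \<le> C * ((norm v * K) * prod_norm vs)"
        using K C(1) prod_norm_nonneg[of vs] by (intro mult_left_mono mult_right_mono) auto
      finally show ?thesis by (simp add: mult_ac)
    qed
    then show ?thesis using C(1) K(1) by (intro exI[of _ "C * K"]) auto
  qed
  have lin_a: "linear (\<lambda>v. Df x [v])" using has_derivative_bounded_linear[OF f] by (rule bounded_linear.linear)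
  show ?thesis
    unfolding multilinear_derivative_def
  proof (intro conjI allI impI)
    show "linear (\<lambda>w. Dg (?f x) (us @ w # ws))" for us ws by (rule lin)
    show "linear (\<lambda>w. Dg (?f x) (Df x [v] # us @ w # ws))" for v us ws
      using lin[of "Df x [v] # us" ws] by simp
    show "linear (\<lambda>v. Dg (?f x) (Df x [v] # vs))" for vs
      using linear_compose[OF lin_a lin[of "[]" vs]] by (simp add: comp_def)
    show "\<exists>C\<ge>0. \<forall>vs. length vs = n \<longrightarrow> norm (Dg (?f x) vs) \<le> C * prod_norm vs" for n
      using jet_on_bound[OF Dg fx] by metis
  qed (fact b2, rule est)
qed

text \<open>
  The formula of Faa di Bruno. The blocks \<open>Bs\<close> are the directions already distributed to inner
  derivatives; a further direction either opens a new block, when the outer map is differentiated, or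
  joins one of the blocks. Directions are processed in the order of differentiation, which is the
  reverse of their order in the argument list of a jet.
\<close>

primrec compose_jets ::
  "('k \<Rightarrow> 'k list \<Rightarrow> 'l) \<Rightarrow> ('h \<Rightarrow> 'h list \<Rightarrow> 'k) \<Rightarrow> 'h list \<Rightarrow> 'h list list \<Rightarrow> 'h \<Rightarrow> 'l::real_normed_vector"
  where
  "compose_jets Dg Df [] Bs x = Dg (Df x []) (map (Df x) Bs)"
| "compose_jets Dg Df (v # rv) Bs x =
     compose_jets Dg Df rv ([v] # Bs) x + (\<Sum>Cs\<leftarrow>inserts v Bs. compose_jets Dg Df rv Cs x)"

lemma inserts_append:
  "inserts v (As @ Bs) = map (\<lambda>Cs. Cs @ Bs) (inserts v As) @ map ((@) As) (inserts v Bs)"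
  by (induction As) auto

lemma linear_sum_list:
  assumes "\<And>c. c \<in> set cs \<Longrightarrow> linear (f c)"
  shows "linear (\<lambda>v. \<Sum>c\<leftarrow>cs. f c v)"
  using assms
proof (induction cs)
  case Nil
  show ?case by (simp add: linear_iff)
next
  case (Cons c cs)
  then show ?case by (auto intro!: linear_compose_add)
qed

lemma linear_sum_inserts:
  assumes "\<And>As a b Bs. linear (\<lambda>v. F (As @ (a @ v # b) # Bs))"
  shows "linear (\<lambda>v. \<Sum>Cs\<leftarrow>inserts v Bs. F (As @ Cs))"
proof (induction Bs arbitrary: As)
  case Nil
  show ?case by (simp add: linear_iff)
next
  case (Cons B Bs)
  show ?case
    using linear_compose_add[OF assms[of As "[]" B Bs] Cons.IH[of "As @ [B]"]] by (simp add: comp_def)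
qed

lemma compose_jets_linear_block:
  assumes Df: "\<And>us ws. linear (\<lambda>v. Df x (us @ v # ws))"
    and Dg: "\<And>us ws. linear (\<lambda>v. Dg (Df x []) (us @ v # ws))"
  shows "linear (\<lambda>v. compose_jets Dg Df rv (As @ (a @ v # b) # Bs) x)"
proof (induction rv arbitrary: As a Bs)
  case Nil
  show ?case
    using linear_compose[OF Df[of a b] Dg[of "map (Df x) As" "map (Df x) Bs"]] by (simp add: comp_def)
next
  case (Cons u rv)
  have 1: "linear (\<lambda>v. compose_jets Dg Df rv ([u] # As @ (a @ v # b) # Bs) x)"
    using Cons.IH[of "[u] # As" a Bs] by simp
  have 2: "linear (\<lambda>v. \<Sum>Cs\<leftarrow>inserts u As. compose_jets Dg Df rv (Cs @ (a @ v # b) # Bs) x)"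
    by (intro linear_sum_list Cons.IH)
  have 3: "linear (\<lambda>v. compose_jets Dg Df rv (As @ (u # a @ v # b) # Bs) x)"
    using Cons.IH[of As "u # a" Bs] by simp
  have 4: "linear (\<lambda>v. \<Sum>Cs\<leftarrow>inserts u Bs. compose_jets Dg Df rv (As @ (a @ v # b) # Cs) x)"
    by (intro linear_sum_list Cons.IH)
  show ?case
    using linear_compose_add[OF 1 linear_compose_add[OF 2 linear_compose_add[OF 3 4]]]
    by (simp add: inserts_append comp_def)
qed

lemma compose_jets_linear:
  assumes Df: "\<And>us ws. linear (\<lambda>v. Df x (us @ v # ws))"
    and Dg: "\<And>us ws. linear (\<lambda>v. Dg (Df x []) (us @ v # ws))"
  shows "linear (\<lambda>v. compose_jets Dg Df (us @ v # ws) Bs x)"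
proof (induction us arbitrary: Bs)
  case Nil
  note block = compose_jets_linear_block[where Dg = Dg and Df = Df and x = x and rv = ws, OF Df Dg]
  have "linear (\<lambda>v. \<Sum>Cs\<leftarrow>inserts v Bs. compose_jets Dg Df ws ([] @ Cs) x)"
    by (rule linear_sum_inserts[where F = "\<lambda>Cs. compose_jets Dg Df ws Cs x"]) (rule block)
  from linear_compose_add[OF block[of "[]" "[]" "[]" Bs] this] show ?case by simp
next
  case (Cons u us)
  show ?case
    using linear_compose_add[OF Cons.IH[of "[u] # Bs"]
      linear_sum_list[of "inserts u Bs" "\<lambda>Cs v. compose_jets Dg Df (us @ v # ws) Cs x", OF Cons.IH]]
    by simp
qed

lemma inserts_weight:
  assumes "Cs \<in> set (inserts v Bs)"
  shows "length Cs = length Bs" "length (concat Cs) = Suc (length (concat Bs))"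
    "prod_norm (concat Cs) = norm v * prod_norm (concat Bs)"
  using assms by (induction Bs arbitrary: Cs) auto

lemma length_inserts: "length (inserts v Bs) = length Bs"
  by (induction Bs) auto

lemma jet_on_bound_upto:
  assumes D: "jet_on W D" "x \<in> W"
  shows "\<exists>C\<ge>0. \<forall>\<^sub>F y in nhds x. \<forall>vs. length vs \<le> n \<longrightarrow> norm (D y vs) \<le> C * prod_norm vs"
proof -
  have "\<forall>i. \<exists>C. \<forall>\<^sub>F y in nhds x. \<forall>vs. length vs = i \<longrightarrow> norm (D y vs) \<le> C * prod_norm vs"
    using D unfolding jet_on_def by blast
  from choice[OF this] obtain C
    where C: "\<forall>i. \<forall>\<^sub>F y in nhds x. \<forall>vs. length vs = i \<longrightarrow> norm (D y vs) \<le> C i * prod_norm vs"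
    by blast
  define K where "K = (\<Sum>i\<le>n. \<bar>C i\<bar>)"
  have "\<forall>\<^sub>F y in nhds x. \<forall>i\<in>{..n}. \<forall>vs. length vs = i \<longrightarrow> norm (D y vs) \<le> C i * prod_norm vs"
    using C by (intro eventually_ball_finite) auto
  then have "\<forall>\<^sub>F y in nhds x. \<forall>vs. length vs \<le> n \<longrightarrow> norm (D y vs) \<le> K * prod_norm vs"
  proof eventually_elim
    case (elim y)
    show ?case
    proof (intro allI impI)
      fix vs :: "'a list" assume len: "length vs \<le> n"
      have "C (length vs) \<le> \<bar>C (length vs)\<bar>" by simp
      also have "\<dots> \<le> K" unfolding K_def using len by (intro member_le_sum) auto
      finally have "C (length vs) * prod_norm vs \<le> K * prod_norm vs"
        by (rule mult_right_mono) (rule prod_norm_nonneg)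
      then show "norm (D y vs) \<le> K * prod_norm vs" using elim[rule_format, of "length vs" vs] len by simp
    qed
  qed
  moreover have "K \<ge> 0" unfolding K_def by (intro sum_nonneg) simp
  ultimately show ?thesis by blast
qed

lemma norm_sum_list_le:
  fixes f :: "'a \<Rightarrow> 'b::real_normed_vector"
  assumes "\<And>c. c \<in> set cs \<Longrightarrow> norm (f c) \<le> K"
  shows "norm (\<Sum>c\<leftarrow>cs. f c) \<le> real (length cs) * K"
  using assms
proof (induction cs)
  case (Cons c cs)
  have "norm (f c + (\<Sum>c\<leftarrow>cs. f c)) \<le> K + real (length cs) * K"
    using Cons by (intro norm_triangle_le add_mono) auto
  then show ?case by (simp add: algebra_simps)
qed simp

lemma prod_norm_map_le:
  fixes F :: "'h::real_normed_vector list \<Rightarrow> 'k::real_normed_vector"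
  assumes "\<And>B. B \<in> set Bs \<Longrightarrow> norm (F B) \<le> C * prod_norm B" and "C \<ge> 0"
  shows "prod_norm (map F Bs) \<le> C ^ length Bs * prod_norm (concat Bs)"
  using assms(1)
proof (induction Bs)
  case (Cons B Bs)
  have "norm (F B) * prod_norm (map F Bs) \<le> (C * prod_norm B) * (C ^ length Bs * prod_norm (concat Bs))"
    using Cons assms(2) prod_norm_nonneg[of "map F Bs"]
    by (intro mult_mono) (auto intro!: prod_norm_nonneg mult_nonneg_nonneg)
  then show ?case by (simp add: mult_ac)
qed simp

lemma length_block_le: "B \<in> set Bs \<Longrightarrow> length B \<le> length (concat Bs)"
  by (induction Bs) auto

text \<open>
  Blocks are controlled by their number and their total length alone, since \<open>inserts\<close> preserves the
  former and raises the latter by one; the bounds are uniform over all such block lists.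
\<close>

lemma compose_jets_bound:
  fixes Df :: "'h::real_normed_vector \<Rightarrow> 'h list \<Rightarrow> 'k::real_normed_vector"
    and Dg :: "'k \<Rightarrow> 'k list \<Rightarrow> 'l::real_normed_vector"
  assumes Df: "jet_on W Df" and x: "x \<in> W" and Dg: "jet_on V Dg" and fx: "Df x [] \<in> V"
  shows "\<exists>C\<ge>0. \<forall>\<^sub>F y in nhds x. \<forall>rv Bs. length rv = n \<and> length Bs = k \<and> length (concat Bs) = N \<longrightarrow>
      norm (compose_jets Dg Df rv Bs y) \<le> C * (prod_norm rv * prod_norm (concat Bs))"
proof (induction n arbitrary: k N)
  case 0
  obtain Cf where Cf: "Cf \<ge> 0"
    "\<forall>\<^sub>F y in nhds x. \<forall>vs. length vs \<le> N \<longrightarrow> norm (Df y vs) \<le> Cf * prod_norm vs"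
    using jet_on_bound_upto[OF Df x] by blast
  obtain Cg where Cg: "Cg \<ge> 0"
    "\<forall>\<^sub>F z in nhds (Df x []). \<forall>vs. length vs \<le> k \<longrightarrow> norm (Dg z vs) \<le> Cg * prod_norm vs"
    using jet_on_bound_upto[OF Dg fx] by blast
  have "(\<lambda>y. Df y []) \<midarrow>x\<rightarrow> Df x []"
    using has_derivative_continuous[OF jet_on_deriv[OF Df x]] by (simp add: continuous_at)
  then have "filterlim (\<lambda>y. Df y []) (nhds (Df x [])) (nhds x)"
    by (rule tendsto_at_iff_tendsto_nhds[of "\<lambda>y. Df y []" x, THEN iffD1])
  from this[unfolded filterlim_iff, rule_format, OF Cg(2)] Cf(2)
  have "\<forall>\<^sub>F y in nhds x. \<forall>rv Bs. length rv = 0 \<and> length Bs = k \<and> length (concat Bs) = N \<longrightarrow>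
      norm (compose_jets Dg Df rv Bs y) \<le> (Cg * Cf ^ k) * (prod_norm rv * prod_norm (concat Bs))"
  proof eventually_elim
    case (elim y)
    show ?case
    proof (intro allI impI; elim conjE)
      fix rv :: "'h list" and Bs :: "'h list list"
      assume len: "length rv = 0" "length Bs = k" "length (concat Bs) = N"
      have "norm (Dg (Df y []) (map (Df y) Bs)) \<le> Cg * prod_norm (map (Df y) Bs)"
        using elim(1)[rule_format, of "map (Df y) Bs"] len by simp
      also have "\<dots> \<le> Cg * (Cf ^ length Bs * prod_norm (concat Bs))"
        using length_block_le[of _ Bs] len elim(2) Cf(1) Cg(1)
        by (intro mult_left_mono prod_norm_map_le) auto
      finally show "norm (compose_jets Dg Df rv Bs y) \<le> (Cg * Cf ^ k) * (prod_norm rv * prod_norm (concat Bs))"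
        using len by (simp add: mult.assoc)
    qed
  qed
  then show ?case using Cf(1) Cg(1) by (intro exI[of _ "Cg * Cf ^ k"]) simp
next
  case (Suc n)
  obtain C1 where C1: "C1 \<ge> 0"
    "\<forall>\<^sub>F y in nhds x. \<forall>rv Bs. length rv = n \<and> length Bs = Suc k \<and> length (concat Bs) = Suc N \<longrightarrow>
      norm (compose_jets Dg Df rv Bs y) \<le> C1 * (prod_norm rv * prod_norm (concat Bs))"
    using Suc.IH by blast
  obtain C2 where C2: "C2 \<ge> 0"
    "\<forall>\<^sub>F y in nhds x. \<forall>rv Bs. length rv = n \<and> length Bs = k \<and> length (concat Bs) = Suc N \<longrightarrow>
      norm (compose_jets Dg Df rv Bs y) \<le> C2 * (prod_norm rv * prod_norm (concat Bs))"
    using Suc.IH by blast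
  have "\<forall>\<^sub>F y in nhds x. \<forall>rv Bs. length rv = Suc n \<and> length Bs = k \<and> length (concat Bs) = N \<longrightarrow>
      norm (compose_jets Dg Df rv Bs y) \<le> (C1 + real k * C2) * (prod_norm rv * prod_norm (concat Bs))"
    using C1(2) C2(2)
  proof eventually_elim
    case (elim y)
    show ?case
    proof (intro allI impI; elim conjE)
      fix rv :: "'h list" and Bs :: "'h list list"
      assume len: "length rv = Suc n" "length Bs = k" "length (concat Bs) = N"
      then obtain v rv' where rv: "rv = v # rv'" "length rv' = n" by (auto simp: length_Suc_conv)
      let ?P = "prod_norm rv * prod_norm (concat Bs)"
      have t1: "norm (compose_jets Dg Df rv' ([v] # Bs) y) \<le> C1 * ?P"
        using elim(1)[rule_format, of rv' "[v] # Bs"] rv len by (simp add: mult_ac)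
      have "norm (\<Sum>Cs\<leftarrow>inserts v Bs. compose_jets Dg Df rv' Cs y)
          \<le> real (length (inserts v Bs)) * (C2 * ?P)"
      proof (rule norm_sum_list_le)
        fix Cs assume Cs: "Cs \<in> set (inserts v Bs)"
        then show "norm (compose_jets Dg Df rv' Cs y) \<le> C2 * ?P"
          using elim(2)[rule_format, of rv' Cs] inserts_weight[OF Cs] rv len by (simp add: mult_ac)
      qed
      then have t2: "norm (\<Sum>Cs\<leftarrow>inserts v Bs. compose_jets Dg Df rv' Cs y) \<le> real k * (C2 * ?P)"
        using len(2) by (simp add: length_inserts)
      have "norm (compose_jets Dg Df rv Bs y) \<le> C1 * ?P + real k * (C2 * ?P)"
        unfolding rv(1) compose_jets.simps
        by (rule norm_triangle_le[OF add_mono[OF t1[unfolded rv(1)] t2[unfolded rv(1)]]])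
      then show "norm (compose_jets Dg Df rv Bs y) \<le> (C1 + real k * C2) * ?P" by (simp add: algebra_simps)
    qed
  qed
  then show ?case using C1(1) C2(1) by (intro exI[of _ "C1 + real k * C2"]) simp
qed

lemma has_derivative_sum_list:
  assumes "\<And>c. c \<in> set cs \<Longrightarrow> (f c has_derivative f' c) F"
  shows "((\<lambda>y. \<Sum>c\<leftarrow>cs. f c y) has_derivative (\<lambda>v. \<Sum>c\<leftarrow>cs. f' c v)) F"
  using assms by (induction cs) (auto intro!: has_derivative_add)

text \<open>
  Differentiating once more appends a direction at the end, where it is processed last: thus the
  induction over \<open>rv\<close> reduces everything to the case of undifferentiated terms.
\<close>

lemma compose_jets_deriv:
  assumes Df: "jet_on W Df" and x: "x \<in> W" and Dg: "jet_on V Dg" and fx: "Df x [] \<in> V"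
  shows "((\<lambda>y. compose_jets Dg Df rv Bs y) has_derivative
           (\<lambda>v. compose_jets Dg Df (rv @ [v]) Bs x)) (at x)"
proof (induction rv arbitrary: Bs)
  case Nil
  show ?case
    using multilinear_derivative_blocks[OF multilinear_derivative_jet_compose[OF assms] Df x, of Bs]
    by simp
next
  case (Cons u rv)
  show ?case by (simp) (intro has_derivative_add has_derivative_sum_list Cons.IH)
qed

lemma smooth_on_open_compose:
  assumes f: "smooth_on_open W f" and g: "smooth_on_open V g" and sub: "f ` W \<subseteq> V"
  shows "smooth_on_open W (g \<circ> f)"
proof -
  obtain Df where Df: "jet_on W Df" "\<And>x. x \<in> W \<Longrightarrow> Df x [] = f x"
    using jet_on_of_smooth_on_open[OF f] by blast
  obtain Dg where Dg: "jet_on V Dg" "\<And>x. x \<in> V \<Longrightarrow> Dg x [] = g x"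
    using jet_on_of_smooth_on_open[OF g] by blast
  have V: "Df x [] \<in> V" if "x \<in> W" for x using that sub Df(2) by auto
  show ?thesis
  proof (rule smooth_on_open_of_jet_on[where D = "\<lambda>x vs. compose_jets Dg Df (rev vs) [] x"])
    show "jet_on W (\<lambda>x vs. compose_jets Dg Df (rev vs) [] x)"
      unfolding jet_on_def
    proof (intro conjI ballI allI)
      show "open W" using Df(1) by (simp add: jet_on_def)
      fix x assume x: "x \<in> W"
      show "linear (\<lambda>v. compose_jets Dg Df (rev (us @ v # ws)) [] x)" for us ws
        using compose_jets_linear[where Df = Df and Dg = Dg and x = x, OF jet_on_linear[OF Df(1) x] jet_on_linear[OF Dg(1) V[OF x]],
            of "rev ws" "rev us"] by simp
      show "\<exists>C. \<forall>\<^sub>F y in nhds x. \<forall>vs. length vs = n \<longrightarrow>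
          norm (compose_jets Dg Df (rev vs) [] y) \<le> C * prod_norm vs" for n
      proof -
        obtain C where "\<forall>\<^sub>F y in nhds x. \<forall>rv Bs. length rv = n \<and> length Bs = 0 \<and> length (concat Bs) = 0 \<longrightarrow>
            norm (compose_jets Dg Df rv Bs y) \<le> C * (prod_norm rv * prod_norm (concat Bs))"
          using compose_jets_bound[OF Df(1) x Dg(1) V[OF x]] by blast
        then have "\<forall>\<^sub>F y in nhds x. \<forall>vs. length vs = n \<longrightarrow>
            norm (compose_jets Dg Df (rev vs) [] y) \<le> C * prod_norm vs"
        proof eventually_elim
          case (elim y)
          then show ?case
            using elim[rule_format, of "rev _" "[]"] by (simp add: rev_map[symmetric] prod_list.rev)
        qed
        then show ?thesis by blast
      qed
      show "((\<lambda>y. compose_jets Dg Df (rev vs) [] y) has_derivative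
          (\<lambda>v. compose_jets Dg Df (rev (v # vs)) [] x)) (at x)" for vs
        using compose_jets_deriv[OF Df(1) x Dg(1) V[OF x], of "rev vs" "[]"] by simp
    qed
  qed (use V Df Dg in auto)
qed

section \<open>Calculus of smooth maps\<close>

lemma jet_on_subset: "jet_on W D \<Longrightarrow> open V \<Longrightarrow> V \<subseteq> W \<Longrightarrow> jet_on V D"
  unfolding jet_on_def by blast

lemma smooth_on_open_subset:
  assumes "smooth_on_open W f" "open V" "V \<subseteq> W"
  shows "smooth_on_open V f"
proof -
  obtain D where D: "jet_on W D" "\<And>x. x \<in> W \<Longrightarrow> D x [] = f x"
    using jet_on_of_smooth_on_open[OF assms(1)] by blast
  then show ?thesis
    using assms(3) by (intro smooth_on_open_of_jet_on[OF jet_on_subset[OF D(1) assms(2,3)]]) auto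
qed

lemma smooth_on_open_has_derivative:
  assumes "smooth_on_open W f" "x \<in> W"
  shows "\<exists>f'. (f has_derivative f') (at x)"
proof -
  obtain D where D: "jet_on W D" "\<And>x. x \<in> W \<Longrightarrow> D x [] = f x"
    using jet_on_of_smooth_on_open[OF assms(1)] by blast
  have "\<forall>\<^sub>F y in nhds x. y \<in> W" using D(1) assms(2) by (simp add: jet_on_def eventually_nhds_in_open)
  then have "\<forall>\<^sub>F y in at x. D y [] = f y" by (auto simp: eventually_at_filter D(2) elim!: eventually_mono)
  then have "(f has_derivative (\<lambda>v. D x [v])) (at x)"
    using jet_on_deriv[OF D(1) assms(2), of "[]"] D(2)[OF assms(2)]
      has_derivative_transform_eventually[of "\<lambda>y. D y []" _ x UNIV f] by auto
  then show ?thesis by blast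
qed

lemma smooth_on_open_continuous_on:
  assumes "smooth_on_open W f"
  shows "continuous_on W f"
  using smooth_on_open_has_derivative[OF assms]
  by (meson continuous_at_imp_continuous_on has_derivative_continuous)

lemma smooth_on_open_imp_smooth_on: "smooth_on_open W f \<Longrightarrow> S \<subseteq> W \<Longrightarrow> smooth_on S f"
  unfolding smooth_on_def by blast

lemma smooth_on_subset:
  assumes "smooth_on S f" "T \<subseteq> S"
  shows "smooth_on T f"
  unfolding smooth_on_def
proof
  fix x assume "x \<in> T"
  then obtain W F where "x \<in> W" "smooth_on_open W F" "\<forall>y\<in>W \<inter> S. F y = f y"
    using assms unfolding smooth_on_def by blast
  with assms(2) show "\<exists>W F. x \<in> W \<and> smooth_on_open W F \<and> (\<forall>y\<in>W \<inter> T. F y = f y)"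
    by (intro exI[of _ W] exI[of _ F]) auto
qed

lemma smooth_on_cong:
  assumes "smooth_on S f" "\<And>x. x \<in> S \<Longrightarrow> f x = g x"
  shows "smooth_on S g"
  using assms unfolding smooth_on_def by (metis IntE)

lemma smooth_on_local:
  assumes "\<And>x. x \<in> S \<Longrightarrow> \<exists>N g. open N \<and> x \<in> N \<and> smooth_on (S \<inter> N) g \<and> (\<forall>y\<in>S \<inter> N. g y = f y)"
  shows "smooth_on S f"
  unfolding smooth_on_def
proof
  fix x assume x: "x \<in> S"
  obtain N g where N: "open N" "x \<in> N" "smooth_on (S \<inter> N) g" "\<forall>y\<in>S \<inter> N. g y = f y"
    using assms[OF x] by blast
  obtain W F where W: "x \<in> W" "smooth_on_open W F" "\<forall>y\<in>W \<inter> (S \<inter> N). F y = g y"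
    using N x unfolding smooth_on_def by blast
  have "open W" using W(2) by (simp add: smooth_on_open_def)
  then have "smooth_on_open (W \<inter> N) F" using W(2) N(1) by (intro smooth_on_open_subset[OF W(2)]) auto
  then show "\<exists>W F. x \<in> W \<and> smooth_on_open W F \<and> (\<forall>y\<in>W \<inter> S. F y = f y)"
    using W N x by (intro exI[of _ "W \<inter> N"] exI[of _ F]) auto
qed

lemma smooth_on_compose:
  assumes f: "smooth_on S f" and g: "smooth_on T g" and sub: "f ` S \<subseteq> T"
  shows "smooth_on S (g \<circ> f)"
  unfolding smooth_on_def
proof
  fix x assume x: "x \<in> S"
  obtain W F where W: "x \<in> W" "smooth_on_open W F" "\<forall>y\<in>W \<inter> S. F y = f y"
    using f x unfolding smooth_on_def by blast
  have "f x \<in> T" using sub x by blast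
  then obtain V H where V: "f x \<in> V" "smooth_on_open V H" "\<forall>y\<in>V \<inter> T. H y = g y"
    using g unfolding smooth_on_def by blast
  let ?W = "W \<inter> F -` V"
  have o: "open W" "open V" using W(2) V(2) by (auto simp: smooth_on_open_def)
  then have "open (F -` V \<inter> W)"
    using continuous_open_preimage[OF smooth_on_open_continuous_on[OF W(2)]]
    by (simp add: Int_commute)
  then have "smooth_on_open ?W F"
    by (intro smooth_on_open_subset[OF W(2)]) (auto simp: Int_commute)
  then have "smooth_on_open ?W (H \<circ> F)"
    by (rule smooth_on_open_compose[OF _ V(2)]) auto
  moreover have "x \<in> ?W" using W x V by auto
  moreover have "\<forall>y\<in>?W \<inter> S. (H \<circ> F) y = (g \<circ> f) y"
    using W(3) V(3) sub by (auto simp: image_subset_iff)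
  ultimately show "\<exists>W F. x \<in> W \<and> smooth_on_open W F \<and> (\<forall>y\<in>W \<inter> S. F y = (g \<circ> f) y)"
    by (intro exI[of _ ?W] exI[of _ "H \<circ> F"] conjI)
qed

lemma smooth_on_has_derivative:
  assumes "smooth_on S f" "x \<in> S"
  shows "\<exists>f'. (f has_derivative f') (at x within S)"
proof -
  obtain W F where W: "x \<in> W" "smooth_on_open W F" "\<forall>y\<in>W \<inter> S. F y = f y"
    using assms unfolding smooth_on_def by blast
  then obtain F' where F': "(F has_derivative F') (at x)" using smooth_on_open_has_derivative by blast
  have "open W" using W(2) by (simp add: smooth_on_open_def)
  then have "\<forall>\<^sub>F y in at x within S. F y = f y"
    using W unfolding eventually_at_topological by blast
  then have "(f has_derivative F') (at x within S)"
    using has_derivative_at_withinI[OF F', of S] W assms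
    by (auto intro: has_derivative_transform_eventually)
  then show ?thesis by blast
qed

lemma smooth_on_continuous_on: "smooth_on S f \<Longrightarrow> continuous_on S f"
  unfolding continuous_on_eq_continuous_within
  using smooth_on_has_derivative has_derivative_continuous by blast

lemma smooth_on_bounded_linear:
  fixes f :: "'a::real_normed_vector \<Rightarrow> 'b::real_normed_vector"
  assumes "bounded_linear f"
  shows "smooth_on S f"
proof (rule smooth_on_open_imp_smooth_on[OF _ subset_UNIV])
  interpret bounded_linear f by fact
  define D where "D = (\<lambda>x vs. case vs of [] \<Rightarrow> f x | [v] \<Rightarrow> f v | _ \<Rightarrow> 0)"
  obtain K where K: "K \<ge> 0" "\<And>x. norm (f x) \<le> norm x * K" using nonneg_bounded by blast
  show "smooth_on_open UNIV f"
  proof (rule smooth_on_open_of_jet_on[where D = D])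
    show "jet_on UNIV D"
      unfolding jet_on_def
    proof (intro conjI ballI allI)
      fix x :: 'a and us ws :: "'a list"
      show "linear (\<lambda>v. D x (us @ v # ws))"
        by (cases us; cases ws; cases "tl us") (simp_all add: D_def linear_iff add scale)
    next
      fix x :: 'a and n :: nat
      have "\<forall>\<^sub>F y in nhds x. dist y x < 1"
        unfolding eventually_nhds_metric by (intro exI[of _ 1]) auto
      then have "\<forall>\<^sub>F y in nhds x. \<forall>vs. length vs = n \<longrightarrow> norm (D y vs) \<le> ((norm x + 1) * K + K) * prod_norm vs"
      proof eventually_elim
        case (elim y)
        have y: "norm (f y) \<le> (norm x + 1) * K"
        proof -
          have "norm y \<le> norm x + 1" using norm_triangle_sub[of y x] elim by (simp add: dist_norm)
          then show ?thesis using K(2)[of y] K(1) by (meson mult_right_mono order_trans)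
        qed
        show ?case
        proof (intro allI impI)
          fix vs :: "'a list"
          consider "vs = []" | v where "vs = [v]" | u v ws where "vs = u # v # ws"
            by (metis list.exhaust)
          then show "norm (D y vs) \<le> ((norm x + 1) * K + K) * prod_norm vs"
          proof cases
            case 1 then show ?thesis using y K(1) by (simp add: D_def)
          next
            case 2
            have "norm v * K \<le> ((norm x + 1) * K + K) * norm v"
              using K(1) by (simp add: algebra_simps)
            then show ?thesis using K(2)[of v] 2 by (simp add: D_def)
          next
            case 3
            then have "D y vs = 0" by (simp add: D_def)
            then show ?thesis using prod_norm_nonneg[of vs] K(1) by (simp add: mult_nonneg_nonneg)
          qed
        qed
      qed
      then show "\<exists>C. \<forall>\<^sub>F y in nhds x. \<forall>vs. length vs = n \<longrightarrow> norm (D y vs) \<le> C * prod_norm vs" by blast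
    next
      fix x :: 'a and vs :: "'a list"
      consider "vs = []" | v where "vs = [v]" | u v ws where "vs = u # v # ws"
        by (metis list.exhaust)
      then show "((\<lambda>y. D y vs) has_derivative (\<lambda>v. D x (v # vs))) (at x)"
      proof cases
        case 1
        then show ?thesis
          by (simp add: D_def bounded_linear_imp_has_derivative bounded_linear_axioms)
      qed (simp_all add: D_def)
    qed simp
  qed (simp add: D_def)
qed

lemma smooth_on_id: "smooth_on S (\<lambda>x. x)"
  by (rule smooth_on_bounded_linear) (rule bounded_linear_ident)

lemma smooth_on_const: "smooth_on S (\<lambda>x. c)"
proof (rule smooth_on_open_imp_smooth_on[OF _ subset_UNIV])
  define D where "D = (\<lambda>(x::'a) (vs::'a list). case vs of [] \<Rightarrow> c | _ \<Rightarrow> 0)"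
  show "smooth_on_open UNIV (\<lambda>x::'a. c)"
  proof (rule smooth_on_open_of_jet_on[where D = D])
    show "jet_on UNIV D"
      unfolding jet_on_def
    proof (intro conjI ballI allI)
      show "linear (\<lambda>v. D x (us @ v # ws))" for x us ws
        by (cases us) (auto simp: D_def linear_iff)
      show "\<exists>C. \<forall>\<^sub>F y in nhds x. \<forall>vs. length vs = n \<longrightarrow> norm (D y vs) \<le> C * prod_norm vs" for x n
        using prod_norm_nonneg by (intro exI[of _ "norm c"] always_eventually) (auto simp: D_def intro!: mult_nonneg_nonneg split: list.splits)
      show "((\<lambda>y. D y vs) has_derivative (\<lambda>v. D x (v # vs))) (at x)" for x vs
        by (cases vs) (auto simp: D_def)
    qed simp
  qed (simp add: D_def)
qed

lemma smooth_on_Pair: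
  assumes f: "smooth_on S f" and g: "smooth_on S g"
  shows "smooth_on S (\<lambda>x. (f x, g x))"
  unfolding smooth_on_def
proof
  fix x assume x: "x \<in> S"
  obtain W F where W: "x \<in> W" "smooth_on_open W F" "\<forall>y\<in>W \<inter> S. F y = f y"
    using f x unfolding smooth_on_def by blast
  obtain V H where V: "x \<in> V" "smooth_on_open V H" "\<forall>y\<in>V \<inter> S. H y = g y"
    using g x unfolding smooth_on_def by blast
  obtain D where D: "jet_on W D" "\<And>x. x \<in> W \<Longrightarrow> D x [] = F x"
    using jet_on_of_smooth_on_open[OF W(2)] by blast
  obtain E where E: "jet_on V E" "\<And>x. x \<in> V \<Longrightarrow> E x [] = H x"
    using jet_on_of_smooth_on_open[OF V(2)] by blast
  have "smooth_on_open (W \<inter> V) (\<lambda>x. (F x, H x))"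
  proof (rule smooth_on_open_of_jet_on[where D = "\<lambda>x vs. (D x vs, E x vs)"])
    show "jet_on (W \<inter> V) (\<lambda>x vs. (D x vs, E x vs))"
      unfolding jet_on_def
    proof (intro conjI ballI allI)
      show "open (W \<inter> V)" using D(1) E(1) by (auto simp: jet_on_def)
      fix x assume x: "x \<in> W \<inter> V"
      show "linear (\<lambda>v. (D x (us @ v # ws), E x (us @ v # ws)))" for us ws
        using jet_on_linear[OF D(1), of x us ws] jet_on_linear[OF E(1), of x us ws] x
        by (simp add: linear_iff)
      show "\<exists>C. \<forall>\<^sub>F y in nhds x. \<forall>vs. length vs = n \<longrightarrow> norm (D y vs, E y vs) \<le> C * prod_norm vs" for n
      proof -
        obtain C1 where C1: "\<forall>\<^sub>F y in nhds x. \<forall>vs. length vs = n \<longrightarrow> norm (D y vs) \<le> C1 * prod_norm vs"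
          using D(1) x unfolding jet_on_def by blast
        obtain C2 where C2: "\<forall>\<^sub>F y in nhds x. \<forall>vs. length vs = n \<longrightarrow> norm (E y vs) \<le> C2 * prod_norm vs"
          using E(1) x unfolding jet_on_def by blast
        from C1 C2
        have "\<forall>\<^sub>F y in nhds x. \<forall>vs. length vs = n \<longrightarrow> norm (D y vs, E y vs) \<le> (C1 + C2) * prod_norm vs"
        proof eventually_elim
          case (elim y)
          show ?case
          proof (intro allI impI)
            fix vs :: "'a list" assume "length vs = n"
            then have "norm (D y vs) + norm (E y vs) \<le> (C1 + C2) * prod_norm vs"
              using elim by (simp add: distrib_right add_mono)
            then show "norm (D y vs, E y vs) \<le> (C1 + C2) * prod_norm vs"
              using norm_Pair_le[of "D y vs" "E y vs"] by linarith
          qed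
        qed
        then show ?thesis by blast
      qed
      show "((\<lambda>y. (D y vs, E y vs)) has_derivative (\<lambda>v. (D x (v # vs), E x (v # vs)))) (at x)" for vs
        using x by (intro has_derivative_Pair jet_on_deriv[OF D(1)] jet_on_deriv[OF E(1)]) auto
    qed
  qed (use D E in auto)
  then show "\<exists>W G. x \<in> W \<and> smooth_on_open W G \<and> (\<forall>y\<in>W \<inter> S. G y = (f y, g y))"
    using W V by (intro exI[of _ "W \<inter> V"] exI[of _ "\<lambda>x. (F x, H x)"]) auto
qed

lemma smooth_on_bounded_bilinear:
  fixes b :: "'a::real_normed_vector \<Rightarrow> 'b::real_normed_vector \<Rightarrow> 'c::real_normed_vector"
  assumes "bounded_bilinear b"
  shows "smooth_on S (\<lambda>p. b (fst p) (snd p))"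
proof (rule smooth_on_open_imp_smooth_on[OF _ subset_UNIV])
  interpret bounded_bilinear b by fact
  define D where "D = (\<lambda>(x :: 'a \<times> 'b) vs. case vs of [] \<Rightarrow> b (fst x) (snd x)
    | [u] \<Rightarrow> b (fst u) (snd x) + b (fst x) (snd u)
    | [u, v] \<Rightarrow> b (fst u) (snd v) + b (fst v) (snd u) | _ \<Rightarrow> 0)"
  have D_simps: "D x [] = b (fst x) (snd x)" "D x [u] = b (fst u) (snd x) + b (fst x) (snd u)"
    "D x [u, v] = b (fst u) (snd v) + b (fst v) (snd u)" "D x (u # v # w # ws) = 0" for x u v w ws
    by (simp_all add: D_def)
  have list_cases: thesis if "vs = [] \<Longrightarrow> thesis" "\<And>u. vs = [u] \<Longrightarrow> thesis"
    "\<And>u v. vs = [u, v] \<Longrightarrow> thesis" "\<And>u v w ws. vs = u # v # w # ws \<Longrightarrow> thesis" for vs :: "('a \<times> 'b) list" and thesis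
    using that by (metis list.exhaust)
  obtain K where K: "K > 0" "\<And>x y. norm (b x y) \<le> norm x * norm y * K" using pos_bounded by blast
  have bK: "norm (b (fst u) (snd v)) \<le> K * norm u * norm v" for u v
  proof -
    have "norm (b (fst u) (snd v)) \<le> norm (fst u) * norm (snd v) * K" by (rule K)
    also have "\<dots> \<le> norm u * norm v * K"
      using K(1) norm_fst_le[of "fst u" "snd u"] norm_snd_le[of "snd v" "fst v"]
      by (intro mult_right_mono mult_mono) auto
    finally show ?thesis by (simp add: mult_ac)
  qed
  show "smooth_on_open UNIV (\<lambda>p. b (fst p) (snd p))"
  proof (rule smooth_on_open_of_jet_on[where D = D])
    show "jet_on UNIV D"
      unfolding jet_on_def
    proof (intro conjI ballI allI)
      fix x :: "'a \<times> 'b" and us ws :: "('a \<times> 'b) list"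
      consider "us = []" "ws = []" | u where "us = [u]" "ws = []" | w where "us = []" "ws = [w]"
        | "length us + length ws \<ge> 2"
        by (cases us; cases ws; cases "tl us"; cases "tl ws") auto
      then show "linear (\<lambda>v. D x (us @ v # ws))"
      proof cases
        case 4
        then have "D x (us @ v # ws) = 0" for v
          by (cases "us @ v # ws" rule: list_cases) (auto simp: D_simps dest: arg_cong[where f = length])
        then show ?thesis by (simp add: linear_iff)
      qed (simp_all add: D_simps linear_iff add_left add_right scaleR_left scaleR_right scaleR_add_right)
    next
      fix x :: "'a \<times> 'b" and n :: nat
      let ?M = "norm x + 1"
      let ?C = "K * ?M * ?M + 2 * K * ?M + 2 * K"
      have "\<forall>\<^sub>F y in nhds x. dist y x < 1"
        unfolding eventually_nhds_metric by (intro exI[of _ 1]) auto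
      then have "\<forall>\<^sub>F y in nhds x. \<forall>vs. length vs = n \<longrightarrow> norm (D y vs) \<le> ?C * prod_norm vs"
      proof eventually_elim
        case (elim y)
        have y: "norm y \<le> ?M" using norm_triangle_sub[of y x] elim by (simp add: dist_norm)
        have M: "?M \<ge> 0" by (simp add: add_nonneg_nonneg)
        have pos: "K * ?M * ?M \<ge> 0" "2 * K * ?M \<ge> 0" "2 * K \<ge> 0" using K(1) M by auto
        show ?case
        proof (intro allI impI)
          fix vs :: "('a \<times> 'b) list"
          show "norm (D y vs) \<le> ?C * prod_norm vs"
          proof (cases vs rule: list_cases)
            case 1
            have "norm (b (fst y) (snd y)) \<le> K * norm y * norm y" by (rule bK)
            also have "\<dots> \<le> K * ?M * ?M" using y K(1) by (intro mult_mono) auto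
            finally show ?thesis
              unfolding 1 D_simps list.map prod_list.Nil mult_1_right using pos by linarith
          next
            case (2 u)
            have "norm (D y vs) \<le> K * norm u * norm y + K * norm y * norm u"
              unfolding 2 D_simps by (intro norm_triangle_le add_mono bK)
            also have "\<dots> = 2 * K * norm y * norm u" by simp
            also have "\<dots> \<le> 2 * K * ?M * norm u" using y K(1) by (intro mult_right_mono mult_left_mono) auto
            also have "\<dots> \<le> ?C * norm u" using pos by (intro mult_right_mono) auto
            finally show ?thesis using 2 by simp
          next
            case (3 u v)
            have "norm (D y vs) \<le> K * norm u * norm v + K * norm v * norm u"
              unfolding 3 D_simps by (intro norm_triangle_le add_mono bK)
            also have "\<dots> = 2 * K * (norm u * norm v)" by simp
            also have "\<dots> \<le> ?C * (norm u * norm v)" using pos by (intro mult_right_mono) auto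
            finally show ?thesis using 3 by simp
          next
            case 4
            then have "D y vs = 0" by (simp add: D_simps)
            moreover have "0 \<le> ?C * prod_norm vs"
              using pos by (intro mult_nonneg_nonneg prod_norm_nonneg) auto
            ultimately show ?thesis by simp
          qed
        qed
      qed
      then show "\<exists>C. \<forall>\<^sub>F y in nhds x. \<forall>vs. length vs = n \<longrightarrow> norm (D y vs) \<le> C * prod_norm vs" by blast
    next
      fix x :: "'a \<times> 'b" and vs :: "('a \<times> 'b) list"
      have fst': "(fst has_derivative fst) F" and snd': "(snd has_derivative snd) F" for F :: "('a \<times> 'b) filter"
        by (auto intro!: bounded_linear_imp_has_derivative bounded_linear_fst bounded_linear_snd)
      have lf: "((\<lambda>y. b (fst y) c) has_derivative (\<lambda>v. b (fst v) c)) F" for c and F :: "('a \<times> 'b) filter"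
        by (rule bounded_linear.has_derivative[OF bounded_linear_left fst'])
      have rf: "((\<lambda>y. b c (snd y)) has_derivative (\<lambda>v. b c (snd v))) F" for c and F :: "('a \<times> 'b) filter"
        by (rule bounded_linear.has_derivative[OF bounded_linear_right snd'])
      show "((\<lambda>y. D y vs) has_derivative (\<lambda>v. D x (v # vs))) (at x)"
      proof (cases vs rule: list_cases)
        case 1
        show ?thesis using FDERIV[OF fst' snd', of x UNIV] unfolding 1 D_simps by (simp add: add.commute)
      next
        case (2 u)
        show ?thesis using has_derivative_add[OF rf[of "fst u"] lf[of "snd u"]]
          unfolding 2 D_simps by (simp add: add.commute)
      qed (simp_all add: D_simps)
    qed simp
  qed (simp add: D_simps)
qed

lemma smooth_on_bilinear:
  assumes b: "bounded_bilinear b" and f: "smooth_on S f" and g: "smooth_on S g"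
  shows "smooth_on S (\<lambda>x. b (f x) (g x))"
  using smooth_on_compose[OF smooth_on_Pair[OF f g] smooth_on_bounded_bilinear[OF b] subset_UNIV]
  by (simp add: comp_def)

lemma smooth_on_linear:
  assumes "bounded_linear L" "smooth_on S f"
  shows "smooth_on S (\<lambda>x. L (f x))"
  using smooth_on_compose[OF assms(2) smooth_on_bounded_linear[OF assms(1)] subset_UNIV]
  by (simp add: comp_def)

lemma smooth_on_add:
  assumes "smooth_on S f" "smooth_on S g"
  shows "smooth_on S (\<lambda>x. f x + g x)"
  using smooth_on_linear[OF _ smooth_on_Pair[OF assms], of "\<lambda>p. fst p + snd p"]
  by (simp add: bounded_linear_add bounded_linear_fst bounded_linear_snd)

lemma smooth_on_diff:
  assumes "smooth_on S f" "smooth_on S g"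
  shows "smooth_on S (\<lambda>x. f x - g x)"
  using smooth_on_linear[OF _ smooth_on_Pair[OF assms], of "\<lambda>p. fst p - snd p"]
  by (simp add: bounded_linear_sub bounded_linear_fst bounded_linear_snd)

lemmas smooth_on_scaleR = smooth_on_bilinear[OF bounded_bilinear_scaleR]
lemmas smooth_on_inner = smooth_on_bilinear[OF bounded_bilinear_inner]
lemmas smooth_on_mult = smooth_on_bilinear[OF bounded_bilinear_mult]

lemma smooth_on_open_inverse: "smooth_on_open (- {0}) (inverse :: real \<Rightarrow> real)"
proof -
  define c where "c = (\<lambda>n (x::real). (-1) ^ n * fact n * inverse x ^ Suc n)"
  define D where "D = (\<lambda>x vs. c (length vs) x * prod_list vs)"
  have c_deriv: "(c n has_real_derivative c (Suc n) x) (at x)" if "x \<noteq> 0" for n x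
  proof -
    have "((\<lambda>x. inverse x ^ Suc n) has_real_derivative
        (1 + of_nat n) * (- (inverse x * 1 * inverse x) * inverse x ^ n)) (at x)"
      by (rule DERIV_power_Suc[OF DERIV_inverse'[OF DERIV_ident that]])
    from DERIV_cmult[OF this, of "(-1) ^ n * fact n"]
    show ?thesis by (simp add: c_def algebra_simps)
  qed
  have norm_prod: "prod_list (map abs vs) = \<bar>prod_list vs\<bar>" for vs :: "real list"
    by (induction vs) (auto simp: abs_mult)
  show ?thesis
  proof (rule smooth_on_open_of_jet_on[where D = D])
    show "jet_on (- {0}) D"
      unfolding jet_on_def
    proof (intro conjI ballI allI)
      show "open (- {0 :: real})" by auto
      fix x :: real assume "x \<in> - {0}"
      then have x: "x \<noteq> 0" by simp
      show "linear (\<lambda>v. D x (us @ v # ws))" for us ws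
        by (simp add: D_def linear_iff algebra_simps)
      show "\<exists>C. \<forall>\<^sub>F y in nhds x. \<forall>vs. length vs = n \<longrightarrow> norm (D y vs) \<le> C * prod_norm vs" for n
      proof -
        have "isCont (c n) x" using c_deriv[OF x] by (rule DERIV_isCont)
        then have "isCont (\<lambda>y. \<bar>c n y\<bar>) x" by (intro continuous_intros)
        then have "((\<lambda>y. \<bar>c n y\<bar>) \<longlongrightarrow> \<bar>c n x\<bar>) (nhds x)"
          unfolding isCont_def by (rule tendsto_at_iff_tendsto_nhds[of "\<lambda>y. \<bar>c n y\<bar>" x, THEN iffD1])
        then have "\<forall>\<^sub>F y in nhds x. \<bar>c n y\<bar> < \<bar>c n x\<bar> + 1"
          by (rule order_tendstoD) simp
        then have "\<forall>\<^sub>F y in nhds x. \<forall>vs. length vs = n \<longrightarrow> norm (D y vs) \<le> (\<bar>c n x\<bar> + 1) * prod_norm vs"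
          by eventually_elim (auto simp: D_def abs_mult norm_prod intro!: mult_right_mono)
        then show ?thesis by blast
      qed
      show "((\<lambda>y. D y vs) has_derivative (\<lambda>v. D x (v # vs))) (at x)" for vs
        unfolding D_def
        by (rule has_derivative_eq_rhs[OF DERIV_cmult_right[OF c_deriv[OF x], unfolded has_field_derivative_def]])
          (simp add: fun_eq_iff mult_ac)
    qed
  qed (simp add: D_def c_def)
qed

lemma smooth_on_inverse:
  fixes f :: "'a::real_normed_vector \<Rightarrow> real"
  assumes f: "smooth_on S f" and nz: "\<And>x. x \<in> S \<Longrightarrow> f x \<noteq> 0"
  shows "smooth_on S (\<lambda>x. inverse (f x))"
proof -
  have "smooth_on (- {0}) (inverse :: real \<Rightarrow> real)"
    by (rule smooth_on_open_imp_smooth_on[OF smooth_on_open_inverse subset_refl])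
  moreover have "f ` S \<subseteq> - {0}" using nz by auto
  ultimately have "smooth_on S (inverse \<circ> f)" by (rule smooth_on_compose[OF f])
  then show ?thesis by (simp add: comp_def)
qed

lemma smooth_on_divide:
  fixes f g :: "'a::real_normed_vector \<Rightarrow> real"
  assumes "smooth_on S f" "smooth_on S g" "\<And>x. x \<in> S \<Longrightarrow> g x \<noteq> 0"
  shows "smooth_on S (\<lambda>x. f x / g x)"
  using smooth_on_mult[OF assms(1) smooth_on_inverse[OF assms(2,3)]] by (simp add: divide_inverse)

lemmas smooth_intros = smooth_on_id smooth_on_const smooth_on_add smooth_on_diff smooth_on_scaleR
  smooth_on_inner smooth_on_mult smooth_on_divide

section \<open>Stereographic projection\<close>

definition stereo :: "'h::real_inner \<Rightarrow> 'h \<Rightarrow> 'h" where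
  "stereo s x = (1 / (1 - inner x s)) *\<^sub>R (x - inner x s *\<^sub>R s)"

text \<open>
  The formulas for the inverse projection and for the metric are polynomials in inner products and in
  this weight \<open>k\<close>, subject to the single relation \<open>k * |y|\<^sup>2 = 1 - k\<close> (\<open>stereo_weight_inner\<close>).
\<close>

definition stereo_weight :: "'h::real_inner \<Rightarrow> real" where
  "stereo_weight y = inverse (1 + inner y y)"

definition stereo_inv :: "'h::real_inner \<Rightarrow> 'h \<Rightarrow> 'h" where
  "stereo_inv s y = s + (2 * stereo_weight y) *\<^sub>R (y - s)"

definition conformal_factor :: "'h::real_inner \<Rightarrow> real" where
  "conformal_factor y = 4 * (stereo_weight y)\<^sup>2"

definition stereo_inv_deriv :: "'h::real_inner \<Rightarrow> 'h \<Rightarrow> 'h \<Rightarrow> 'h" where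
  "stereo_inv_deriv s y v =
     (2 * stereo_weight y) *\<^sub>R v - (4 * inner y v * (stereo_weight y)\<^sup>2) *\<^sub>R (y - s)"

lemma one_plus_inner_pos: "0 < 1 + inner y y"
  using inner_ge_zero[of y] by linarith

lemma stereo_weight_pos: "0 < stereo_weight y"
  unfolding stereo_weight_def using one_plus_inner_pos[of y] by simp

lemma stereo_weight_inner: "stereo_weight y * inner y y = 1 - stereo_weight y"
  unfolding stereo_weight_def using one_plus_inner_pos[of y] by (simp add: field_simps)

lemma stereo_weight_has_derivative:
  "(stereo_weight has_derivative (\<lambda>v. - (2 * inner y v * (stereo_weight y)\<^sup>2))) (at y within S)"
proof -
  have "1 + inner y y \<noteq> 0" using one_plus_inner_pos[of y] by simp
  then show ?thesis
    unfolding stereo_weight_def[abs_def]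
    by (auto intro!: derivative_eq_intros simp: inner_commute power2_eq_square)
qed

lemma smooth_on_stereo_weight: "smooth_on S stereo_weight"
proof -
  have "1 + inner y y \<noteq> 0" for y :: 'a using one_plus_inner_pos[of y] by simp
  then show ?thesis
    unfolding stereo_weight_def[abs_def] by (intro smooth_on_inverse smooth_intros) auto
qed

lemma conformal_factor_pos: "0 < conformal_factor y"
  unfolding conformal_factor_def using stereo_weight_pos[of y] by simp

lemma unit_inner_eq_1:
  assumes "norm s = 1" "norm x = 1" "inner x s = 1"
  shows "x = s"
proof -
  have "inner s x = 1" using assms(3) by (simp add: inner_commute)
  moreover have "inner s s = 1" "inner x x = 1" using assms by (simp_all add: power2_norm_eq_inner[symmetric])
  ultimately have "inner (x - s) (x - s) = 0"
    using assms(3) by (simp add: inner_diff_left inner_diff_right)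
  then show ?thesis by simp
qed

lemma stereo_inv_stereo:
  assumes s: "norm s = 1" and x: "norm x = 1" "x \<noteq> s"
  shows "stereo_inv s (stereo s x) = x"
proof -
  define c where "c = inner x s"
  define d where "d = 1 / (1 - c)"
  have c: "1 - c \<noteq> 0" using unit_inner_eq_1[OF s x(1)] x(2) by (auto simp: c_def)
  then have d: "d * (1 - c) = 1" "d \<noteq> 0" by (auto simp: d_def)
  have ss: "inner s s = 1" "inner x x = 1" using s x by (simp_all add: power2_norm_eq_inner[symmetric])
  have "inner (stereo s x) (stereo s x) = d * d * (1 - c * c)"
    by (simp add: stereo_def inner_diff_left inner_diff_right ss inner_commute[of s x]
        c_def[symmetric] d_def[symmetric])
  with d(1) have "1 + inner (stereo s x) (stereo s x) = 2 * d" by algebra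
  then have w: "2 * stereo_weight (stereo s x) = 1 - c"
    using d by (simp add: stereo_weight_def field_simps)
  have y: "(1 - c) *\<^sub>R stereo s x = x - c *\<^sub>R s" using c by (simp add: stereo_def c_def[symmetric])
  show ?thesis
    unfolding stereo_inv_def w scaleR_diff_right[of "1 - c"] y by (simp add: scaleR_left_diff_distrib)
qed

lemma inner_stereo_inv:
  assumes s: "norm s = 1" and y: "inner y s = 0"
  shows "inner (stereo_inv s y) s = 1 - 2 * stereo_weight y"
  using s y by (simp add: stereo_inv_def inner_add_left inner_diff_left power2_norm_eq_inner[symmetric])

lemma stereo_stereo_inv:
  assumes s: "norm s = 1" and y: "inner y s = 0"
  shows "stereo s (stereo_inv s y) = y"
proof -
  have "stereo s (stereo_inv s y) = (1 / (2 * stereo_weight y)) *\<^sub>R (2 * stereo_weight y) *\<^sub>R y"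
    by (simp add: stereo_def inner_stereo_inv[OF assms]) (simp add: stereo_inv_def algebra_simps)
  then show ?thesis using stereo_weight_pos[of y] by simp
qed

lemma norm_stereo_inv:
  assumes s: "norm s = 1" and y: "inner y s = 0"
  shows "norm (stereo_inv s y) = 1"
proof -
  have ss: "inner s s = 1" using s by (simp add: power2_norm_eq_inner[symmetric])
  have sy: "inner s y = 0" using y by (simp add: inner_commute)
  have "inner (stereo_inv s y) (stereo_inv s y)
      = 1 - 4 * stereo_weight y + 4 * stereo_weight y * (stereo_weight y * inner y y + stereo_weight y)"
    by (simp add: stereo_inv_def inner_add_left inner_add_right inner_diff_left inner_diff_right ss y sy
        algebra_simps)
  also have "\<dots> = 1" unfolding stereo_weight_inner by simp
  finally show ?thesis by (simp add: norm_eq_sqrt_inner)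
qed

lemma inner_stereo:
  assumes "norm s = 1"
  shows "inner (stereo s x) s = 0"
  using assms by (simp add: stereo_def inner_diff_left power2_norm_eq_inner[symmetric])

lemma stereo_inv_has_derivative: "(stereo_inv s has_derivative stereo_inv_deriv s y) (at y within S)"
  unfolding stereo_inv_def[abs_def]
  by (auto intro!: derivative_eq_intros stereo_weight_has_derivative
      simp: stereo_inv_deriv_def fun_eq_iff algebra_simps)

text \<open>
  The cross terms cancel against the square of the radial part because \<open>y\<close> is orthogonal to the
  unit vector \<open>s\<close>, so that \<open>|y - s|\<^sup>2 = 1 + |y|\<^sup>2\<close>.
\<close>

lemma stereo_inv_conformal:
  assumes s: "norm s = 1" and y: "inner y s = 0" and v: "inner v s = 0" and w: "inner w s = 0"
  shows "inner (stereo_inv_deriv s y v) (stereo_inv_deriv s y w) = conformal_factor y * inner v w"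
proof -
  have ss: "inner s s = 1" using s by (simp add: power2_norm_eq_inner[symmetric])
  have sy: "inner s y = 0" "inner s v = 0" "inner s w = 0" using y v w by (simp_all add: inner_commute)
  have "inner (stereo_inv_deriv s y v) (stereo_inv_deriv s y w) = conformal_factor y * inner v w
      + 16 * inner y v * inner y w * (stereo_weight y)^3
        * (stereo_weight y * inner y y + stereo_weight y - 1)"
    unfolding stereo_inv_deriv_def conformal_factor_def
    by (simp add: inner_diff_left inner_diff_right ss y sy v w inner_commute[of v y] inner_commute[of w y]
        power2_eq_square power3_eq_cube algebra_simps)
  then show ?thesis unfolding stereo_weight_inner by simp
qed

lemma smooth_on_stereo_inv: "smooth_on S (stereo_inv s)"
  unfolding stereo_inv_def[abs_def] by (intro smooth_intros smooth_on_stereo_weight)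

lemma smooth_on_stereo: "smooth_on {x. inner x s \<noteq> 1} (stereo s)"
  unfolding stereo_def[abs_def] by (intro smooth_intros) auto

lemma smooth_on_round_form: "smooth_on S (\<lambda>(x :: 'h::real_inner, v :: 'h, w :: 'h). conformal_factor x * inner v w)"
proof -
  have f: "smooth_on S (\<lambda>p. fst (p :: 'h \<times> 'h \<times> 'h))" by (intro smooth_on_bounded_linear bounded_linear_fst)
  have sn: "smooth_on S (\<lambda>p. snd (p :: 'h \<times> 'h \<times> 'h))" by (intro smooth_on_bounded_linear bounded_linear_snd)
  have v: "smooth_on S (\<lambda>p. fst (snd (p :: 'h \<times> 'h \<times> 'h)))" by (rule smooth_on_linear[OF bounded_linear_fst sn])
  have w: "smooth_on S (\<lambda>p. snd (snd (p :: 'h \<times> 'h \<times> 'h)))" by (rule smooth_on_linear[OF bounded_linear_snd sn])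
  have k: "smooth_on S (\<lambda>p. stereo_weight (fst (p :: 'h \<times> 'h \<times> 'h)))"
    using smooth_on_compose[OF f smooth_on_stereo_weight subset_UNIV] by (simp add: comp_def)
  show ?thesis
    unfolding conformal_factor_def case_prod_beta power2_eq_square by (intro smooth_intros k v w)
qed

section \<open>Curvature of the round metric\<close>

text \<open>
  The Christoffel symbol of a conformally flat metric \<open>\<lambda>\<^sup>2 * \<langle>v, w\<rangle>\<close>, where here
  \<open>d(ln \<lambda>)(v) = - 2 * \<langle>y, v\<rangle> / (1 + |y|\<^sup>2)\<close>.
\<close>

definition round_christoffel :: "'h::real_inner \<Rightarrow> 'h \<Rightarrow> 'h \<Rightarrow> 'h" where
  "round_christoffel y v w =
     - ((2 * stereo_weight y) *\<^sub>R (inner y v *\<^sub>R w + inner y w *\<^sub>R v - inner v w *\<^sub>R y))"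

definition round_christoffel_deriv :: "'h::real_inner \<Rightarrow> 'h \<Rightarrow> 'h \<Rightarrow> 'h \<Rightarrow> 'h" where
  "round_christoffel_deriv y v w u =
     (4 * inner y u * (stereo_weight y)\<^sup>2) *\<^sub>R (inner y v *\<^sub>R w + inner y w *\<^sub>R v - inner v w *\<^sub>R y)
     - (2 * stereo_weight y) *\<^sub>R (inner u v *\<^sub>R w + inner u w *\<^sub>R v - inner v w *\<^sub>R u)"

lemma conformal_factor_has_derivative: "(conformal_factor has_derivative (\<lambda>u. - 16 * inner y u * stereo_weight y ^ 3)) (at y)"
  unfolding conformal_factor_def[abs_def]
  by (auto intro!: derivative_eq_intros stereo_weight_has_derivative
      simp: fun_eq_iff power2_eq_square power3_eq_cube algebra_simps)

lemma round_christoffel_has_derivative: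
  "((\<lambda>y. round_christoffel y v w) has_derivative round_christoffel_deriv y v w) (at y)"
  unfolding round_christoffel_def
  by (auto intro!: derivative_eq_intros stereo_weight_has_derivative
      simp: round_christoffel_deriv_def fun_eq_iff power2_eq_square algebra_simps)

lemma dir_deriv_eqI:
  assumes "(g has_derivative g') (at x)" "\<forall>\<^sub>F t in nhds 0. f (x + t *\<^sub>R u) = g (x + t *\<^sub>R u)"
  shows "dir_deriv f x u = g' u"
proof -
  have "((\<lambda>t. x + t *\<^sub>R u) has_derivative (\<lambda>t. t *\<^sub>R u)) (at 0)"
    by (auto intro!: derivative_eq_intros)
  then have "((\<lambda>t. g (x + t *\<^sub>R u)) has_derivative (\<lambda>t. g' (t *\<^sub>R u))) (at 0)"
    using has_derivative_compose[of "\<lambda>t. x + t *\<^sub>R u" _ 0 UNIV g g'] assms(1) by simp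
  then have "((\<lambda>t. g (x + t *\<^sub>R u)) has_vector_derivative g' u) (at 0)"
    unfolding has_vector_derivative_def
    using linear_scale[OF bounded_linear.linear[OF has_derivative_bounded_linear[OF assms(1)]]] by simp
  moreover obtain N where N: "open N" "0 \<in> N" "\<And>t. t \<in> N \<Longrightarrow> g (x + t *\<^sub>R u) = f (x + t *\<^sub>R u)"
    using assms(2) unfolding eventually_nhds by force
  ultimately have "((\<lambda>t. f (x + t *\<^sub>R u)) has_vector_derivative g' u) (at 0)"
    by (rule has_vector_derivative_transform_within_open)
  then show ?thesis unfolding dir_deriv_def by (rule vector_derivative_at)
qed

lemma eventually_line_in_openin:
  fixes E :: "'h::real_normed_vector set"
  assumes E: "subspace E" and X: "openin (top_of_set E) X" and x: "x \<in> X" and u: "u \<in> E"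
  shows "\<forall>\<^sub>F t in nhds 0. x + t *\<^sub>R u \<in> X"
proof -
  obtain T where T: "open T" "X = E \<inter> T" using X by (auto simp: openin_open)
  have "((\<lambda>t::real. x + t *\<^sub>R u) \<longlongrightarrow> x + 0 *\<^sub>R u) (nhds 0)"
    by (intro tendsto_intros filterlim_ident)
  then have "\<forall>\<^sub>F t in nhds 0. x + t *\<^sub>R u \<in> T"
    using T x by (auto dest: topological_tendstoD)
  then show ?thesis
  proof eventually_elim
    case (elim t)
    then show ?case using T x u E by (auto intro!: subspace_add subspace_scale)
  qed
qed

text \<open>
  Knowing \<open>B\<close> on the relatively open set \<open>X\<close> suffices to compute directional derivatives: they are
  taken along \<open>E\<close>, and a short segment in such a direction stays inside \<open>X\<close>.
\<close>

locale round_metric_rep =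
  fixes E X :: "'h::real_inner set" and B :: "'h \<Rightarrow> 'h \<Rightarrow> 'h \<Rightarrow> real"
  assumes E: "subspace E" and X: "openin (top_of_set E) X"
    and B: "\<And>x v w. x \<in> X \<Longrightarrow> v \<in> E \<Longrightarrow> w \<in> E \<Longrightarrow> B x v w = conformal_factor x * inner v w"
begin

lemma X_E: "x \<in> X \<Longrightarrow> x \<in> E"
  using openin_subset[OF X] by auto

lemma dir_deriv_B:
  assumes "x \<in> X" "u \<in> E" "v \<in> E" "w \<in> E"
  shows "dir_deriv (\<lambda>y. B y v w) x u = - 16 * inner x u * stereo_weight x ^ 3 * inner v w"
proof (rule dir_deriv_eqI)
  show "((\<lambda>y. conformal_factor y * inner v w) has_derivative (\<lambda>u. - 16 * inner x u * stereo_weight x ^ 3 * inner v w)) (at x)"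
    by (rule has_derivative_mult_left[OF conformal_factor_has_derivative])
  show "\<forall>\<^sub>F t in nhds 0. B (x + t *\<^sub>R u) v w = conformal_factor (x + t *\<^sub>R u) * inner v w"
    using eventually_line_in_openin[OF E X assms(1,2)] by eventually_elim (simp add: B assms)
qed

lemma round_christoffel_in: "y \<in> E \<Longrightarrow> v \<in> E \<Longrightarrow> w \<in> E \<Longrightarrow> round_christoffel y v w \<in> E"
  unfolding round_christoffel_def by (intro subspace_neg subspace_scale subspace_add subspace_diff E)

lemma christoffel_eq:
  assumes x: "x \<in> X" and v: "v \<in> E" and w: "w \<in> E"
  shows "christoffel E B x v w = round_christoffel x v w"
  unfolding christoffel_def
proof (rule the_equality, intro conjI ballI)
  show G: "round_christoffel x v w \<in> E" by (intro round_christoffel_in X_E x v w)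
  show eq: "2 * B x (round_christoffel x v w) u =
      dir_deriv (\<lambda>y. B y w u) x v + dir_deriv (\<lambda>y. B y v u) x w - dir_deriv (\<lambda>y. B y v w) x u"
    if u: "u \<in> E" for u
  proof -
    have "2 * B x (round_christoffel x v w) u = 2 * (conformal_factor x * inner (round_christoffel x v w) u)"
      by (simp add: B x u G)
    also have "\<dots> = - 16 * stereo_weight x ^ 3 * (inner x v * inner w u + inner x w * inner v u - inner x u * inner v w)"
      by (simp add: conformal_factor_def round_christoffel_def inner_add_left inner_diff_left inner_minus_left
          power2_eq_square power3_eq_cube algebra_simps)
    finally show ?thesis
      using x u v w by (simp add: dir_deriv_B algebra_simps)
  qed
  fix z assume z: "z \<in> E \<and> (\<forall>u\<in>E. 2 * B x z u =
      dir_deriv (\<lambda>y. B y w u) x v + dir_deriv (\<lambda>y. B y v u) x w - dir_deriv (\<lambda>y. B y v w) x u)"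
  let ?d = "z - round_christoffel x v w"
  have d: "?d \<in> E" using z G by (auto intro: subspace_diff E)
  then have "B x z ?d = B x (round_christoffel x v w) ?d" using z eq[OF d] by auto
  then have "conformal_factor x * inner ?d ?d = 0" using z G d x by (simp add: B inner_diff_left algebra_simps)
  then show "z = round_christoffel x v w" using conformal_factor_pos[of x] by simp
qed

lemma dir_deriv_christoffel:
  assumes x: "x \<in> X" and u: "u \<in> E" and v: "v \<in> E" and w: "w \<in> E"
  shows "dir_deriv (\<lambda>y. christoffel E B y v w) x u = round_christoffel_deriv x v w u"
proof (rule dir_deriv_eqI[OF round_christoffel_has_derivative])
  show "\<forall>\<^sub>F t in nhds 0. christoffel E B (x + t *\<^sub>R u) v w = round_christoffel (x + t *\<^sub>R u) v w"
    using eventually_line_in_openin[OF E X x u] by eventually_elim (simp add: christoffel_eq v w)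
qed

text \<open>
  The curvature tensor of a space of constant curvature 1: after the quadratic terms have cancelled,
  the coefficient \<open>4 * k * (1 - k * |x|\<^sup>2)\<close> remains, which is the conformal factor.
\<close>

lemma riemann_tensor_eq:
  assumes x: "x \<in> X" and u: "u \<in> E" and v: "v \<in> E" and w: "w \<in> E"
  shows "riemann_tensor E B x u v w = conformal_factor x *\<^sub>R (inner v w *\<^sub>R u - inner u w *\<^sub>R v)"
proof -
  define k where "k = stereo_weight x"
  have k: "k * inner x x = 1 - k" unfolding k_def by (rule stereo_weight_inner)
  have G: "round_christoffel x v w \<in> E" "round_christoffel x u w \<in> E"
    by (intro round_christoffel_in X_E x v w u)+
  let ?R = "round_christoffel_deriv x v w u - round_christoffel_deriv x u w v
      + round_christoffel x u (round_christoffel x v w) - round_christoffel x v (round_christoffel x u w)"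
  have R: "riemann_tensor E B x u v w = ?R"
    unfolding riemann_tensor_def using x u v w G by (simp add: dir_deriv_christoffel christoffel_eq)
  have "inner ?R z = (4 * k * (1 - k * inner x x)) * (inner v w * inner u z - inner u w * inner v z)" for z
    unfolding round_christoffel_deriv_def round_christoffel_def k_def[symmetric]
    by (simp add: power2_eq_square inner_add_left inner_diff_left inner_add_right inner_diff_right
        inner_commute[of u x] inner_commute[of v x] inner_commute[of w x] inner_commute[of v u]
        inner_commute[of w u] inner_commute[of w v] algebra_simps)
  then have "inner ?R z = inner (conformal_factor x *\<^sub>R (inner v w *\<^sub>R u - inner u w *\<^sub>R v)) z" for z
    unfolding k by (simp add: conformal_factor_def k_def[symmetric] power2_eq_square inner_diff_left)
  then have "\<forall>z. inner ?R z = inner (conformal_factor x *\<^sub>R (inner v w *\<^sub>R u - inner u w *\<^sub>R v)) z" by (rule allI)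
  then show ?thesis unfolding R by (rule vector_eq_rdot[THEN iffD1])
qed

text \<open>
  By the equality case of the Cauchy-Schwarz inequality the denominator vanishes for dependent
  vectors only.
\<close>

lemma sectional_curvature_eq_1:
  assumes x: "x \<in> X" and u: "u \<in> E" and v: "v \<in> E" and ind: "u \<noteq> v" "independent {u, v}"
  shows "sectional_curvature E B x u v = 1"
proof -
  have "(inner u v)\<^sup>2 \<noteq> inner u u * inner v v"
  proof
    assume eq: "(inner u v)\<^sup>2 = inner u u * inner v v"
    have v0: "v \<noteq> 0" using ind dependent_zero by blast
    have "inner (inner v v *\<^sub>R u - inner u v *\<^sub>R v) (inner v v *\<^sub>R u - inner u v *\<^sub>R v) = 0"
      using eq by (simp add: inner_diff_left inner_diff_right inner_commute[of v u] power2_eq_square algebra_simps)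
    then have "inner v v *\<^sub>R u = inner u v *\<^sub>R v" by simp
    then have "u = (inner u v / inner v v) *\<^sub>R v"
      using v0 by (metis (no_types, lifting) divide_inverse_commute inner_eq_zero_iff scaleR_scaleR
          left_inverse scaleR_one)
    then have "u \<in> span {v}" by (metis span_base span_scale singletonI)
    then show False using ind by (metis dependent_def insert_Diff_single insertI1 insert_absorb2 Diff_insert_absorb singletonD)
  qed
  then have nz: "(inner u u * inner v v - (inner u v)\<^sup>2) \<noteq> 0" by simp
  let ?R = "conformal_factor x *\<^sub>R (inner v v *\<^sub>R u - inner u v *\<^sub>R v)"
  have "?R \<in> E" using u v by (intro subspace_scale subspace_diff E)
  then have "B x (riemann_tensor E B x u v v) u = conformal_factor x * (conformal_factor x * (inner u u * inner v v - (inner u v)\<^sup>2))"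
    using x u v by (simp add: riemann_tensor_eq B inner_diff_left inner_commute[of v u] power2_eq_square algebra_simps)
  moreover have "B x u u * B x v v - (B x u v)\<^sup>2 = conformal_factor x * (conformal_factor x * (inner u u * inner v v - (inner u v)\<^sup>2))"
    using x u v by (simp add: B power2_eq_square algebra_simps)
  ultimately show ?thesis
    unfolding sectional_curvature_def using nz conformal_factor_pos[of x] by simp
qed

end

section \<open>Orbits of free isometric actions on a sphere\<close>

lemma homeomorphic_mapI:
  assumes "continuous_map X Y f" "continuous_map Y X g"
    "\<And>x. x \<in> topspace X \<Longrightarrow> g (f x) = x" "\<And>y. y \<in> topspace Y \<Longrightarrow> f (g y) = y"
  shows "homeomorphic_map X Y f"
  unfolding homeomorphic_map_maps homeomorphic_maps_def using assms by blast

lemma neighbourhood_openin: "openin X U \<Longrightarrow> x \<in> U \<Longrightarrow> neighbourhood X x U"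
  by (simp add: neighbourhood_def interior_of_openin openin_subset)

text \<open>
  The action is described by linear maps of the ambient space that are isometric on \<open>H\<close>. Separation
  says that an orbit does not accumulate anywhere, not even at its own points; the vector \<open>e\<close> serves as
  the pole of the stereographic projections.
\<close>

locale free_isometric_action = group G for G :: "('g, 'b) monoid_scheme" (structure) +
  fixes T :: "'g \<Rightarrow> 'h::real_inner \<Rightarrow> 'h" and H :: "'h set" and e :: 'h
  assumes H: "subspace H" "complete H" and e: "e \<in> H" "norm e = 1"
    and T_linear: "g \<in> carrier G \<Longrightarrow> bounded_linear (T g)"
    and T_in: "\<lbrakk>g \<in> carrier G; x \<in> H\<rbrakk> \<Longrightarrow> T g x \<in> H"
    and T_inner: "\<lbrakk>g \<in> carrier G; x \<in> H; y \<in> H\<rbrakk> \<Longrightarrow> inner (T g x) (T g y) = inner x y"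
    and T_mult: "\<lbrakk>g \<in> carrier G; h \<in> carrier G; x \<in> H\<rbrakk> \<Longrightarrow> T (g \<otimes> h) x = T g (T h x)"
    and T_one: "x \<in> H \<Longrightarrow> T \<one> x = x"
    and free: "\<lbrakk>g \<in> carrier G; x \<in> H; norm x = 1; T g x = x\<rbrakk> \<Longrightarrow> g = \<one>"
    and separated: "\<lbrakk>x \<in> H; norm x = 1; y \<in> H; norm y = 1\<rbrakk> \<Longrightarrow>
      \<exists>d>0. \<forall>g\<in>carrier G. T g x \<noteq> y \<longrightarrow> d \<le> dist (T g x) y"
begin

definition S :: "'h set" where "S = {x \<in> H. norm x = 1}"
definition E :: "'h set" where "E = {x \<in> H. inner x e = 0}"
definition act :: "'g \<Rightarrow> 'h \<Rightarrow> 'h" where "act g = restrict (T g) S"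
definition proj :: "'h \<Rightarrow> 'h set" where "proj = orbit G act"
definition Q :: "'h set topology" where "Q = quotient_topology (top_of_set S) proj"

lemma S_H: "x \<in> S \<Longrightarrow> x \<in> H" by (simp add: S_def)

lemma T_dist:
  assumes "g \<in> carrier G" "x \<in> H" "y \<in> H"
  shows "dist (T g x) (T g y) = dist x y"
proof -
  have "T g x - T g y = T g (x - y)"
    using linear_diff[OF bounded_linear.linear[OF T_linear[OF assms(1)]]] by simp
  moreover have "x - y \<in> H" using assms H(1) by (simp add: subspace_diff)
  ultimately show ?thesis using assms by (simp add: dist_norm norm_eq_sqrt_inner T_inner)
qed

lemma T_S: "g \<in> carrier G \<Longrightarrow> x \<in> S \<Longrightarrow> T g x \<in> S"
  by (simp add: S_def T_in norm_eq_sqrt_inner T_inner)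

lemma T_inv: "g \<in> carrier G \<Longrightarrow> x \<in> H \<Longrightarrow> T (inv g) (T g x) = x"
  using T_mult[of "inv g" g x] by (simp add: T_one)

lemma T_inv': "g \<in> carrier G \<Longrightarrow> x \<in> H \<Longrightarrow> T g (T (inv g) x) = x"
  using T_mult[of g "inv g" x] by (simp add: T_one)

lemma T_continuous: "g \<in> carrier G \<Longrightarrow> continuous_on A (T g)"
  by (rule linear_continuous_on[OF T_linear])

lemma S_separated:
  assumes "x \<in> S" "y \<in> S"
  obtains d where "d > 0" "\<And>g. g \<in> carrier G \<Longrightarrow> T g x \<noteq> y \<Longrightarrow> d \<le> dist (T g x) y"
  using separated[of x y] assms unfolding S_def by blast

lemma S_free: "g \<in> carrier G \<Longrightarrow> x \<in> S \<Longrightarrow> T g x = x \<Longrightarrow> g = \<one>"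
  using free unfolding S_def by blast

lemma closed_H: "closed H" by (rule complete_imp_closed[OF H(2)])

lemma complete_S: "complete S"
proof -
  have "S = H \<inter> {x. norm x = 1}" by (auto simp: S_def)
  moreover have "closed {x :: 'h. norm x = 1}" by (intro closed_Collect_eq continuous_intros)
  ultimately show ?thesis using complete_Int_closed[OF H(2)] by simp
qed

lemma E_eq: "E = H \<inter> {x. inner e x = 0}"
  by (auto simp: E_def inner_commute)

lemma subspace_E: "subspace E"
  unfolding E_eq by (intro subspace_inter H subspace_hyperplane)

lemma complete_E: "complete E"
  unfolding E_eq by (intro complete_Int_closed H closed_hyperplane)

lemma E_H: "x \<in> E \<Longrightarrow> x \<in> H" by (simp add: E_def)

lemma proj_eq: "x \<in> S \<Longrightarrow> proj x = {T g x | g. g \<in> carrier G}"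
  by (simp add: proj_def orbit_def act_def)

lemma mem_proj: "x \<in> S \<Longrightarrow> x \<in> proj x"
  using T_one[of x] by (auto simp: proj_eq S_H intro!: exI[of _ \<one>])

lemma proj_memD: "x \<in> S \<Longrightarrow> y \<in> proj x \<Longrightarrow> \<exists>g\<in>carrier G. T g x = y"
  by (auto simp: proj_eq)

lemma proj_T: 
  assumes g: "g \<in> carrier G" and x: "x \<in> S" 
  shows "proj (T g x) = proj x"
proof -
  have sub: "proj (T g x) \<subseteq> proj x" if gx: "g \<in> carrier G" "x \<in> S" for g x
  proof
    fix y assume "y \<in> proj (T g x)"
    then obtain h where h: "h \<in> carrier G" "y = T h (T g x)" using gx by (auto simp: proj_eq T_S)
    then have "y = T (h \<otimes> g) x" using gx by (simp add: T_mult S_H)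
    then show "y \<in> proj x" using h(1) gx by (auto simp: proj_eq)
  qed
  have "proj x = proj (T (inv g) (T g x))" using assms by (simp add: T_inv S_H)
  also have "\<dots> \<subseteq> proj (T g x)" using assms by (intro sub T_S) auto
  finally show ?thesis using sub[OF g x] by blast
qed

lemma proj_eq_iff:
  assumes "x \<in> S" "y \<in> S"
  shows "proj x = proj y \<longleftrightarrow> (\<exists>g\<in>carrier G. T g x = y)"
  using assms proj_T[of _ x] proj_memD[OF assms(1), of y] mem_proj[OF assms(2)] by auto

lemma proj_memE:
  assumes "x \<in> S" "y \<in> proj x"
  shows "y \<in> S" "proj y = proj x"
  using proj_memD[OF assms] assms(1) by (auto simp: T_S proj_T)

lemma act_eq: "x \<in> S \<Longrightarrow> act g x = T g x" by (simp add: act_def)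

lemma group_action_act: "group_action G S act"
proof -
  have bij: "act g \<in> Bij S" if g: "g \<in> carrier G" for g
    unfolding Bij_def
  proof (intro IntI CollectI)
    show "act g \<in> extensional S" by (simp add: act_def)
    show "bij_betw (act g) S S"
      by (rule bij_betw_byWitness[where f' = "T (inv g)"])
        (use g in \<open>auto simp: act_eq T_inv T_inv' T_S S_H\<close>)
  qed
  have "act (g \<otimes> h) = compose S (act g) (act h)" if "g \<in> carrier G" "h \<in> carrier G" for g h
    using that by (auto simp: compose_def act_def restrict_def fun_eq_iff T_mult S_H T_S)
  then have "act \<in> hom G (BijGroup S)"
    using bij by (auto simp: hom_def BijGroup_def)
  then show ?thesis
    by (simp add: group_action_def group_hom_def group_hom_axioms_def group_axioms group_BijGroup)
qed

lemma homeomorphic_act: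
  assumes g: "g \<in> carrier G"
  shows "homeomorphic_map (top_of_set S) (top_of_set S) (act g)"
proof (rule homeomorphic_mapI)
  have c: "continuous_map (top_of_set S) (top_of_set S) (act g)" if "g \<in> carrier G" for g
  proof -
    have "continuous_on S (act g)"
      using T_continuous[OF that, of S] by (rule continuous_on_eq) (simp add: act_eq)
    then show ?thesis using that by (auto simp: act_eq T_S)
  qed
  show "continuous_map (top_of_set S) (top_of_set S) (act g)" using g by (rule c)
  show "continuous_map (top_of_set S) (top_of_set S) (act (inv g))" using g by (intro c) simp
qed (use g in \<open>auto simp: act_eq T_S T_inv T_inv' S_H\<close>)

lemma stabilizer_act: "x \<in> S \<Longrightarrow> stabilizer G act x = {\<one>}"
  using S_free by (auto simp: stabilizer_def act_eq T_one S_H)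

text \<open>
  The triangle inequality for a ball of half the distance between \<open>x\<close> and the rest of its orbit.
\<close>

lemma small_neighbourhood:
  assumes x: "x \<in> S"
  obtains U where "openin (top_of_set S) U" "x \<in> U"
    "\<And>g. g \<in> carrier G \<Longrightarrow> g \<noteq> \<one> \<Longrightarrow> T g ` U \<inter> U = {}"
proof -
  obtain d where d: "d > 0" "\<And>g. g \<in> carrier G \<Longrightarrow> T g x \<noteq> x \<Longrightarrow> d \<le> dist (T g x) x"
    using S_separated[OF x x] by blast
  let ?U = "S \<inter> ball x (d / 2)"
  have "T g ` ?U \<inter> ?U = {}" if g: "g \<in> carrier G" "g \<noteq> \<one>" for g
  proof (rule ccontr)
    assume "T g ` ?U \<inter> ?U \<noteq> {}"
    then obtain y where y: "y \<in> ?U" "T g y \<in> ?U" by blast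
    have "dist (T g x) x \<le> dist (T g x) (T g y) + dist (T g y) x" by (rule dist_triangle)
    also have "\<dots> < d / 2 + d / 2"
      using y g(1) x by (intro add_strict_mono) (auto simp: T_dist S_H dist_commute)
    finally show False using d(2)[OF g(1)] S_free[OF g(1) x] g(2) by fastforce
  qed
  then show ?thesis using that[of ?U] d(1) x by (simp add: openin_open_Int)
qed

lemma orbit_separation:
  assumes x: "x \<in> S" and y: "y \<in> S" and ne: "proj x \<noteq> proj y"
  obtains U V where "openin (top_of_set S) U" "x \<in> U" "openin (top_of_set S) V" "y \<in> V"
    "\<And>g. g \<in> carrier G \<Longrightarrow> T g ` U \<inter> V = {}"
proof -
  obtain d where d: "d > 0" "\<And>g. g \<in> carrier G \<Longrightarrow> T g x \<noteq> y \<Longrightarrow> d \<le> dist (T g x) y"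
    using S_separated[OF x y] by blast
  let ?U = "S \<inter> ball x (d / 2)" and ?V = "S \<inter> ball y (d / 2)"
  have "T g ` ?U \<inter> ?V = {}" if g: "g \<in> carrier G" for g
  proof (rule ccontr)
    assume "T g ` ?U \<inter> ?V \<noteq> {}"
    then obtain z where z: "z \<in> ?U" "T g z \<in> ?V" by blast
    have "dist (T g x) y \<le> dist (T g x) (T g z) + dist (T g z) y" by (rule dist_triangle)
    also have "\<dots> < d / 2 + d / 2"
      using z g(1) x by (intro add_strict_mono) (auto simp: T_dist S_H dist_commute)
    finally have "dist (T g x) y < d" by simp
    moreover have "T g x \<noteq> y" using ne g x y by (auto simp: proj_eq_iff)
    ultimately show False using d(2)[OF g(1)] by simp
  qed
  then show ?thesis using that[of ?U ?V] d(1) x y by (simp add: openin_open_Int)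
qed

theorem properly_discontinuous_act: "properly_discontinuous G (top_of_set S) act"
  unfolding properly_discontinuous_def topspace_euclidean_subtopology
proof (intro conjI ballI impI)
  show "group_action G S act" by (rule group_action_act)
  show "homeomorphic_map (top_of_set S) (top_of_set S) (act g)" if "g \<in> carrier G" for g
    using that by (rule homeomorphic_act)
  have act_image: "act g ` U = T g ` U" if "openin (top_of_set S) U" for g U
    using openin_subset[OF that] by (intro image_cong) (auto simp: act_eq)
  show "\<exists>U V. neighbourhood (top_of_set S) x U \<and> neighbourhood (top_of_set S) y V \<and>
      (\<forall>g\<in>carrier G. act g ` U \<inter> V = {})"
    if xy: "x \<in> S" "y \<in> S" "y \<notin> orbit G act x" for x y
  proof -
    have "proj x \<noteq> proj y" using xy mem_proj[of y] by (auto simp: proj_def)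
    then obtain U V where "openin (top_of_set S) U" "x \<in> U" "openin (top_of_set S) V" "y \<in> V"
      "\<And>g. g \<in> carrier G \<Longrightarrow> T g ` U \<inter> V = {}"
      using orbit_separation[OF xy(1,2)] by blast
    then show ?thesis
      by (intro exI[of _ U] exI[of _ V]) (simp add: neighbourhood_openin act_image)
  qed
  show "finite (stabilizer G act x)" if "x \<in> S" for x by (simp add: stabilizer_act that)
  show "\<exists>U. neighbourhood (top_of_set S) x U \<and> (\<forall>g\<in>stabilizer G act x. act g ` U = U) \<and>
      (\<forall>g\<in>carrier G - stabilizer G act x. act g ` U \<inter> U = {})" if x: "x \<in> S" for x
  proof -
    obtain U where U: "openin (top_of_set S) U" "x \<in> U"
      "\<And>g. g \<in> carrier G \<Longrightarrow> g \<noteq> \<one> \<Longrightarrow> T g ` U \<inter> U = {}"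
      using small_neighbourhood[OF x] by blast
    have "act \<one> ` U = id ` U"
      unfolding act_image[OF U(1)]
      by (intro image_cong) (use openin_subset[OF U(1)] in \<open>auto simp: T_one S_H\<close>)
    then show ?thesis using U x
      by (intro exI[of _ U]) (simp add: neighbourhood_openin stabilizer_act act_image)
  qed
qed

lemma openin_Q: "openin Q V \<longleftrightarrow> V \<subseteq> proj ` S \<and> openin (top_of_set S) {x \<in> S. proj x \<in> V}"
  by (simp add: Q_def openin_quotient_topology)

lemma topspace_Q: "topspace Q = proj ` S"
proof
  show "topspace Q \<subseteq> proj ` S" using openin_Q openin_topspace by blast
  have "{x \<in> S. proj x \<in> proj ` S} = S" by auto
  then have "openin Q (proj ` S)" by (simp add: openin_Q)
  then show "proj ` S \<subseteq> topspace Q" by (rule openin_subset)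
qed

lemma openin_T_image:
  assumes U: "openin (top_of_set S) U" and g: "g \<in> carrier G"
  shows "openin (top_of_set S) (T g ` U)"
proof -
  have sub: "U \<subseteq> S" using openin_subset[OF U] by simp
  have "T g ` U = S \<inter> T (inv g) -` U"
  proof (intro equalityI subsetI)
    fix y assume "y \<in> S \<inter> T (inv g) -` U"
    then show "y \<in> T g ` U" using T_inv'[OF g, of y] S_H by force
  qed (use sub g in \<open>auto simp: T_S T_inv S_H subset_iff\<close>)
  moreover have "openin (top_of_set S) (S \<inter> T (inv g) -` U)"
    using g by (intro continuous_openin_preimage[OF _ _ U] T_continuous) (auto simp: T_S)
  ultimately show ?thesis by simp
qed

text \<open>
  This makes \<open>proj\<close> an open map, because the isometries are homeomorphisms.
\<close>

lemma saturation:
  assumes "U \<subseteq> S"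
  shows "{x \<in> S. proj x \<in> proj ` U} = (\<Union>g\<in>carrier G. T g ` U)"
proof (intro equalityI subsetI)
  fix x assume "x \<in> {x \<in> S. proj x \<in> proj ` U}"
  then obtain u where u: "x \<in> S" "u \<in> U" "proj u = proj x" by auto
  then show "x \<in> (\<Union>g\<in>carrier G. T g ` U)" using proj_eq_iff[of u x] assms by blast
next
  fix x assume "x \<in> (\<Union>g\<in>carrier G. T g ` U)"
  then show "x \<in> {x \<in> S. proj x \<in> proj ` U}" using assms by (auto simp: T_S proj_T subset_iff)
qed

lemma openin_proj_image:
  assumes U: "openin (top_of_set S) U"
  shows "openin Q (proj ` U)"
proof -
  have sub: "U \<subseteq> S" using openin_subset[OF U] by simp
  then show ?thesis
    unfolding openin_Q saturation[OF sub] using U by (auto intro!: openin_Union openin_T_image)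
qed

lemma continuous_proj: "continuous_map (top_of_set S) Q proj"
  unfolding continuous_map by (auto simp: topspace_Q openin_Q)

lemma openin_S_proj:
  "openin Q V \<Longrightarrow> openin (top_of_set S) {x \<in> S. proj x \<in> V}"
  by (simp add: openin_Q)

lemma Hausdorff_Q: "Hausdorff_space Q"
  unfolding Hausdorff_space_def
proof (intro allI impI; elim conjE)
  fix p q assume "p \<in> topspace Q" "q \<in> topspace Q" and ne: "p \<noteq> q"
  then obtain x y where xy: "x \<in> S" "p = proj x" "y \<in> S" "q = proj y" by (auto simp: topspace_Q)
  then obtain U V where UV: "openin (top_of_set S) U" "x \<in> U" "openin (top_of_set S) V" "y \<in> V"
    "\<And>g. g \<in> carrier G \<Longrightarrow> T g ` U \<inter> V = {}"
    using orbit_separation[OF xy(1,3)] ne by blast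
  have "disjnt (proj ` U) (proj ` V)"
    unfolding disjnt_iff
  proof (intro allI notI; elim conjE)
    fix p assume "p \<in> proj ` U" "p \<in> proj ` V"
    then obtain u v where uv: "u \<in> U" "v \<in> V" "proj u = proj v" by force
    then obtain g where "g \<in> carrier G" "T g u = v"
      using proj_eq_iff[of u v] openin_subset[OF UV(1)] openin_subset[OF UV(3)] by auto
    then show False using UV(5) uv by blast
  qed
  then show "\<exists>U V. openin Q U \<and> openin Q V \<and> p \<in> U \<and> q \<in> V \<and> disjnt U V"
    using UV xy openin_proj_image by (intro exI[of _ "proj ` U"] exI[of _ "proj ` V"]) auto
qed

lemma inj_on_small:
  assumes "U \<subseteq> S" "\<And>g. g \<in> carrier G \<Longrightarrow> g \<noteq> \<one> \<Longrightarrow> T g ` U \<inter> U = {}"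
  shows "inj_on proj U"
proof (rule inj_onI)
  fix x y assume xy: "x \<in> U" "y \<in> U" "proj x = proj y"
  then obtain g where g: "g \<in> carrier G" "T g x = y" using proj_eq_iff[of x y] assms(1) by blast
  then have "g = \<one>" using assms(2)[of g] xy by blast
  then show "x = y" using g xy assms(1) by (auto simp: T_one S_H subset_iff)
qed

lemma continuous_lift:
  assumes U: "openin (top_of_set S) U" and inj: "inj_on proj U"
  shows "continuous_map (subtopology Q (proj ` U)) (top_of_set U) (inv_into U proj)"
  unfolding continuous_map_def
proof (intro conjI allI impI)
  have sub: "U \<subseteq> S" using openin_subset[OF U] by simp
  have top: "topspace (subtopology Q (proj ` U)) = proj ` U"
    using sub by (auto simp: topspace_Q)
  show "inv_into U proj \<in> topspace (subtopology Q (proj ` U)) \<rightarrow> topspace (top_of_set U)"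
    unfolding top by (auto simp: inv_into_into)
  fix W assume W: "openin (top_of_set U) W"
  then have WU: "W \<subseteq> U" using openin_subset by fastforce
  have "openin (top_of_set S) W" using W U openin_trans by blast
  then have "openin Q (proj ` W)" by (rule openin_proj_image)
  moreover have "{p \<in> proj ` U. inv_into U proj p \<in> W} = proj ` W"
    using WU inj by (auto simp: inv_into_f_f subset_iff)
  ultimately show "openin (subtopology Q (proj ` U)) {p \<in> topspace (subtopology Q (proj ` U)). inv_into U proj p \<in> W}"
    unfolding top using WU by (simp add: openin_open_subtopology openin_proj_image U image_mono)
qed

lemma homeomorphic_proj:
  assumes U: "openin (top_of_set S) U" and inj: "inj_on proj U"
  shows "homeomorphic_map (subtopology (top_of_set S) U) (subtopology Q (proj ` U)) proj"
proof (rule homeomorphic_mapI)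
  have sub: "U \<subseteq> S" using openin_subset[OF U] by simp
  then have top: "subtopology (top_of_set S) U = top_of_set U"
    by (simp add: subtopology_subtopology Int_absorb1)
  show "continuous_map (subtopology (top_of_set S) U) (subtopology Q (proj ` U)) proj"
    using continuous_map_from_subtopology[OF continuous_proj]
    by (auto simp: continuous_map_in_subtopology)
  show "continuous_map (subtopology Q (proj ` U)) (subtopology (top_of_set S) U) (inv_into U proj)"
    unfolding top by (rule continuous_lift[OF U inj])
qed (use inj in \<open>auto simp: inv_into_f_f f_inv_into_f\<close>)

text \<open>
  The sheets over the image of a small neighbourhood \<open>U\<close> are its translates, which are pairwise
  disjoint by freeness.
\<close>

theorem covering_map_proj: "covering_map (top_of_set S) Q proj"
  unfolding covering_map_def
proof (intro conjI ballI)
  show "continuous_map (top_of_set S) Q proj" by (rule continuous_proj)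
  show "proj ` topspace (top_of_set S) = topspace Q" by (simp add: topspace_Q)
  fix p assume "p \<in> topspace Q"
  then obtain x where x: "x \<in> S" "p = proj x" by (auto simp: topspace_Q)
  obtain U where U: "openin (top_of_set S) U" "x \<in> U"
      "\<And>g. g \<in> carrier G \<Longrightarrow> g \<noteq> \<one> \<Longrightarrow> T g ` U \<inter> U = {}"
    using small_neighbourhood[OF x(1)] by blast
  have sub: "U \<subseteq> S" using openin_subset[OF U(1)] by simp
  let ?\<U> = "(\<lambda>g. T g ` U) ` carrier G"
  have img: "proj ` T g ` U = proj ` U" if "g \<in> carrier G" for g
    unfolding image_image using sub that by (intro image_cong) (auto simp: proj_T)
  have disj: "pairwise disjnt ?\<U>"
  proof (rule pairwiseI)
    fix A B assume "A \<in> ?\<U>" "B \<in> ?\<U>" "A \<noteq> B"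
    then obtain g h where gh: "g \<in> carrier G" "h \<in> carrier G" "A = T g ` U" "B = T h ` U" "g \<noteq> h"
      by blast
    have "A \<inter> B = {}"
    proof (rule ccontr)
      assume "A \<inter> B \<noteq> {}"
      then obtain u v where uv: "u \<in> U" "v \<in> U" "T g u = T h v" using gh by auto
      have "T (inv h \<otimes> g) u = T (inv h) (T g u)" using gh(1,2) uv(1) sub by (intro T_mult) (auto intro: S_H)
      also have "\<dots> = v" using uv gh sub by (auto simp: T_inv S_H subset_iff)
      finally have "T (inv h \<otimes> g) ` U \<inter> U \<noteq> {}" using uv by blast
      then have "inv h \<otimes> g = \<one>" using U(3)[of "inv h \<otimes> g"] gh by blast
      then show False using gh by (metis inv_equality inv_inv inv_closed)
    qed
    then show "disjnt A B" by (simp add: disjnt_def)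
  qed
  have hom: "homeomorphic_map (subtopology (top_of_set S) A) (subtopology Q (proj ` U)) proj \<and> openin (top_of_set S) A"
    if "A \<in> ?\<U>" for A
  proof -
    obtain g where g: "g \<in> carrier G" "A = T g ` U" using \<open>A \<in> ?\<U>\<close> by blast
    have "inj_on proj A"
    proof (rule inj_onI)
      fix y z assume "y \<in> A" "z \<in> A" and yz: "proj y = proj z"
      then obtain u v where uv: "u \<in> U" "v \<in> U" "y = T g u" "z = T g v" using g by auto
      then have "proj u = proj v" using yz g sub by (auto simp: proj_T subset_iff)
      then have "u = v" using inj_on_small[OF sub U(3)] uv by (auto dest: inj_onD)
      then show "y = z" using uv by simp
    qed
    then show ?thesis
      using homeomorphic_proj[OF openin_T_image[OF U(1) g(1)]] openin_T_image[OF U(1) g(1)] g img by auto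
  qed
  have un: "\<Union>?\<U> = {y \<in> topspace (top_of_set S). proj y \<in> proj ` U}"
    using saturation[OF sub] by simp
  show "\<exists>V \<U>. openin Q V \<and> p \<in> V \<and> \<Union>\<U> = {x \<in> topspace (top_of_set S). proj x \<in> V} \<and> pairwise disjnt \<U> \<and>
      (\<forall>U\<in>\<U>. openin (top_of_set S) U \<and> homeomorphic_map (subtopology (top_of_set S) U) (subtopology Q V) proj)"
  proof (rule exI[of _ "proj ` U"], rule exI[of _ ?\<U>], intro conjI ballI)
    show "p \<in> proj ` U" using x U(2) by simp
  qed (use hom disj un openin_proj_image[OF U(1)] in simp_all)
qed

end

section \<open>Smooth structures on the sphere and on its quotient\<close>

context free_isometric_action begin

definition pole :: "'h \<Rightarrow> bool" where "pole s \<longleftrightarrow> s = e \<or> s = - e"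

lemma pole_norm: "pole s \<Longrightarrow> norm s = 1" and pole_H: "pole s \<Longrightarrow> s \<in> H"
  using e H(1) by (auto simp: pole_def subspace_neg)

lemma E_pole: "pole s \<Longrightarrow> y \<in> E \<Longrightarrow> inner y s = 0"
  by (auto simp: pole_def E_def)

lemma stereo_E:
  assumes "pole s" "x \<in> H"
  shows "stereo s x \<in> E"
proof -
  have "inner (stereo s x) e = 0"
    using inner_stereo[OF pole_norm[OF assms(1)], of x] assms(1) by (auto simp: pole_def)
  moreover have "stereo s x \<in> H"
    unfolding stereo_def using assms pole_H H(1) by (intro subspace_scale subspace_diff)
  ultimately show ?thesis by (simp add: E_def)
qed

lemma stereo_inv_S:
  assumes "pole s" "y \<in> E"
  shows "stereo_inv s y \<in> S"
proof -
  have "stereo_inv s y \<in> H"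
    unfolding stereo_inv_def using assms pole_H E_H H(1) by (intro subspace_add subspace_scale subspace_diff)
  then show ?thesis using norm_stereo_inv[OF pole_norm E_pole] assms by (simp add: S_def)
qed

lemma stereo_stereo_inv_E: "pole s \<Longrightarrow> y \<in> E \<Longrightarrow> stereo s (stereo_inv s y) = y"
  by (intro stereo_stereo_inv pole_norm E_pole)

lemma stereo_inv_stereo_S: "pole s \<Longrightarrow> x \<in> S \<Longrightarrow> x \<noteq> s \<Longrightarrow> stereo_inv s (stereo s x) = x"
  by (rule stereo_inv_stereo[OF pole_norm]) (auto simp: S_def)

lemma smooth_on_stereo_S:
  assumes "pole s" "U \<subseteq> S" "s \<notin> U"
  shows "smooth_on U (stereo s)"
proof (rule smooth_on_subset[OF smooth_on_stereo])
  show "U \<subseteq> {x. inner x s \<noteq> 1}"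
    using unit_inner_eq_1[OF pole_norm[OF assms(1)]] assms(2,3) by (auto simp: S_def)
qed

lemma stereo_image_eq:
  assumes "pole s" "U \<subseteq> S" "s \<notin> U"
  shows "stereo s ` U = E \<inter> stereo_inv s -` U"
proof (intro equalityI subsetI)
  fix y assume "y \<in> stereo s ` U"
  then obtain x where "x \<in> U" "y = stereo s x" by blast
  moreover from this have "x \<in> S" "x \<noteq> s" using assms by auto
  ultimately show "y \<in> E \<inter> stereo_inv s -` U"
    using assms(1) by (simp add: stereo_inv_stereo_S stereo_E S_H)
next
  fix y assume "y \<in> E \<inter> stereo_inv s -` U"
  then show "y \<in> stereo s ` U" using stereo_stereo_inv_E[OF assms(1), of y] by force
qed

lemma openin_stereo_image:
  assumes "pole s" "openin (top_of_set S) U" "s \<notin> U"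
  shows "openin (top_of_set E) (stereo s ` U)"
proof -
  have "U \<subseteq> S" using openin_subset[OF assms(2)] by simp
  then have eq: "stereo s ` U = E \<inter> stereo_inv s -` U" by (rule stereo_image_eq[OF assms(1) _ assms(3)])
  show ?thesis
    unfolding eq using assms by (intro continuous_openin_preimage[OF _ _ assms(2)]
        smooth_on_continuous_on smooth_on_stereo_inv) (auto simp: stereo_inv_S)
qed

text \<open>
  Two poles are used so that every point of the sphere lies in the domain of a chart. Opposite poles
  have the same orthogonal hyperplane \<open>E\<close>.
\<close>

lemma exists_pole: 
  obtains s where "pole s" "x \<noteq> s"
proof -
  have "e \<noteq> - e"
  proof
    assume "e = - e"
    then have "2 *\<^sub>R e = 0" by (metis add.right_inverse scaleR_2)
    then show False using e(2) by simp
  qed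
  then show ?thesis using that[of e] that[of "- e"] by (auto simp: pole_def)
qed

lemma submanifold_atlas_homeomorphic:
  assumes c: "c \<in> submanifold_atlas S E"
  shows "homeomorphic_map (subtopology (top_of_set S) (fst c)) (top_of_set (chart_image c)) (snd c)"
proof (rule homeomorphic_mapI)
  have sub: "fst c \<subseteq> S" using c openin_subset[of "top_of_set S" "fst c"] by (auto simp: submanifold_atlas_def)
  then have top: "subtopology (top_of_set S) (fst c) = top_of_set (fst c)"
    by (simp add: subtopology_subtopology Int_absorb1)
  have c': "smooth_on (fst c) (snd c)" "smooth_on (chart_image c) (chart_inv c)" "inj_on (snd c) (fst c)"
    using c by (auto simp: submanifold_atlas_def)
  show "continuous_map (subtopology (top_of_set S) (fst c)) (top_of_set (chart_image c)) (snd c)"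
    unfolding top using smooth_on_continuous_on[OF c'(1)] by auto
  show "continuous_map (top_of_set (chart_image c)) (subtopology (top_of_set S) (fst c)) (chart_inv c)"
    unfolding top using smooth_on_continuous_on[OF c'(2)] by (auto simp: inv_into_into)
  show "chart_inv c (snd c x) = x" if "x \<in> topspace (subtopology (top_of_set S) (fst c))" for x
    using that c'(3) unfolding top by simp
  show "snd c (chart_inv c y) = y" if "y \<in> topspace (top_of_set (chart_image c))" for y
    using that by (simp add: f_inv_into_f)
qed

lemma stereo_chart:
  assumes s: "pole s"
  shows "(S - {s}, stereo s) \<in> submanifold_atlas S E"
proof -
  have op: "openin (top_of_set S) (S - {s})"
    by (metis openin_delete openin_subtopology_self)
  have inj: "inj_on (stereo s) (S - {s})"
    by (rule inj_on_inverseI[where g = "stereo_inv s"]) (use s in \<open>auto simp: stereo_inv_stereo_S\<close>)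
  have "smooth_on (stereo s ` (S - {s})) (inv_into (S - {s}) (stereo s))"
  proof (rule smooth_on_cong[OF smooth_on_stereo_inv[where s = s]])
    fix y assume "y \<in> stereo s ` (S - {s})"
    then obtain x where x: "x \<in> S - {s}" "y = stereo s x" by blast
    then show "stereo_inv s y = inv_into (S - {s}) (stereo s) y"
      using inv_into_f_f[OF inj x(1)] s by (simp add: stereo_inv_stereo_S)
  qed
  then show ?thesis
    unfolding submanifold_atlas_def using inj op s openin_stereo_image[OF s op]
    by (auto intro!: smooth_on_stereo_S)
qed

theorem hilbert_manifold_S: "hilbert_manifold (top_of_set S) E (submanifold_atlas S E)"
  unfolding hilbert_manifold_def
proof (intro conjI ballI)
  show "subspace E" "complete E" by (rule subspace_E complete_E)+
  show "Hausdorff_space (top_of_set S)"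
    by (intro Hausdorff_space_subtopology) simp
  show "(\<Union>c\<in>submanifold_atlas S E. fst c) = topspace (top_of_set S)"
  proof (intro equalityI subsetI)
    fix x assume "x \<in> (\<Union>c\<in>submanifold_atlas S E. fst c)"
    then show "x \<in> topspace (top_of_set S)"
      by (auto simp: submanifold_atlas_def dest!: openin_subset)
  next
    fix x assume "x \<in> topspace (top_of_set S)"
    then have x: "x \<in> S" by simp
    obtain s where s: "pole s" "x \<noteq> s" by (rule exists_pole)
    with x stereo_chart[OF s(1)] show "x \<in> (\<Union>c\<in>submanifold_atlas S E. fst c)" by force
  qed
  fix c assume c: "c \<in> submanifold_atlas S E"
  then show "openin (top_of_set S) (fst c)" "openin (top_of_set E) (chart_image c)"
    by (auto simp: submanifold_atlas_def)
  show "homeomorphic_map (subtopology (top_of_set S) (fst c)) (top_of_set (chart_image c)) (snd c)"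
    by (rule submanifold_atlas_homeomorphic[OF c])
  fix d assume d: "d \<in> submanifold_atlas S E"
  have inj: "inj_on (snd c) (fst c)" using c by (simp add: submanifold_atlas_def)
  have "smooth_on (snd c ` (fst c \<inter> fst d)) (chart_inv c)"
    using c by (auto simp: submanifold_atlas_def intro: smooth_on_subset)
  moreover have "smooth_on (fst d) (snd d)" using d by (simp add: submanifold_atlas_def)
  moreover have "chart_inv c ` snd c ` (fst c \<inter> fst d) \<subseteq> fst d" using inj by auto
  ultimately show "smooth_on (snd c ` (fst c \<inter> fst d)) (snd d \<circ> chart_inv c)"
    by (rule smooth_on_compose)
qed

definition qchart :: "'h \<Rightarrow> 'h set \<Rightarrow> ('h set, 'h) chart" where
  "qchart s U = (proj ` U, stereo s \<circ> inv_into U proj)"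

definition chart_domain :: "'h \<Rightarrow> 'h set \<Rightarrow> bool" where
  "chart_domain s U \<longleftrightarrow> pole s \<and> openin (top_of_set S) U \<and> s \<notin> U \<and> inj_on proj U"

definition atlas :: "('h set, 'h) chart set" where
  "atlas = {qchart s U | s U. chart_domain s U}"

lemma chart_domain_S: "chart_domain s U \<Longrightarrow> x \<in> U \<Longrightarrow> x \<in> S"
  using openin_subset[of "top_of_set S" U] by (auto simp: chart_domain_def)

lemma atlasE:
  assumes "c \<in> atlas"
  obtains s U where "c = qchart s U" "chart_domain s U"
  using assms unfolding atlas_def by blast

lemma fst_qchart: "fst (qchart s U) = proj ` U" by (simp add: qchart_def)

lemma qchart_proj: "chart_domain s U \<Longrightarrow> x \<in> U \<Longrightarrow> snd (qchart s U) (proj x) = stereo s x"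
  by (simp add: qchart_def chart_domain_def inv_into_f_f)

lemma qchart_image: "chart_domain s U \<Longrightarrow> chart_image (qchart s U) = stereo s ` U"
  unfolding fst_qchart image_image by (intro image_cong) (auto simp: qchart_proj)

lemma chart_domain_stereo_inv:
  assumes "chart_domain s U" "x \<in> U"
  shows "stereo_inv s (stereo s x) = x"
  using assms chart_domain_S[OF assms] by (intro stereo_inv_stereo_S) (auto simp: chart_domain_def)

lemma qchart_inv:
  assumes U: "chart_domain s U" and y: "y \<in> stereo s ` U"
  shows "chart_inv (qchart s U) y = proj (stereo_inv s y)" "stereo_inv s y \<in> U"
proof -
  obtain x where x: "x \<in> U" "y = stereo s x" using y by blast
  have inj: "inj_on (snd (qchart s U)) (proj ` U)"
  proof (rule inj_onI)
    fix p q assume "p \<in> proj ` U" "q \<in> proj ` U" and eq: "snd (qchart s U) p = snd (qchart s U) q"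
    then obtain u v where uv: "u \<in> U" "p = proj u" "v \<in> U" "q = proj v" by blast
    then have "stereo s u = stereo s v" using eq by (simp add: qchart_proj U)
    then have "u = v" using chart_domain_stereo_inv[OF U] uv by metis
    then show "p = q" using uv by simp
  qed
  show "stereo_inv s y \<in> U" using x by (simp add: chart_domain_stereo_inv[OF U])
  have "y = snd (qchart s U) (proj x)" using x by (simp add: qchart_proj U)
  then have "chart_inv (qchart s U) y = proj x"
    using inj x(1) by (simp add: fst_qchart inv_into_f_f)
  then show "chart_inv (qchart s U) y = proj (stereo_inv s y)"
    using x by (simp add: chart_domain_stereo_inv[OF U])
qed

text \<open>
  Some isometry moves \<open>x\<close> into the open set \<open>U\<close>; by continuity it does so with all points near \<open>x\<close>,
  and since \<open>proj\<close> is injective on \<open>U\<close>, the moved point is the one that \<open>inv_into U proj\<close> selects.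
\<close>

lemma local_lift:
  assumes U: "openin (top_of_set S) U" "inj_on proj U" and x: "x \<in> S" "proj x \<in> proj ` U"
  shows "\<exists>g\<in>carrier G. \<exists>N. open N \<and> x \<in> N \<and>
    (\<forall>z\<in>S \<inter> N. T g z \<in> U \<and> inv_into U proj (proj z) = T g z)"
proof -
  have "x \<in> {x \<in> S. proj x \<in> proj ` U}" using x by simp
  moreover have "U \<subseteq> S" using openin_subset[OF U(1)] by simp
  ultimately have "x \<in> (\<Union>g\<in>carrier G. T g ` U)" by (simp only: saturation)
  then obtain g u where gu: "g \<in> carrier G" "u \<in> U" "x = T g u" by blast
  have uS: "u \<in> S" using gu(2) openin_subset[OF U(1)] by auto
  let ?h = "inv g"
  have h: "?h \<in> carrier G" using gu by simp
  have "openin (top_of_set S) (S \<inter> T ?h -` U)"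
    using h by (intro continuous_openin_preimage[OF _ _ U(1)] T_continuous) (auto simp: T_S)
  then obtain N where N: "open N" "S \<inter> T ?h -` U = S \<inter> N" by (auto simp: openin_open)
  have "T ?h x \<in> U" using gu uS by (simp add: T_inv S_H)
  then have xN: "x \<in> N" using N x by blast
  have lift: "T ?h z \<in> U \<and> inv_into U proj (proj z) = T ?h z" if z: "z \<in> S" "z \<in> N" for z
  proof -
    have 1: "T ?h z \<in> U" using z N by blast
    then have "inv_into U proj (proj (T ?h z)) = T ?h z" using U(2) by simp
    then show ?thesis using 1 z h by (simp add: proj_T)
  qed
  show ?thesis
  proof (rule bexI[OF _ h], rule exI[of _ N], intro conjI ballI)
    fix z assume "z \<in> S \<inter> N"
    then show "T ?h z \<in> U" "inv_into U proj (proj z) = T ?h z" using lift by auto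
  qed (fact N(1), fact xN)
qed

lemma smooth_on_lift:
  assumes U: "openin (top_of_set S) U" "inj_on proj U"
  shows "smooth_on {x \<in> S. proj x \<in> proj ` U} (\<lambda>x. inv_into U proj (proj x))"
proof (rule smooth_on_local)
  fix x assume x: "x \<in> {x \<in> S. proj x \<in> proj ` U}"
  then have x': "x \<in> S" "proj x \<in> proj ` U" by auto
  obtain g N where g: "g \<in> carrier G" and N: "open N \<and> x \<in> N \<and>
      (\<forall>z\<in>S \<inter> N. T g z \<in> U \<and> inv_into U proj (proj z) = T g z)"
    using local_lift[OF U x'] by (elim bexE exE) (rule that)
  show "\<exists>N f. open N \<and> x \<in> N \<and> smooth_on ({x \<in> S. proj x \<in> proj ` U} \<inter> N) f \<and>
      (\<forall>y\<in>{x \<in> S. proj x \<in> proj ` U} \<inter> N. f y = inv_into U proj (proj y))"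
    using N by (intro exI[of _ N] exI[of _ "T g"]) (simp add: smooth_on_bounded_linear T_linear g)
qed

lemma smooth_on_qchart_proj:
  assumes U: "chart_domain s U"
  shows "smooth_on {x \<in> S. proj x \<in> proj ` U} (\<lambda>x. snd (qchart s U) (proj x))"
proof -
  have U': "openin (top_of_set S) U" "inj_on proj U" "pole s" "s \<notin> U" using U by (auto simp: chart_domain_def)
  have "smooth_on U (stereo s)"
    using chart_domain_S[OF U] by (intro smooth_on_stereo_S U') auto
  from smooth_on_compose[OF smooth_on_lift[OF U'(1,2)] this]
  have "smooth_on {x \<in> S. proj x \<in> proj ` U} (stereo s \<circ> (\<lambda>x. inv_into U proj (proj x)))"
    by (simp add: image_subset_iff inv_into_into)
  then show ?thesis by (simp add: qchart_def comp_def)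
qed

lemma smooth_on_chart_proj:
  "c \<in> atlas \<Longrightarrow> smooth_on {x \<in> S. proj x \<in> fst c} (\<lambda>x. snd c (proj x))"
  by (elim atlasE) (simp add: fst_qchart smooth_on_qchart_proj)

text \<open>
  On the whole image of a chart, its inverse is the composition of inverse stereographic projection
  and \<open>proj\<close>; in this form it can be composed with \<open>smooth_on_chart_proj\<close>.
\<close>

lemma chart_inv_stereo:
  assumes c: "c \<in> atlas"
  shows "\<exists>s. pole s \<and> (\<forall>y\<in>chart_image c. stereo_inv s y \<in> S \<and> chart_inv c y = proj (stereo_inv s y))"
proof -
  obtain s U where U: "c = qchart s U" "chart_domain s U" using atlasE[OF c] .
  have "stereo_inv s y \<in> S \<and> chart_inv c y = proj (stereo_inv s y)" if "y \<in> chart_image c" for y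
    using that qchart_inv[OF U(2)] chart_domain_S[OF U(2)] by (simp add: U(1) qchart_image[OF U(2)])
  then show ?thesis using U(2) unfolding chart_domain_def by blast
qed

lemma atlas_covers: "x \<in> S \<Longrightarrow> \<exists>c\<in>atlas. proj x \<in> fst c"
proof -
  assume x: "x \<in> S"
  obtain U where U: "openin (top_of_set S) U" "x \<in> U"
      "\<And>g. g \<in> carrier G \<Longrightarrow> g \<noteq> \<one> \<Longrightarrow> T g ` U \<inter> U = {}"
    using small_neighbourhood[OF x] by blast
  obtain s where s: "pole s" "x \<noteq> s" by (rule exists_pole)
  have "inj_on proj U" using inj_on_small[OF _ U(3)] openin_subset[OF U(1)] by auto
  then have "chart_domain s (U - {s})"
    using U s unfolding chart_domain_def by (auto intro: openin_delete inj_on_subset)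
  then have "qchart s (U - {s}) \<in> atlas" by (auto simp: atlas_def)
  then show ?thesis using U(2) s(2) by (intro bexI[of _ "qchart s (U - {s})"]) (auto simp: fst_qchart)
qed

lemma atlas_openin:
  assumes "c \<in> atlas"
  shows "openin Q (fst c)" "openin (top_of_set E) (chart_image c)"
proof -
  obtain s U where U: "c = qchart s U" "chart_domain s U" using atlasE[OF assms] .
  show "openin Q (fst c)" using U by (simp add: fst_qchart openin_proj_image chart_domain_def)
  show "openin (top_of_set E) (chart_image c)"
    unfolding U(1) qchart_image[OF U(2)] using U(2) by (simp add: openin_stereo_image chart_domain_def)
qed

lemma atlas_inj_on: "c \<in> atlas \<Longrightarrow> p \<in> fst c \<Longrightarrow> chart_inv c (snd c p) = p"
proof (elim atlasE)
  fix s U assume p: "p \<in> fst c" and U: "c = qchart s U" "chart_domain s U"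
  then obtain x where x: "x \<in> U" "p = proj x" by (auto simp: fst_qchart)
  then show "chart_inv c (snd c p) = p"
    using U by (simp add: qchart_proj qchart_inv chart_domain_stereo_inv)
qed

theorem hilbert_manifold_Q: "hilbert_manifold Q E atlas"
  unfolding hilbert_manifold_def
proof (intro conjI ballI)
  show "subspace E" "complete E" by (rule subspace_E complete_E)+
  show "Hausdorff_space Q" by (rule Hausdorff_Q)
  show "(\<Union>c\<in>atlas. fst c) = topspace Q"
  proof (rule equalityI)
    show "(\<Union>c\<in>atlas. fst c) \<subseteq> topspace Q" using atlas_openin(1) openin_subset by blast
    show "topspace Q \<subseteq> (\<Union>c\<in>atlas. fst c)" using atlas_covers by (auto simp: topspace_Q)
  qed
  fix c assume c: "c \<in> atlas"
  show "openin Q (fst c)" "openin (top_of_set E) (chart_image c)" by (rule atlas_openin[OF c])+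
  obtain s U where U: "c = qchart s U" "chart_domain s U" using atlasE[OF c] .
  have U': "openin (top_of_set S) U" "inj_on proj U" "pole s" "s \<notin> U" "U \<subseteq> S"
    using U chart_domain_S by (auto simp: chart_domain_def)
  show "homeomorphic_map (subtopology Q (fst c)) (top_of_set (chart_image c)) (snd c)"
    unfolding U(1) qchart_image[OF U(2)]
    unfolding fst_qchart
  proof (rule homeomorphic_mapI[where g = "proj \<circ> stereo_inv s"])
    have "continuous_map (top_of_set U) (top_of_set (stereo s ` U)) (stereo s)"
      using smooth_on_continuous_on[OF smooth_on_stereo_S[OF U'(3,5,4)]] by auto
    from continuous_map_compose[OF continuous_lift[OF U'(1,2)] this]
    show "continuous_map (subtopology Q (proj ` U)) (top_of_set (stereo s ` U)) (snd (qchart s U))"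
      by (simp add: qchart_def)
    have "continuous_map (top_of_set (stereo s ` U)) (top_of_set S) (stereo_inv s)"
      using smooth_on_continuous_on[OF smooth_on_stereo_inv] U'(5)
      by (auto simp: chart_domain_stereo_inv[OF U(2)])
    from continuous_map_compose[OF this continuous_proj]
    show "continuous_map (top_of_set (stereo s ` U)) (subtopology Q (proj ` U)) (proj \<circ> stereo_inv s)"
      by (auto simp: continuous_map_in_subtopology chart_domain_stereo_inv[OF U(2)])
    show "(proj \<circ> stereo_inv s) (snd (qchart s U) p) = p" if "p \<in> topspace (subtopology Q (proj ` U))" for p
      using that by (auto simp: qchart_proj[OF U(2)] chart_domain_stereo_inv[OF U(2)])
    show "snd (qchart s U) ((proj \<circ> stereo_inv s) y) = y" if "y \<in> topspace (top_of_set (stereo s ` U))" for y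
      using that by (auto simp: qchart_proj[OF U(2)] chart_domain_stereo_inv[OF U(2)])
  qed
  fix d assume d: "d \<in> atlas"
  obtain s' where s': "\<forall>y\<in>chart_image c. stereo_inv s' y \<in> S \<and> chart_inv c y = proj (stereo_inv s' y)"
    using chart_inv_stereo[OF c] by blast
  let ?X = "snd c ` (fst c \<inter> fst d)"
  have X: "y \<in> chart_image c" "chart_inv c y \<in> fst d" if "y \<in> ?X" for y
    using that atlas_inj_on[OF c] by auto
  have "smooth_on ?X ((\<lambda>x. snd d (proj x)) \<circ> stereo_inv s')"
    using X s' by (intro smooth_on_compose[OF smooth_on_stereo_inv smooth_on_chart_proj[OF d]]) force
  then show "smooth_on ?X (snd d \<circ> chart_inv c)"
    by (rule smooth_on_cong) (use X s' in auto)
qed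

theorem local_diffeomorphism_proj:
  "local_diffeomorphism (top_of_set S) (submanifold_atlas S E) Q atlas proj"
  unfolding local_diffeomorphism_def
proof (intro ballI)
  fix x assume "x \<in> topspace (top_of_set S)"
  then have x: "x \<in> S" by simp
  obtain U where U: "openin (top_of_set S) U" "x \<in> U"
      "\<And>g. g \<in> carrier G \<Longrightarrow> g \<noteq> \<one> \<Longrightarrow> T g ` U \<inter> U = {}"
    using small_neighbourhood[OF x] by blast
  have sub: "U \<subseteq> S" using openin_subset[OF U(1)] by simp
  have inj: "inj_on proj U" by (rule inj_on_small[OF sub U(3)])
  have 1: "smooth_map_on (submanifold_atlas S E) atlas U proj"
    unfolding smooth_map_on_def
  proof (intro ballI)
    fix c d assume c: "c \<in> submanifold_atlas S E" and d: "d \<in> atlas"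
    let ?X = "snd c ` {x \<in> U \<inter> fst c. proj x \<in> fst d}"
    have c': "smooth_on (chart_image c) (chart_inv c)" "inj_on (snd c) (fst c)"
      using c by (auto simp: submanifold_atlas_def)
    have "smooth_on ?X (chart_inv c)" by (rule smooth_on_subset[OF c'(1)]) auto
    moreover have "chart_inv c ` ?X \<subseteq> {x \<in> S. proj x \<in> fst d}" using c'(2) sub by auto
    ultimately show "smooth_on ?X (snd d \<circ> proj \<circ> chart_inv c)"
      using smooth_on_compose[OF _ smooth_on_chart_proj[OF d]] by (simp add: comp_def)
  qed
  have 2: "smooth_map_on atlas (submanifold_atlas S E) (proj ` U) (inv_into U proj)"
    unfolding smooth_map_on_def
  proof (intro ballI)
    fix c d assume c: "c \<in> atlas" and d: "d \<in> submanifold_atlas S E"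
    let ?X = "snd c ` {p \<in> proj ` U \<inter> fst c. inv_into U proj p \<in> fst d}"
    obtain s where s: "\<forall>y\<in>chart_image c. stereo_inv s y \<in> S \<and> chart_inv c y = proj (stereo_inv s y)"
      using chart_inv_stereo[OF c] by blast
    have X: "y \<in> chart_image c" "chart_inv c y \<in> proj ` U" "inv_into U proj (chart_inv c y) \<in> fst d" if "y \<in> ?X" for y
      using that atlas_inj_on[OF c] by auto
    have "smooth_on ?X ((\<lambda>x. inv_into U proj (proj x)) \<circ> stereo_inv s)"
      using X s by (intro smooth_on_compose[OF smooth_on_stereo_inv smooth_on_lift[OF U(1) inj]]) force
    then have "smooth_on ?X (inv_into U proj \<circ> chart_inv c)"
      by (rule smooth_on_cong) (use X s in auto)
    moreover have "smooth_on (fst d) (snd d)" using d by (simp add: submanifold_atlas_def)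
    moreover have "(inv_into U proj \<circ> chart_inv c) ` ?X \<subseteq> fst d" using X by auto
    ultimately show "smooth_on ?X (snd d \<circ> inv_into U proj \<circ> chart_inv c)"
      using smooth_on_compose[of ?X "inv_into U proj \<circ> chart_inv c" "fst d" "snd d"] by (simp add: comp_assoc)
  qed
  show "\<exists>U. openin (top_of_set S) U \<and> x \<in> U \<and> openin Q (proj ` U) \<and>
      homeomorphic_map (subtopology (top_of_set S) U) (subtopology Q (proj ` U)) proj \<and>
      smooth_map_on (submanifold_atlas S E) atlas U proj \<and>
      smooth_map_on atlas (submanifold_atlas S E) (proj ` U) (inv_into U proj)"
    by (intro exI[of _ U] conjI U(1,2) openin_proj_image homeomorphic_proj inj 1 2)
qed

end

section \<open>The round metric on the quotient\<close>

text \<open>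
  Difference quotients stay in the subspace.
\<close>

lemma vector_derivative_in_closed_subspace:
  fixes \<gamma> :: "real \<Rightarrow> 'h::real_normed_vector"
  assumes V: "subspace V" "closed V" and d: "(\<gamma> has_vector_derivative v) (at t)"
    and ev: "\<forall>\<^sub>F u in nhds t. \<gamma> u \<in> V"
  shows "v \<in> V"
proof (rule Lim_in_closed_set[OF V(2)])
  let ?q = "\<lambda>u. (1 / (u - t)) *\<^sub>R (\<gamma> u - \<gamma> t)"
  have "\<gamma> t \<in> V" using ev by (rule eventually_nhds_x_imp_x)
  then show "\<forall>\<^sub>F u in at t. ?q u \<in> V"
    using ev V(1) unfolding eventually_at_filter
    by (auto elim!: eventually_mono intro!: subspace_scale subspace_diff)
  have lim: "((\<lambda>u. norm (\<gamma> u - \<gamma> t - (u - t) *\<^sub>R v) / norm (u - t)) \<longlongrightarrow> 0) (at t)"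
    using d unfolding has_vector_derivative_def has_derivative_iff_norm by blast
  have "norm (?q u - v) = norm (\<gamma> u - \<gamma> t - (u - t) *\<^sub>R v) / norm (u - t)" if "u \<noteq> t" for u
  proof -
    have "?q u - v = (1 / (u - t)) *\<^sub>R (\<gamma> u - \<gamma> t - (u - t) *\<^sub>R v)"
      using that by (simp add: scaleR_diff_right)
    then show ?thesis by simp
  qed
  then have "\<forall>\<^sub>F u in at t. norm (\<gamma> u - \<gamma> t - (u - t) *\<^sub>R v) / norm (u - t) = norm (?q u - v)"
    unfolding eventually_at_filter by (simp add: always_eventually)
  from Lim_transform_eventually[OF lim this] have "((\<lambda>u. norm (?q u - v)) \<longlongrightarrow> 0) (at t)" .
  then show "(?q \<longlongrightarrow> v) (at t)" by (subst Lim_null) (simp add: tendsto_norm_zero_iff)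
qed simp

lemma has_vector_derivative_compose:
  assumes "(\<gamma> has_vector_derivative v) (at t within A)" "(f has_derivative f') (at (\<gamma> t))"
  shows "((\<lambda>u. f (\<gamma> u)) has_vector_derivative f' v) (at t within A)"
  using has_derivative_compose[OF assms(1)[unfolded has_vector_derivative_def] assms(2)]
    linear_scale[OF bounded_linear.linear[OF has_derivative_bounded_linear[OF assms(2)]]]
  by (simp add: has_vector_derivative_def)

lemma has_vector_derivative_eventually_cong:
  assumes "(f has_vector_derivative v) (at t)" "\<forall>\<^sub>F u in nhds t. f u = g u"
  shows "(g has_vector_derivative v) (at t)"
proof -
  obtain N where N: "open N" "t \<in> N" "\<And>u. u \<in> N \<Longrightarrow> f u = g u"
    using assms(2) unfolding eventually_nhds by blast
  from assms(1) N show ?thesis by (rule has_vector_derivative_transform_within_open)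
qed

context free_isometric_action begin

text \<open>
  Inverse stereographic projection maps the coordinates of \<open>proj \<circ> \<gamma>\<close> back to the moved curve
  \<open>T g \<circ> \<gamma>\<close>. Comparing derivatives expresses the moved velocity by the derivative \<open>w\<close> of the coordinates.
  The isometry and the pole depend on the point and the chart only, so two curves through the same
  point can be compared.
\<close>

lemma chart_of_curve:
  assumes d: "d \<in> atlas" and x: "x \<in> S" "proj x \<in> fst d"
  shows "\<exists>g\<in>carrier G. \<exists>s. pole s \<and>
    (\<forall>\<gamma> t v. (\<gamma> has_vector_derivative v) (at t) \<longrightarrow> (\<forall>\<^sub>F u in nhds t. \<gamma> u \<in> S) \<longrightarrow> \<gamma> t = x \<longrightarrow>
       (\<exists>w\<in>E. ((\<lambda>u. snd d (proj (\<gamma> u))) has_vector_derivative w) (at t) \<and>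
         T g v = stereo_inv_deriv s (snd d (proj x)) w))"
proof -
  obtain s U where U: "d = qchart s U" "chart_domain s U" using atlasE[OF d] .
  have U': "openin (top_of_set S) U" "inj_on proj U" "pole s" "s \<notin> U" using U by (auto simp: chart_domain_def)
  have *: "proj x \<in> proj ` U" using x(2) by (simp add: U(1) fst_qchart)
  obtain g N where g: "g \<in> carrier G" and N: "open N \<and> x \<in> N \<and>
      (\<forall>z\<in>S \<inter> N. T g z \<in> U \<and> inv_into U proj (proj z) = T g z)"
    using local_lift[OF U'(1,2) x(1) *] by (elim bexE exE) (rule that)
  have chart: "snd d (proj z) = stereo s (T g z)" if "z \<in> S" "z \<in> N" for z
    using N that by (simp add: U(1) qchart_def)
  have gx: "T g x \<in> U" "T g x \<in> S" using g N x by (auto simp: T_S)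
  have "\<exists>w\<in>E. ((\<lambda>u. snd d (proj (\<gamma> u))) has_vector_derivative w) (at t) \<and>
         T g v = stereo_inv_deriv s (snd d (proj x)) w"
    if \<gamma>: "(\<gamma> has_vector_derivative v) (at t)" "\<forall>\<^sub>F u in nhds t. \<gamma> u \<in> S" "\<gamma> t = x" for \<gamma> t v
  proof -
    have "(\<gamma> \<longlongrightarrow> \<gamma> t) (nhds t)"
      using has_vector_derivative_continuous[OF \<gamma>(1)] unfolding continuous_at
      by (rule tendsto_at_iff_tendsto_nhds[THEN iffD1])
    then have "\<forall>\<^sub>F u in nhds t. \<gamma> u \<in> N" using N \<gamma>(3) by (auto dest: topological_tendstoD)
    with \<gamma>(2) have ev: "\<forall>\<^sub>F u in nhds t. \<gamma> u \<in> S \<and> \<gamma> u \<in> N" by eventually_elim simp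
    have \<gamma>': "((\<lambda>u. T g (\<gamma> u)) has_vector_derivative T g v) (at t)"
      by (rule has_vector_derivative_compose[OF \<gamma>(1) bounded_linear_imp_has_derivative[OF T_linear[OF g]]])
    have "T g x \<noteq> s" using gx U'(4) by blast
    then have nz: "inner (T g x) s \<noteq> 1"
      using unit_inner_eq_1[OF pole_norm[OF U'(3)]] gx(2) by (auto simp: S_def)
    have "open {z. inner z s \<noteq> 1}" by (intro open_Collect_neq continuous_intros)
    then have "at (T g x) within {z. inner z s \<noteq> 1} = at (T g x)" using nz by (intro at_within_open) auto
    then obtain f' where f': "(stereo s has_derivative f') (at (T g x))"
      using smooth_on_has_derivative[OF smooth_on_stereo, of "T g x" s] nz by auto
    let ?w = "f' (T g v)"
    have w1: "((\<lambda>u. stereo s (T g (\<gamma> u))) has_vector_derivative ?w) (at t)"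
      by (rule has_vector_derivative_compose[OF \<gamma>']) (simp add: \<gamma>(3) f')
    have "\<forall>\<^sub>F u in nhds t. stereo s (T g (\<gamma> u)) = snd d (proj (\<gamma> u))"
      using ev by eventually_elim (simp add: chart)
    with w1 have w2: "((\<lambda>u. snd d (proj (\<gamma> u))) has_vector_derivative ?w) (at t)"
      by (rule has_vector_derivative_eventually_cong)
    have "\<forall>\<^sub>F u in nhds t. stereo s (T g (\<gamma> u)) \<in> E"
      using ev by eventually_elim (simp add: stereo_E U' T_in g S_H)
    then have "?w \<in> E"
      by (rule vector_derivative_in_closed_subspace[OF subspace_E complete_imp_closed[OF complete_E] w1])
    have w3: "((\<lambda>u. stereo_inv s (stereo s (T g (\<gamma> u)))) has_vector_derivative
        stereo_inv_deriv s (stereo s (T g (\<gamma> t))) ?w) (at t)"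
      by (rule has_vector_derivative_compose[OF w1 stereo_inv_has_derivative])
    have "\<forall>\<^sub>F u in nhds t. stereo_inv s (stereo s (T g (\<gamma> u))) = T g (\<gamma> u)"
      using ev by eventually_elim (use N chart_domain_stereo_inv[OF U(2)] in blast)
    with w3 have "((\<lambda>u. T g (\<gamma> u)) has_vector_derivative stereo_inv_deriv s (stereo s (T g (\<gamma> t))) ?w) (at t)"
      by (rule has_vector_derivative_eventually_cong)
    then have "T g v = stereo_inv_deriv s (stereo s (T g (\<gamma> t))) ?w"
      using \<gamma>' vector_derivative_unique_at by blast
    then have "T g v = stereo_inv_deriv s (snd d (proj x)) ?w"
      using chart[OF x(1)] N \<gamma>(3) by simp
    with \<open>?w \<in> E\<close> w2 show ?thesis by blast
  qed
  note curve = this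
  show ?thesis
  proof (rule bexI[OF _ g], rule exI[of _ s], intro conjI allI impI)
    show "pole s" by (rule U'(3))
  qed (rule curve)
qed

definition base_chart :: "'h set \<Rightarrow> ('h set, 'h) chart" where
  "base_chart p = (SOME c. c \<in> atlas \<and> p \<in> fst c)"

text \<open>
  A tangent vector of the quotient contains exactly one pair for every chart around the base point. The
  metric reads off the pair for a fixed chart at this point; \<open>metric_curves\<close> shows that the choice does
  not matter.
\<close>

definition round_metric :: "('h set, 'h) metric" where
  "round_metric p \<xi> \<eta> = conformal_factor (snd (base_chart p) p) *
     inner (THE v. (base_chart p, v) \<in> \<xi>) (THE w. (base_chart p, w) \<in> \<eta>)"

lemma base_chart:
  assumes "x \<in> S"
  shows "base_chart (proj x) \<in> atlas" "proj x \<in> fst (base_chart (proj x))"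
  using someI_ex[of "\<lambda>c. c \<in> atlas \<and> proj x \<in> fst c"] atlas_covers[OF assms]
  unfolding base_chart_def by blast+

text \<open>
  The metric of the quotient is the inner product of the velocities in \<open>H\<close> of curves upstairs. Both
  tangent vectors given by charts and velocities of curves are of this form.
\<close>

lemma metric_curves:
  assumes x: "x \<in> S"
    and \<gamma>1: "(\<gamma>1 has_vector_derivative v1) (at t1)" "\<forall>\<^sub>F u in nhds t1. \<gamma>1 u \<in> S" "\<gamma>1 t1 = x"
    and \<gamma>2: "(\<gamma>2 has_vector_derivative v2) (at t2)" "\<forall>\<^sub>F u in nhds t2. \<gamma>2 u \<in> S" "\<gamma>2 t2 = x"
    and \<xi>: "\<And>d w. d \<in> atlas \<Longrightarrow> proj x \<in> fst d \<Longrightarrow>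
        (d, w) \<in> \<xi> \<longleftrightarrow> w = vector_derivative (\<lambda>u. snd d (proj (\<gamma>1 u))) (at t1)"
    and \<eta>: "\<And>d w. d \<in> atlas \<Longrightarrow> proj x \<in> fst d \<Longrightarrow>
        (d, w) \<in> \<eta> \<longleftrightarrow> w = vector_derivative (\<lambda>u. snd d (proj (\<gamma>2 u))) (at t2)"
  shows "round_metric (proj x) \<xi> \<eta> = inner v1 v2"
proof -
  let ?d = "base_chart (proj x)"
  let ?y = "snd ?d (proj x)"
  note d = base_chart[OF x]
  obtain g s where g: "g \<in> carrier G" and sl: "pole s \<and> (\<forall>\<gamma> t v. (\<gamma> has_vector_derivative v) (at t) \<longrightarrow> (\<forall>\<^sub>F u in nhds t. \<gamma> u \<in> S) \<longrightarrow> \<gamma> t = x \<longrightarrow>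
       (\<exists>w\<in>E. ((\<lambda>u. snd ?d (proj (\<gamma> u))) has_vector_derivative w) (at t) \<and>
         T g v = stereo_inv_deriv s ?y w))"
    using chart_of_curve[OF d(1) x d(2)] by (elim bexE exE) (rule that)
  note s = conjunct1[OF sl] and lift = conjunct2[OF sl]
  obtain w1 where w1: "w1 \<in> E" "((\<lambda>u. snd ?d (proj (\<gamma>1 u))) has_vector_derivative w1) (at t1)"
    "T g v1 = stereo_inv_deriv s ?y w1" using lift[rule_format, OF \<gamma>1] by blast
  obtain w2 where w2: "w2 \<in> E" "((\<lambda>u. snd ?d (proj (\<gamma>2 u))) has_vector_derivative w2) (at t2)"
    "T g v2 = stereo_inv_deriv s ?y w2" using lift[rule_format, OF \<gamma>2] by blast
  have the: "(THE v. (?d, v) \<in> \<xi>) = w1" "(THE w. (?d, w) \<in> \<eta>) = w2"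
    using \<xi>[OF d] \<eta>[OF d] vector_derivative_at[OF w1(2)] vector_derivative_at[OF w2(2)] by simp_all
  have S_H': "\<forall>\<^sub>F u in F. \<gamma> u \<in> S \<Longrightarrow> \<forall>\<^sub>F u in F. \<gamma> u \<in> H" for \<gamma> :: "real \<Rightarrow> 'h" and F
    by (erule eventually_mono) (rule S_H)
  have v: "v1 \<in> H" "v2 \<in> H"
    using vector_derivative_in_closed_subspace[OF H(1) closed_H \<gamma>1(1) S_H'[OF \<gamma>1(2)]]
      vector_derivative_in_closed_subspace[OF H(1) closed_H \<gamma>2(1) S_H'[OF \<gamma>2(2)]] by blast+
  have y: "?y \<in> E"
  proof -
    have "?y \<in> chart_image ?d" using d(2) by blast
    then show ?thesis using openin_subset[OF atlas_openin(2)[OF d(1)]] by auto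
  qed
  have "inner v1 v2 = inner (T g v1) (T g v2)" by (simp add: T_inner g v)
  also have "\<dots> = conformal_factor ?y * inner w1 w2"
    unfolding w1(3) w2(3) by (intro stereo_inv_conformal pole_norm E_pole s y w1 w2)
  finally show ?thesis unfolding round_metric_def the by simp
qed

lemma atlas_chart_inv:
  assumes "c \<in> atlas" "x \<in> chart_image c"
  shows "chart_inv c x \<in> fst c" "snd c (chart_inv c x) = x" "x \<in> E"
  using assms openin_subset[OF atlas_openin(2)[OF assms(1)]]
  by (auto simp: inv_into_into f_inv_into_f)

text \<open>
  The curves upstairs are the images of straight lines under inverse stereographic projection.
\<close>

lemma metric_rep_eq:
  assumes c: "c \<in> atlas" and x: "x \<in> chart_image c" and v: "v \<in> E" and w: "w \<in> E"
  shows "metric_rep atlas round_metric c x v w = conformal_factor x * inner v w"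
proof -
  obtain s where s: "pole s" "\<forall>y\<in>chart_image c. stereo_inv s y \<in> S \<and> chart_inv c y = proj (stereo_inv s y)"
    using chart_inv_stereo[OF c] by blast
  have inv: "stereo_inv s y \<in> S" "chart_inv c y = proj (stereo_inv s y)" if "y \<in> chart_image c" for y
    using bspec[OF s(2) that] by simp_all
  note xs = inv[OF x]
  let ?\<gamma> = "\<lambda>v t. stereo_inv s (x + t *\<^sub>R v)"
  have \<gamma>: "(?\<gamma> v has_vector_derivative stereo_inv_deriv s x v) (at 0)"
    "\<forall>\<^sub>F t in nhds 0. ?\<gamma> v t \<in> S"
    "\<And>d w. d \<in> atlas \<Longrightarrow> proj (stereo_inv s x) \<in> fst d \<Longrightarrow>
        (d, w) \<in> tangent_vector atlas (proj (stereo_inv s x)) c v \<longleftrightarrow>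
        w = vector_derivative (\<lambda>u. snd d (proj (?\<gamma> v u))) (at 0)" if v: "v \<in> E" for v
  proof -
    have ev: "\<forall>\<^sub>F t in nhds 0. x + t *\<^sub>R v \<in> chart_image c"
      by (rule eventually_line_in_openin[OF subspace_E atlas_openin(2)[OF c] x v])
    have "((\<lambda>t. x + t *\<^sub>R v) has_vector_derivative v) (at 0)"
      by (auto intro!: derivative_eq_intros)
    then show "(?\<gamma> v has_vector_derivative stereo_inv_deriv s x v) (at 0)"
      by (rule has_vector_derivative_compose) (simp add: stereo_inv_has_derivative)
    show "\<forall>\<^sub>F t in nhds 0. ?\<gamma> v t \<in> S"
      using ev by eventually_elim (rule inv(1))
    fix d w assume d: "d \<in> atlas" "proj (stereo_inv s x) \<in> fst d"
    have p: "snd c (proj (stereo_inv s x)) = x"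
      using xs(2) atlas_chart_inv(2)[OF c x] by simp
    have "dir_deriv (snd d \<circ> chart_inv c) x v = vector_derivative (\<lambda>u. snd d (proj (?\<gamma> v u))) (at 0)"
      unfolding dir_deriv_def
    proof (rule vector_derivative_cong_eq)
      show "\<forall>\<^sub>F t in nhds 0. t \<in> UNIV \<longrightarrow>
          (snd d \<circ> chart_inv c) (x + t *\<^sub>R v) = snd d (proj (?\<gamma> v t))"
        using ev by eventually_elim (simp add: inv(2))
    qed auto
    then show "(d, w) \<in> tangent_vector atlas (proj (stereo_inv s x)) c v \<longleftrightarrow>
        w = vector_derivative (\<lambda>u. snd d (proj (?\<gamma> v u))) (at 0)"
      using d by (simp add: tangent_vector_def p)
  qed
  have "round_metric (proj (stereo_inv s x)) (tangent_vector atlas (proj (stereo_inv s x)) c v)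
      (tangent_vector atlas (proj (stereo_inv s x)) c w)
      = inner (stereo_inv_deriv s x v) (stereo_inv_deriv s x w)"
    by (rule metric_curves[OF xs(1) \<gamma>(1,2)[OF v] _ \<gamma>(1,2)[OF w] _ \<gamma>(3)[OF v] \<gamma>(3)[OF w]]) simp_all
  also have "\<dots> = conformal_factor x * inner v w"
    by (intro stereo_inv_conformal pole_norm E_pole s v w atlas_chart_inv(3)[OF c x])
  finally show ?thesis by (simp add: metric_rep_def xs(2))
qed

theorem riemannian_metric_Q: "riemannian_metric E atlas round_metric"
  unfolding riemannian_metric_def
proof (intro ballI conjI)
  fix c assume c: "c \<in> atlas"
  show "inner_product_on E (metric_rep atlas round_metric c x)" if x: "x \<in> chart_image c" for x
    unfolding inner_product_on_def
  proof (intro conjI ballI allI impI)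
    fix u v w a b assume uvw: "u \<in> E" "v \<in> E" "w \<in> E"
    then have "a *\<^sub>R u + b *\<^sub>R v \<in> E" using subspace_E by (simp add: subspace_add subspace_scale)
    with uvw show "metric_rep atlas round_metric c x (a *\<^sub>R u + b *\<^sub>R v) w =
        a * metric_rep atlas round_metric c x u w + b * metric_rep atlas round_metric c x v w"
      by (simp add: metric_rep_eq[OF c x] inner_add_left algebra_simps)
  qed (auto simp: metric_rep_eq[OF c x] inner_commute conformal_factor_pos)
  show "\<exists>m>0. \<exists>M. \<forall>v\<in>E. m * norm v \<le> sqrt (metric_rep atlas round_metric c x v v) \<and>
      sqrt (metric_rep atlas round_metric c x v v) \<le> M * norm v" if x: "x \<in> chart_image c" for x
  proof -
    have "sqrt (metric_rep atlas round_metric c x v v) = sqrt (conformal_factor x) * norm v" if "v \<in> E" for v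
      by (simp add: metric_rep_eq[OF c x that that] real_sqrt_mult norm_eq_sqrt_inner)
    then show ?thesis using conformal_factor_pos[of x] by (intro exI[of _ "sqrt (conformal_factor x)"] conjI) (auto intro: exI[of _ "sqrt (conformal_factor x)"])
  qed
  show "smooth_on (chart_image c \<times> E \<times> E) (\<lambda>(x, v, w). metric_rep atlas round_metric c x v w)"
    by (rule smooth_on_cong[OF smooth_on_round_form]) (auto simp: metric_rep_eq[OF c])
qed

theorem constant_curvature_Q: "constant_sectional_curvature E atlas round_metric 1"
  unfolding constant_sectional_curvature_def
proof (intro ballI impI; elim conjE)
  fix c x u v assume c: "c \<in> atlas" and x: "x \<in> chart_image c" and uv: "u \<in> E" "v \<in> E"
    and ind: "u \<noteq> v" "independent {u, v}"
  interpret R: round_metric_rep E "chart_image c" "metric_rep atlas round_metric c"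
    by unfold_locales (auto intro: subspace_E atlas_openin(2)[OF c] metric_rep_eq[OF c])
  show "sectional_curvature E (metric_rep atlas round_metric c) x u v = 1"
    by (rule R.sectional_curvature_eq_1[OF x uv ind])
qed

lemma speed_eq:
  assumes \<gamma>: "(\<gamma> has_vector_derivative v) (at t)" "\<forall>\<^sub>F u in nhds t. \<gamma> u \<in> S"
    and \<delta>: "\<forall>\<^sub>F u in nhds t. \<delta> u = proj (\<gamma> u)"
  shows "sqrt (round_metric (\<delta> t) (velocity atlas \<delta> t) (velocity atlas \<delta> t)) = norm v"
proof -
  have \<delta>t: "\<delta> t = proj (\<gamma> t)" using \<delta> by (rule eventually_nhds_x_imp_x)
  have \<gamma>t: "\<gamma> t \<in> S" using \<gamma>(2) by (rule eventually_nhds_x_imp_x)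
  have vel: "(d, w) \<in> velocity atlas \<delta> t \<longleftrightarrow> w = vector_derivative (\<lambda>u. snd d (proj (\<gamma> u))) (at t)"
    if "d \<in> atlas" "proj (\<gamma> t) \<in> fst d" for d w
  proof -
    have "vector_derivative (snd d \<circ> \<delta>) (at t) = vector_derivative (\<lambda>u. snd d (proj (\<gamma> u))) (at t)"
    proof (rule vector_derivative_cong_eq)
      show "\<forall>\<^sub>F u in nhds t. u \<in> UNIV \<longrightarrow> (snd d \<circ> \<delta>) u = snd d (proj (\<gamma> u))"
        using \<delta> by eventually_elim simp
    qed auto
    then show ?thesis using that by (simp add: velocity_def \<delta>t)
  qed
  have "round_metric (proj (\<gamma> t)) (velocity atlas \<delta> t) (velocity atlas \<delta> t) = inner v v"
    by (rule metric_curves[OF \<gamma>t \<gamma> refl \<gamma> refl]) (simp_all add: vel)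
  then show ?thesis by (simp add: \<delta>t norm_eq_sqrt_inner)
qed

end

section \<open>Lengths of curves and completeness\<close>

lemma dist_le_integral_norm_derivative:
  fixes f :: "real \<Rightarrow> 'a::real_normed_vector"
  assumes ab: "a < b"
    and f': "\<And>t. t \<in> {a..b} \<Longrightarrow> (f has_vector_derivative f' t) (at t within {a..b})"
    and cont: "continuous_on {a..b} f'"
  shows "dist (f a) (f b) \<le> integral {a..b} (\<lambda>t. norm (f' t))"
proof -
  let ?\<phi> = "\<lambda>t. integral {a..t} (\<lambda>t. norm (f' t))"
  have c: "continuous_on {a..b} (\<lambda>t. norm (f' t))" using cont by (intro continuous_intros)
  note \<phi> = integral_has_vector_derivative[OF c]
  have at: "at t within {a..b} = at t" if "a < t" "t < b" for t
    using that by (rule at_within_Icc_at)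
  have "norm (f b - f a) \<le> ?\<phi> b - ?\<phi> a"
  proof (rule differentiable_bound_general[OF ab, where f' = f' and \<phi>' = "\<lambda>t. norm (f' t)"])
    show "continuous_on {a..b} f"
      using f' by (rule continuous_on_vector_derivative)
    show "continuous_on {a..b} ?\<phi>"
      using \<phi> by (rule continuous_on_vector_derivative)
    show "(f has_vector_derivative f' t) (at t)" if "a < t" "t < b" for t
      using f'[of t] at[OF that] that by simp
    show "(?\<phi> has_vector_derivative norm (f' t)) (at t)" if "a < t" "t < b" for t
      using \<phi>[of t] at[OF that] that by simp
  qed simp
  then show ?thesis by (simp add: dist_norm norm_minus_commute)
qed

text \<open>
  On an open set of real numbers smooth maps are continuously differentiable: locally the derivative
  is the member \<open>D t [1]\<close> of a jet.
\<close>

lemma smooth_on_real_derivative: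
  fixes f :: "real \<Rightarrow> 'k::real_normed_vector"
  assumes f: "smooth_on X f" and X: "open X"
  shows "t \<in> X \<Longrightarrow> (f has_vector_derivative vector_derivative f (at t)) (at t)"
    and "continuous_on X (\<lambda>t. vector_derivative f (at t))"
proof -
  have loc: "\<exists>W D'. open W \<and> t \<in> W \<and> continuous_on W D' \<and> (\<forall>u\<in>W. (f has_vector_derivative D' u) (at u))"
    if t: "t \<in> X" for t
  proof -
    obtain W F where W: "t \<in> W" "smooth_on_open W F" "\<forall>u\<in>W \<inter> X. F u = f u"
      using f t unfolding smooth_on_def by blast
    obtain D where D: "jet_on W D" "\<And>u. u \<in> W \<Longrightarrow> D u [] = F u"
      using jet_on_of_smooth_on_open[OF W(2)] by blast
    have oW: "open (W \<inter> X)" using D(1) X by (auto simp: jet_on_def)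
    have "(f has_vector_derivative D u [1]) (at u)" if u: "u \<in> W \<inter> X" for u
    proof -
      have lin: "linear (\<lambda>v. D u [v])" using jet_on_linear[OF D(1), of u "[]" "[]"] u by simp
      have scale: "(\<lambda>h. D u [h]) = (\<lambda>h. h *\<^sub>R D u [1])"
        by (intro ext) (rule linear_scale[OF lin, of _ 1, unfolded real_scaleR_def mult_1_right])
      have "((\<lambda>y. D y []) has_derivative (\<lambda>h. D u [h])) (at u)"
        using u by (intro jet_on_deriv[OF D(1)]) simp
      then have "((\<lambda>y. D y []) has_vector_derivative D u [1]) (at u)"
        unfolding has_vector_derivative_def by (simp only: scale)
      then show ?thesis
        by (rule has_vector_derivative_transform_within_open[OF _ oW u]) (use D(2) W(3) in auto)
    qed
    moreover have "continuous_on (W \<inter> X) (\<lambda>u. D u [1])"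
      by (rule continuous_at_imp_continuous_on)
        (use has_derivative_continuous[OF jet_on_deriv[OF D(1)]] in blast)
    ultimately show ?thesis using oW W(1) t by (intro exI[of _ "W \<inter> X"] exI[of _ "\<lambda>u. D u [1]"]) auto
  qed
  show "(f has_vector_derivative vector_derivative f (at t)) (at t)" if "t \<in> X" for t
    using loc[OF that] vector_derivative_at by metis
  show "continuous_on X (\<lambda>t. vector_derivative f (at t))"
    unfolding continuous_on_eq_continuous_at[OF X]
  proof
    fix t assume "t \<in> X"
    from loc[OF this] obtain W D' where W: "open W" "t \<in> W" "continuous_on W D'"
      "\<forall>u\<in>W. (f has_vector_derivative D' u) (at u)" by (elim exE conjE) (rule that)
    have "continuous_on W (\<lambda>t. vector_derivative f (at t))"
      by (rule continuous_on_eq[OF W(3)]) (use W(4) vector_derivative_at in metis)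
    then show "isCont (\<lambda>t. vector_derivative f (at t)) t"
      using W(1,2) continuous_on_eq_continuous_at by blast
  qed
qed

context free_isometric_action begin

definition speed :: "(real \<Rightarrow> 'h set) \<Rightarrow> real \<Rightarrow> real" where
  "speed \<gamma> t = sqrt (round_metric (\<gamma> t) (velocity atlas \<gamma> t) (velocity atlas \<gamma> t))"

lemma curve_length_eq: "curve_length atlas round_metric \<gamma> = integral {0..1} (speed \<gamma>)"
  by (simp add: curve_length_def speed_def[abs_def])

text \<open>
  The interval property to which Bolzano's bisection argument is applied. The second part replaces a
  lift of the whole curve: only the end points in the fibres are remembered, and these can be chosen
  one interval after the other.
\<close>

definition length_bounds :: "(real \<Rightarrow> 'h set) \<Rightarrow> real \<Rightarrow> real \<Rightarrow> bool" where
  "length_bounds \<gamma> a b \<longleftrightarrow> (\<exists>L. (speed \<gamma> has_integral L) {a..b} \<and> (\<forall>x\<in>\<gamma> a. \<exists>y\<in>\<gamma> b. dist x y \<le> L))"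

lemma length_bounds_refl: "length_bounds \<gamma> a a"
  unfolding length_bounds_def by (intro exI[of _ 0]) auto

lemma length_bounds_trans:
  assumes "length_bounds \<gamma> a b" "length_bounds \<gamma> b c" "a \<le> b" "b \<le> c"
  shows "length_bounds \<gamma> a c"
proof -
  obtain L where L: "(speed \<gamma> has_integral L) {a..b}" "\<forall>x\<in>\<gamma> a. \<exists>y\<in>\<gamma> b. dist x y \<le> L"
    using assms(1) unfolding length_bounds_def by blast
  obtain M where M: "(speed \<gamma> has_integral M) {b..c}" "\<forall>x\<in>\<gamma> b. \<exists>y\<in>\<gamma> c. dist x y \<le> M"
    using assms(2) unfolding length_bounds_def by blast
  have "\<exists>z\<in>\<gamma> c. dist x z \<le> L + M" if x: "x \<in> \<gamma> a" for x
  proof -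
    obtain y where y: "y \<in> \<gamma> b" "dist x y \<le> L" using L(2) x by blast
    obtain z where z: "z \<in> \<gamma> c" "dist y z \<le> M" using M(2) y(1) by blast
    have "dist x z \<le> L + M" using dist_triangle[of x z y] y z by linarith
    then show ?thesis using z(1) by blast
  qed
  then show ?thesis
    unfolding length_bounds_def using has_integral_combine[OF assms(3,4) L(1) M(1)] by blast
qed

text \<open>
  Within a chart the curve has an explicit lift, and all other lifts are translates of it.
\<close>

lemma length_bounds_C1_in_chart:
  assumes ab: "a < b" and C1: "C1_curve_on Q atlas a b \<gamma>"
    and c: "c \<in> atlas" and dom: "\<And>t. t \<in> {a..b} \<Longrightarrow> \<gamma> t \<in> fst c"
  shows "length_bounds \<gamma> a b"
proof -
  obtain D where D: "\<forall>t\<in>{a..b}. \<gamma> t \<in> fst c \<longrightarrow> ((snd c \<circ> \<gamma>) has_vector_derivative D t) (at t within {a..b})"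
    "continuous_on {t \<in> {a..b}. \<gamma> t \<in> fst c} D"
    using C1 c unfolding C1_curve_on_def by blast
  have all: "{t \<in> {a..b}. \<gamma> t \<in> fst c} = {a..b}" using dom by auto
  have D1: "((snd c \<circ> \<gamma>) has_vector_derivative D t) (at t within {a..b})" if "t \<in> {a..b}" for t
    using D(1) dom that by blast
  have D2: "continuous_on {a..b} D" using D(2) unfolding all .
  obtain s where s: "pole s" "\<forall>y\<in>chart_image c. stereo_inv s y \<in> S \<and> chart_inv c y = proj (stereo_inv s y)"
    using chart_inv_stereo[OF c] by blast
  let ?y = "snd c \<circ> \<gamma>"
  let ?\<gamma> = "\<lambda>t. stereo_inv s (?y t)"
  let ?V = "\<lambda>t. stereo_inv_deriv s (?y t) (D t)"
  have lift: "?\<gamma> t \<in> S" "proj (?\<gamma> t) = \<gamma> t" if t: "t \<in> {a..b}" for t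
  proof -
    have "?y t \<in> chart_image c" using dom[OF t] by simp
    from bspec[OF s(2) this] show "?\<gamma> t \<in> S" "proj (?\<gamma> t) = \<gamma> t"
      using atlas_inj_on[OF c dom[OF t]] by auto
  qed
  have V: "(?\<gamma> has_vector_derivative ?V t) (at t within {a..b})" if "t \<in> {a..b}" for t
    by (rule has_vector_derivative_compose[OF D1[OF that] stereo_inv_has_derivative])
  have y_cont: "continuous_on {a..b} ?y" using D1 by (rule continuous_on_vector_derivative)
  have w_cont: "continuous_on {a..b} (\<lambda>t. stereo_weight (?y t))"
    by (rule continuous_on_compose2[OF smooth_on_continuous_on[OF smooth_on_stereo_weight[of UNIV]] y_cont]) simp
  have V_cont: "continuous_on {a..b} ?V"
    unfolding stereo_inv_deriv_def by (intro continuous_intros y_cont w_cont D2)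
  have sp: "speed \<gamma> t = norm (?V t)" if t: "a < t" "t < b" for t
    unfolding speed_def
  proof (rule speed_eq)
    show "(?\<gamma> has_vector_derivative ?V t) (at t)"
      using V[of t] at_within_Icc_at[OF t] t by simp
    have "\<forall>\<^sub>F u in nhds t. u \<in> {a<..<b}" using t by (intro eventually_nhds_in_open) auto
    then show "\<forall>\<^sub>F u in nhds t. ?\<gamma> u \<in> S" "\<forall>\<^sub>F u in nhds t. \<gamma> u = proj (?\<gamma> u)"
      by (eventually_elim, use lift in force)+
  qed
  let ?L = "integral {a..b} (\<lambda>t. norm (?V t))"
  have "((\<lambda>t. norm (?V t)) has_integral ?L) {a..b}"
    using V_cont by (intro integrable_integral integrable_continuous_real continuous_intros)
  then have "(speed \<gamma> has_integral ?L) {a..b}"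
    using has_integral_spike_interior[of "\<lambda>t. norm (?V t)" ?L a b "speed \<gamma>"] sp by simp
  moreover have "\<exists>y\<in>\<gamma> b. dist x y \<le> ?L" if x: "x \<in> \<gamma> a" for x
  proof -
    have a: "a \<in> {a..b}" and b: "b \<in> {a..b}" using ab by auto
    have "x \<in> proj (?\<gamma> a)" using x lift(2)[OF a] by simp
    then obtain g where g: "g \<in> carrier G" "T g (?\<gamma> a) = x" using proj_memD[OF lift(1)[OF a]] by blast
    have "T g (?\<gamma> b) \<in> \<gamma> b"
      using mem_proj[OF T_S[OF g(1) lift(1)[OF b]]] proj_T[OF g(1) lift(1)[OF b]] lift(2)[OF b] by simp
    moreover have "dist x (T g (?\<gamma> b)) \<le> ?L"
      using dist_le_integral_norm_derivative[OF ab V V_cont] T_dist[OF g(1) S_H S_H, OF lift(1)[OF a] lift(1)[OF b]] g(2)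
      by simp
    ultimately show ?thesis by blast
  qed
  ultimately show ?thesis unfolding length_bounds_def by blast
qed

text \<open>
  Around each time the curve stays in one chart, and the time itself is the only possible break
  point; splitting there leaves continuously differentiable pieces.
\<close>

lemma length_bounds_curve:
  assumes \<gamma>: "piecewise_C1_curve Q atlas \<gamma>"
  shows "length_bounds \<gamma> 0 1"
proof -
  obtain B where cont: "continuous_map (top_of_set {0..1}) Q \<gamma>" and B: "finite B"
    and C1: "\<And>a b. 0 \<le> a \<Longrightarrow> a < b \<Longrightarrow> b \<le> 1 \<Longrightarrow> {a<..<b} \<inter> B = {} \<Longrightarrow> C1_curve_on Q atlas a b \<gamma>"
    using \<gamma> unfolding piecewise_C1_curve_def by blast
  have "0 \<le> (0::real) \<and> (1::real) \<le> 1 \<longrightarrow> length_bounds \<gamma> 0 1"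
  proof (rule Bolzano[where P = "\<lambda>a b. 0 \<le> a \<and> b \<le> 1 \<longrightarrow> length_bounds \<gamma> a b"])
    show "0 \<le> a \<and> c \<le> 1 \<longrightarrow> length_bounds \<gamma> a c"
      if "0 \<le> a \<and> b \<le> 1 \<longrightarrow> length_bounds \<gamma> a b" "0 \<le> b \<and> c \<le> 1 \<longrightarrow> length_bounds \<gamma> b c"
        "a \<le> b" "b \<le> c" for a b c
      using length_bounds_trans[of \<gamma> a b c] that by auto
    fix t :: real assume "0 \<le> t" "t \<le> 1"
    then have t: "t \<in> {0..1}" by simp
    have "\<gamma> t \<in> topspace Q" using cont t unfolding continuous_map_def by auto
    then obtain z where z: "z \<in> S" "\<gamma> t = proj z" by (auto simp: topspace_Q)
    obtain c where c: "c \<in> atlas" "\<gamma> t \<in> fst c" using atlas_covers[OF z(1)] unfolding z(2) by blast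
    have "openin (top_of_set {0..1}) {u \<in> topspace (top_of_set {0..1}). \<gamma> u \<in> fst c}"
      using openin_continuous_map_preimage[OF cont atlas_openin(1)[OF c(1)]] .
    then obtain N where N: "open N" "{u \<in> {0..1}. \<gamma> u \<in> fst c} = {0..1} \<inter> N" by (auto simp: openin_open)
    then have "t \<in> N" using t c(2) by blast
    then obtain r where r: "r > 0" "ball t r \<subseteq> N" using N(1) open_contains_ball by blast
    obtain r' where r': "r' > 0" "\<forall>u\<in>B. u \<noteq> t \<longrightarrow> r' \<le> dist t u" using finite_set_avoid[OF B, of t] by blast
    have piece: "length_bounds \<gamma> a b" if ab: "0 \<le> a" "a \<le> b" "b \<le> 1" "a = t \<or> b = t" "b - a < min r r'" for a b
    proof (cases "a = b")
      case False
      then have "a < b" using ab by simp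
      moreover have "C1_curve_on Q atlas a b \<gamma>"
      proof (rule C1[OF ab(1) \<open>a < b\<close> ab(3)])
        have "u \<notin> B" if "u \<in> {a<..<b}" for u
          using r'(2) that ab by (fastforce simp: dist_real_def)
        then show "{a<..<b} \<inter> B = {}" by blast
      qed
      moreover have "\<gamma> u \<in> fst c" if u: "u \<in> {a..b}" for u
      proof -
        have "u \<in> ball t r" using u ab by (auto simp: dist_real_def)
        then have "u \<in> {0..1} \<inter> N" using r u ab by auto
        then show ?thesis using N(2) by blast
      qed
      ultimately show ?thesis using length_bounds_C1_in_chart[OF _ _ c(1)] by blast
    qed (simp add: length_bounds_refl)
    show "\<exists>d>0. \<forall>a b. a \<le> t \<and> t \<le> b \<and> b - a < d \<longrightarrow> 0 \<le> a \<and> b \<le> 1 \<longrightarrow> length_bounds \<gamma> a b"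
    proof (intro exI[of _ "min r r'"] conjI allI impI)
      fix a b assume "a \<le> t \<and> t \<le> b \<and> b - a < min r r'" "0 \<le> a \<and> b \<le> 1"
      then show "length_bounds \<gamma> a b"
        by (intro length_bounds_trans[of \<gamma> a t b] piece) auto
    qed (use r r' in auto)
  qed simp
  then show ?thesis by simp
qed

lemma curve_length_bound:
  assumes "piecewise_C1_curve Q atlas \<gamma>" "x \<in> \<gamma> 0"
  shows "\<exists>y\<in>\<gamma> 1. dist x y \<le> curve_length atlas round_metric \<gamma>"
  using length_bounds_curve[OF assms(1)] assms(2)
  unfolding length_bounds_def curve_length_eq by (auto dest: integral_unique)

lemma riemannian_dist_less:
  assumes "riemannian_dist Q atlas round_metric p q < ereal \<epsilon>" "x \<in> p"
  shows "\<exists>y\<in>q. dist x y < \<epsilon>"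
proof -
  obtain \<gamma> where \<gamma>: "piecewise_C1_curve Q atlas \<gamma>" "\<gamma> 0 = p" "\<gamma> 1 = q" "curve_length atlas round_metric \<gamma> < \<epsilon>"
    using assms(1) unfolding riemannian_dist_def INF_less_iff by auto
  then show ?thesis using curve_length_bound[OF \<gamma>(1), of x] assms(2) by force
qed

lemma riemannian_dist_nonneg:
  assumes "x \<in> S"
  shows "0 \<le> riemannian_dist Q atlas round_metric (proj x) q"
  unfolding riemannian_dist_def
proof (rule INF_greatest)
  fix \<gamma> assume "\<gamma> \<in> {\<gamma>. piecewise_C1_curve Q atlas \<gamma> \<and> \<gamma> 0 = proj x \<and> \<gamma> 1 = q}"
  then obtain y where "dist x y \<le> curve_length atlas round_metric \<gamma>"
    using curve_length_bound[of \<gamma> x] mem_proj[OF assms] by auto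
  then have "0 \<le> curve_length atlas round_metric \<gamma>" using zero_le_dist[of x y] by linarith
  then show "0 \<le> ereal (curve_length atlas round_metric \<gamma>)" by simp
qed

lemma stereo_inv_S_orthogonal:
  assumes "s \<in> S" "w \<in> H" "inner w s = 0"
  shows "stereo_inv s w \<in> S"
proof -
  have "stereo_inv s w \<in> H"
    unfolding stereo_inv_def using assms S_H H(1) by (intro subspace_add subspace_scale subspace_diff) auto
  then show ?thesis using norm_stereo_inv[of s w] assms by (simp add: S_def)
qed

text \<open>
  The arc is the image of a segment under inverse stereographic projection from \<open>- x\<close>, which sends the
  origin to \<open>x\<close>. Its speed is at most twice the length of the segment.
\<close>

lemma riemannian_dist_le:
  assumes x: "x \<in> S" and y: "y \<in> S" and near: "dist x y \<le> 1"
  shows "riemannian_dist Q atlas round_metric (proj x) (proj y) \<le> ereal (sqrt 2 * dist x y)"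
proof -
  define c where "c = inner x y"
  have xx: "inner x x = 1" "inner y y = 1" using x y by (simp_all add: S_def power2_norm_eq_inner[symmetric])
  have d: "(dist x y)\<^sup>2 = 2 - 2 * c"
    by (simp add: dist_norm power2_norm_eq_inner inner_diff_left inner_diff_right xx c_def inner_commute[of y x])
  have "(dist x y)\<^sup>2 \<le> 1\<^sup>2" using near by (intro power_mono) auto
  then have c: "c \<ge> 1 / 2" using d by simp
  let ?s = "- x"
  have s: "?s \<in> S" "norm ?s = 1" using x H(1) by (auto simp: S_def subspace_neg)
  define w where "w = stereo ?s y"
  \<comment> \<open>The arc runs along the segment from \<open>0\<close> to \<open>w\<close> in the coordinates of the pole \<open>- x\<close>.\<close>
  have w_eq: "w = (1 / (1 + c)) *\<^sub>R (y - c *\<^sub>R x)"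
    by (simp add: w_def stereo_def c_def inner_commute)
  have w: "w \<in> H" unfolding w_eq using x y S_H H(1) by (intro subspace_scale subspace_diff) auto
  have ws: "inner w ?s = 0" unfolding w_def by (rule inner_stereo[OF s(2)])
  have norm_w: "2 * norm w \<le> sqrt 2 * dist x y"
  proof (rule power2_le_imp_le)
    have "inner (y - c *\<^sub>R x) (y - c *\<^sub>R x) = 1 - c * c"
      by (simp add: inner_diff_left inner_diff_right xx inner_commute[of y x] c_def[symmetric])
    then have "(norm w)\<^sup>2 = (1 / (1 + c))\<^sup>2 * (1 - c * c)"
      unfolding power2_norm_eq_inner w_eq by (simp add: power2_eq_square)
    also have "1 - c * c = (1 - c) * (1 + c)" by (simp add: algebra_simps)
    also have "(1 / (1 + c))\<^sup>2 * ((1 - c) * (1 + c)) = (1 - c) / (1 + c)"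
      using c by (simp add: power2_eq_square)
    also have "\<dots> \<le> (1 - c) / 1"
    proof (rule divide_left_mono)
      have "0 \<le> 2 - 2 * c" unfolding d[symmetric] by simp
      then show "0 \<le> 1 - c" by simp
    qed (use c in auto)
    finally show "(2 * norm w)\<^sup>2 \<le> (sqrt 2 * dist x y)\<^sup>2"
      by (simp add: power_mult_distrib d)
  qed simp
  define \<gamma> where "\<gamma> t = stereo_inv ?s (t *\<^sub>R w)" for t :: real
  have \<gamma>_S: "\<gamma> t \<in> S" for t
    unfolding \<gamma>_def using ws by (intro stereo_inv_S_orthogonal s subspace_scale H(1) w) simp
  have \<gamma>_ends: "\<gamma> 0 = x" "\<gamma> 1 = y"
  proof -
    show "\<gamma> 0 = x" by (simp add: \<gamma>_def stereo_inv_def stereo_weight_def scaleR_2)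
    have "y \<noteq> ?s" using c xx by (auto simp: c_def)
    then show "\<gamma> 1 = y"
      unfolding \<gamma>_def w_def scaleR_one using y by (intro stereo_inv_stereo s(2)) (simp_all add: S_def)
  qed
  have \<gamma>_smooth: "smooth_on X \<gamma>" for X
    using smooth_on_compose[OF smooth_on_scaleR[OF smooth_on_id smooth_on_const[of X w]]
        smooth_on_stereo_inv[of UNIV ?s]] by (simp add: \<gamma>_def[abs_def] comp_def)
  have \<gamma>_deriv: "(\<gamma> has_vector_derivative stereo_inv_deriv ?s (t *\<^sub>R w) w) (at t)" for t
    unfolding \<gamma>_def[abs_def]
    by (rule has_vector_derivative_compose[OF _ stereo_inv_has_derivative])
      (auto intro!: derivative_eq_intros)
  have \<gamma>_norm: "norm (stereo_inv_deriv ?s (t *\<^sub>R w) w) = 2 * stereo_weight (t *\<^sub>R w) * norm w" for t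
  proof -
    have "inner (stereo_inv_deriv ?s (t *\<^sub>R w) w) (stereo_inv_deriv ?s (t *\<^sub>R w) w) = conformal_factor (t *\<^sub>R w) * inner w w"
      using ws by (intro stereo_inv_conformal[OF s(2)]) auto
    also have "\<dots> = (2 * stereo_weight (t *\<^sub>R w) * norm w)\<^sup>2"
      by (simp add: conformal_factor_def power_mult_distrib power2_norm_eq_inner)
    finally show ?thesis
      using stereo_weight_pos[of "t *\<^sub>R w"] by (simp add: norm_eq_sqrt_inner[of "stereo_inv_deriv ?s (t *\<^sub>R w) w"])
  qed
  let ?\<delta> = "proj \<circ> \<gamma>"
  have cont: "continuous_map (top_of_set A) Q ?\<delta>" for A
  proof (rule continuous_map_compose[OF _ continuous_proj])
    show "continuous_map (top_of_set A) (top_of_set S) \<gamma>"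
      using smooth_on_continuous_on[OF \<gamma>_smooth] \<gamma>_S by auto
  qed
  have C1: "C1_curve_on Q atlas a b ?\<delta>" for a b
    unfolding C1_curve_on_def
  proof (intro conjI ballI cont)
    fix c assume c: "c \<in> atlas"
    let ?X = "{t. proj (\<gamma> t) \<in> fst c}"
    have "openin (top_of_set S) {z \<in> S. proj z \<in> fst c}" by (rule openin_S_proj[OF atlas_openin(1)[OF c]])
    then have "openin (top_of_set UNIV) (UNIV \<inter> \<gamma> -` {z \<in> S. proj z \<in> fst c})"
      using \<gamma>_S by (intro continuous_openin_preimage[OF smooth_on_continuous_on[OF \<gamma>_smooth]]) auto
    moreover have "UNIV \<inter> \<gamma> -` {z \<in> S. proj z \<in> fst c} = ?X" using \<gamma>_S by auto
    ultimately have X: "open ?X" by simp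
    have "smooth_on ?X ((\<lambda>z. snd c (proj z)) \<circ> \<gamma>)"
      using \<gamma>_S by (intro smooth_on_compose[OF \<gamma>_smooth smooth_on_chart_proj[OF c]]) auto
    then have sm: "smooth_on ?X (snd c \<circ> ?\<delta>)" by (simp add: comp_def)
    show "\<exists>D. (\<forall>t\<in>{a..b}. ?\<delta> t \<in> fst c \<longrightarrow> ((snd c \<circ> ?\<delta>) has_vector_derivative D t) (at t within {a..b})) \<and>
        continuous_on {t \<in> {a..b}. ?\<delta> t \<in> fst c} D"
    proof (intro exI[of _ "\<lambda>t. vector_derivative (snd c \<circ> ?\<delta>) (at t)"] conjI ballI impI)
      show "((snd c \<circ> ?\<delta>) has_vector_derivative vector_derivative (snd c \<circ> ?\<delta>) (at t)) (at t within {a..b})"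
        if "?\<delta> t \<in> fst c" for t
        using that by (intro has_vector_derivative_at_within[OF smooth_on_real_derivative(1)[OF sm X]]) simp
      show "continuous_on {t \<in> {a..b}. ?\<delta> t \<in> fst c} (\<lambda>t. vector_derivative (snd c \<circ> ?\<delta>) (at t))"
        by (rule continuous_on_subset[OF smooth_on_real_derivative(2)[OF sm X]]) auto
    qed
  qed
  have pw: "piecewise_C1_curve Q atlas ?\<delta>"
    unfolding piecewise_C1_curve_def using cont C1 by (intro conjI exI[of _ "{}"]) auto
  have sp: "speed ?\<delta> t = 2 * stereo_weight (t *\<^sub>R w) * norm w" for t
    unfolding speed_def \<gamma>_norm[symmetric]
    by (rule speed_eq[OF \<gamma>_deriv]) (simp_all add: \<gamma>_S)
  have "curve_length atlas round_metric ?\<delta> \<le> integral {0..1} (\<lambda>t::real. 2 * norm w)"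
    unfolding curve_length_eq
  proof (rule integral_le)
    have "continuous_on {0..1} (\<lambda>t. stereo_weight (t *\<^sub>R w))"
      by (rule continuous_on_compose2[OF smooth_on_continuous_on[OF smooth_on_stereo_weight[of UNIV]]])
        (auto intro!: continuous_intros)
    then show "speed ?\<delta> integrable_on {0..1}"
      unfolding sp[abs_def] by (intro integrable_continuous_real continuous_intros)
    show "speed ?\<delta> t \<le> 2 * norm w" for t
    proof -
      have "inverse (1 + inner (t *\<^sub>R w) (t *\<^sub>R w)) \<le> inverse 1"
        using inner_ge_zero[of "t *\<^sub>R w"] by (intro le_imp_inverse_le) linarith+
      then have "stereo_weight (t *\<^sub>R w) \<le> 1" by (simp only: stereo_weight_def inverse_1)
      \<comment> \<open>The weight is at most 1, so the speed is bounded by its value at the start.\<close>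
      then have "2 * (stereo_weight (t *\<^sub>R w) * norm w) \<le> 2 * (1 * norm w)"
        by (intro mult_left_mono mult_right_mono) auto
      then show ?thesis by (simp add: sp)
    qed
  qed (intro integrable_continuous_real continuous_intros)
  also have "\<dots> = 2 * norm w" by simp
  finally have "curve_length atlas round_metric ?\<delta> \<le> sqrt 2 * dist x y" using norm_w by linarith
  moreover have "riemannian_dist Q atlas round_metric (proj x) (proj y) \<le> ereal (curve_length atlas round_metric ?\<delta>)"
    unfolding riemannian_dist_def using pw \<gamma>_ends by (intro INF_lower) simp
  ultimately show ?thesis using order_trans ereal_less_eq(3) by blast
qed

lemma riemannian_dist_eq_0_iff:
  assumes x: "x \<in> S" and y: "y \<in> S"
  shows "riemannian_dist Q atlas round_metric (proj x) (proj y) = 0 \<longleftrightarrow> proj x = proj y"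
proof
  assume eq: "riemannian_dist Q atlas round_metric (proj x) (proj y) = 0"
  obtain d where d: "d > 0" "\<And>g. g \<in> carrier G \<Longrightarrow> T g y \<noteq> x \<Longrightarrow> d \<le> dist (T g y) x"
    using S_separated[OF y x] by blast
  have "riemannian_dist Q atlas round_metric (proj x) (proj y) < ereal d" using eq d(1) by simp
  then obtain z where z: "z \<in> proj y" "dist x z < d" using riemannian_dist_less mem_proj[OF x] by blast
  then obtain g where g: "g \<in> carrier G" "T g y = z" using proj_memD[OF y] by blast
  then have "T g y = x" using d(2)[OF g(1)] z(2) by (auto simp: dist_commute)
  then show "proj x = proj y" using proj_T[OF g(1) y] by simp
next
  assume "proj x = proj y"
  then have "riemannian_dist Q atlas round_metric (proj x) (proj y) \<le> 0" 
    using riemannian_dist_le[OF x x] by (simp add: zero_ereal_def)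
  then show "riemannian_dist Q atlas round_metric (proj x) (proj y) = 0"
    using riemannian_dist_nonneg[OF x] by (simp add: order_antisym)
qed

text \<open>
  Starting from any point in a fibre, points in the fibres of a rapidly converging subsequence are
  chosen successively, each within \<open>(1 / 2) ^ k\<close> of its predecessor.
\<close>

lemma Cauchy_sequence_lift:
  fixes \<sigma> :: "nat \<Rightarrow> 'h set"
  assumes ran: "range \<sigma> \<subseteq> topspace Q"
    and Cauchy: "\<forall>e>0. \<exists>N. \<forall>m\<ge>N. \<forall>n\<ge>N. riemannian_dist Q atlas round_metric (\<sigma> m) (\<sigma> n) < ereal e"
  shows "\<exists>x\<in>S. \<forall>e>0. \<exists>N. \<forall>n\<ge>N. \<exists>y\<in>\<sigma> n. dist y x < e"
proof -
  have orb: "\<exists>x\<in>S. \<sigma> n = proj x" for n using ran by (auto simp: topspace_Q)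
  have \<sigma>_S: "y \<in> S" if "y \<in> \<sigma> n" for y n using orb[of n] that proj_memE(1) by auto
  have "\<forall>k::nat. \<exists>N. \<forall>m\<ge>N. \<forall>n\<ge>N. riemannian_dist Q atlas round_metric (\<sigma> m) (\<sigma> n) < ereal ((1 / 2) ^ k)"
    using Cauchy by simp
  from choice[OF this] obtain M where M: "\<forall>k. \<forall>m\<ge>M k. \<forall>n\<ge>M k. riemannian_dist Q atlas round_metric (\<sigma> m) (\<sigma> n) < ereal ((1 / 2) ^ k)" ..
  \<comment> \<open>Partial sums make the thresholds monotone.\<close>
  define r where "r k = (\<Sum>i\<le>k. M i)" for k
  have r: "M k \<le> r k" "r k \<le> r (Suc k)" for k
    by (auto simp: r_def intro: member_le_sum)
  have step: "\<exists>y\<in>\<sigma> n. dist x y < (1 / 2) ^ k" if "x \<in> \<sigma> (r k)" "n \<ge> r k" for x k n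
  proof (rule riemannian_dist_less[OF _ that(1)])
    show "riemannian_dist Q atlas round_metric (\<sigma> (r k)) (\<sigma> n) < ereal ((1 / 2) ^ k)"
      using M r(1)[of k] that(2) by simp
  qed
  have "\<exists>X. \<forall>k. X k \<in> \<sigma> (r k) \<and> dist (X k) (X (Suc k)) < (1 / 2) ^ k"
  proof (rule dependent_nat_choice)
    show "\<exists>x. x \<in> \<sigma> (r 0)" using orb[of "r 0"] mem_proj by auto
    show "\<exists>y. y \<in> \<sigma> (r (Suc k)) \<and> dist x y < (1 / 2) ^ k" if "x \<in> \<sigma> (r k)" for x k
      using step[OF that, of "r (Suc k)"] r(2) by blast
  qed
  then obtain X where X: "\<And>k. X k \<in> \<sigma> (r k)" "\<And>k. dist (X k) (X (Suc k)) < (1 / 2) ^ k" by blast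
  have tail: "dist (X k) (X (k + j)) \<le> 2 * (1 / 2) ^ k - 2 * (1 / 2) ^ (k + j)" for k j
  proof (induction j)
    case (Suc j)
    have "dist (X k) (X (k + Suc j)) \<le> dist (X k) (X (k + j)) + dist (X (k + j)) (X (Suc (k + j)))"
      by (simp add: dist_triangle)
    then show ?case using Suc X(2)[of "k + j"] by simp
  qed simp
  have tail': "dist (X k) (X n) \<le> 2 * (1 / 2) ^ k" if "k \<le> n" for k n
    using tail[of k "n - k"] that by (smt (verit) le_add_diff_inverse zero_less_power zero_less_divide_1_iff)
  have small: "\<exists>k. 3 * (1 / 2 :: real) ^ k < e" if e: "e > 0" for e
  proof -
    obtain k where "(1 / 2 :: real) ^ k < e / 3" using real_arch_pow_inv[of "e / 3" "1 / 2"] e by auto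
    then show ?thesis by (intro exI[of _ k]) simp
  qed
  have "Cauchy X"
    unfolding Cauchy_altdef
  proof (intro allI impI)
    fix e :: real assume "e > 0"
    then obtain k where k: "3 * (1 / 2 :: real) ^ k < e" using small by blast
    show "\<exists>N. \<forall>m\<ge>N. \<forall>n>m. dist (X m) (X n) < e"
    proof (intro exI[of _ k] allI impI)
      fix m n assume mn: "k \<le> m" "m < n"
      have "dist (X m) (X n) \<le> 2 * (1 / 2) ^ m" using tail' mn by simp
      also have "\<dots> \<le> 2 * (1 / 2) ^ k" using mn by (intro mult_left_mono power_decreasing) auto
      also have "\<dots> < e" using k by (smt (verit) zero_less_power zero_less_divide_1_iff)
      finally show "dist (X m) (X n) < e" .
    qed
  qed
  then obtain x where x: "x \<in> S" "X \<longlonglongrightarrow> x"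
    using complete_S X(1) \<sigma>_S unfolding complete_def by blast
  have lim: "dist (X k) x \<le> 2 * (1 / 2) ^ k" for k
  proof (rule LIMSEQ_le_const2)
    show "(\<lambda>n. dist (X k) (X n)) \<longlonglongrightarrow> dist (X k) x" by (intro tendsto_intros x(2))
    show "\<exists>N. \<forall>n\<ge>N. dist (X k) (X n) \<le> 2 * (1 / 2) ^ k" using tail' by blast
  qed
  have "\<exists>N. \<forall>n\<ge>N. \<exists>y\<in>\<sigma> n. dist y x < e" if "e > 0" for e
  proof -
    obtain k where k: "3 * (1 / 2 :: real) ^ k < e" using small[OF \<open>e > 0\<close>] by blast
    have "\<exists>y\<in>\<sigma> n. dist y x < e" if n: "n \<ge> r k" for n
    proof -
      obtain y where y: "y \<in> \<sigma> n" "dist (X k) y < (1 / 2) ^ k" using step[OF X(1) n] by blast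
      have "dist y x \<le> dist (X k) y + dist (X k) x" by (metis dist_commute dist_triangle)
      also have "\<dots> < e" using y(2) lim[of k] k by linarith
      finally show ?thesis using y(1) by blast
    qed
    then show ?thesis by blast
  qed
  then show ?thesis using x(1) by blast
qed

theorem riemannian_complete_Q: "riemannian_complete Q atlas round_metric"
  unfolding riemannian_complete_def
proof (intro conjI ballI allI impI; (elim conjE)?)
  show "riemannian_dist Q atlas round_metric p q = 0 \<longleftrightarrow> p = q" if "p \<in> topspace Q" "q \<in> topspace Q" for p q
    using that riemannian_dist_eq_0_iff by (auto simp: topspace_Q)
  fix \<sigma> :: "nat \<Rightarrow> 'h set"
  assume \<sigma>: "range \<sigma> \<subseteq> topspace Q"
    "\<forall>e>0. \<exists>N. \<forall>m\<ge>N. \<forall>n\<ge>N. riemannian_dist Q atlas round_metric (\<sigma> m) (\<sigma> n) < ereal e"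
  from Cauchy_sequence_lift[OF this]
  obtain x where x: "x \<in> S" and near: "\<forall>e>0. \<exists>N. \<forall>n\<ge>N. \<exists>y\<in>\<sigma> n. dist y x < e" by blast
  have "(\<lambda>n. riemannian_dist Q atlas round_metric (\<sigma> n) (proj x)) \<longlonglongrightarrow> 0"
  proof (rule order_tendstoI)
    have orb: "\<exists>x\<in>S. \<sigma> n = proj x" for n using \<sigma>(1) by (auto simp: topspace_Q)
    fix a :: ereal
    show "\<forall>\<^sub>F n in sequentially. a < riemannian_dist Q atlas round_metric (\<sigma> n) (proj x)" if "a < 0"
    proof (rule always_eventually, rule allI)
      fix n
      obtain y where "y \<in> S" "\<sigma> n = proj y" using orb by blast
      then show "a < riemannian_dist Q atlas round_metric (\<sigma> n) (proj x)"
        using riemannian_dist_nonneg[of y "proj x"] that by simp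
    qed
    show "\<forall>\<^sub>F n in sequentially. riemannian_dist Q atlas round_metric (\<sigma> n) (proj x) < a" if a: "0 < a"
    proof -
      obtain e where e: "0 < e" "ereal e < a" using ereal_dense2[OF a] by (metis ereal_less(2))
      obtain N where N: "\<And>n. n \<ge> N \<Longrightarrow> \<exists>y\<in>\<sigma> n. dist y x < min 1 (e / sqrt 2)"
        using near e(1) by (metis divide_pos_pos min_less_iff_conj real_sqrt_gt_zero zero_less_numeral zero_less_one)
      show ?thesis
        unfolding eventually_sequentially
      proof (intro exI[of _ N] allI impI)
        fix n assume "n \<ge> N"
        then obtain y where y: "y \<in> \<sigma> n" "dist y x < min 1 (e / sqrt 2)" using N by blast
        obtain z where z: "z \<in> S" "\<sigma> n = proj z" using orb by blast
        have yS: "y \<in> S" "\<sigma> n = proj y" using proj_memE[of z y] z y(1) by auto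
        have "riemannian_dist Q atlas round_metric (\<sigma> n) (proj x) \<le> ereal (sqrt 2 * dist y x)"
          unfolding yS(2) using y(2) by (intro riemannian_dist_le yS x) simp
        also have "ereal (sqrt 2 * dist y x) < ereal e" using y(2) by (simp add: field_simps)
        also note e(2)
        finally show "riemannian_dist Q atlas round_metric (\<sigma> n) (proj x) < a" .
      qed
    qed
  qed
  then show "\<exists>p\<in>topspace Q. (\<lambda>n. riemannian_dist Q atlas round_metric (\<sigma> n) p) \<longlonglongrightarrow> 0"
    using x by (auto simp: topspace_Q)
qed

end

section \<open>Translations of square-summable families\<close>

lemma l2_norm_square: "(norm x)\<^sup>2 = infsum (\<lambda>g. (l2_apply x g)\<^sup>2) UNIV"
  unfolding power2_norm_eq_inner inner_l2_def by (simp add: power2_eq_square)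

lemma l2_sum_le_norm:
  assumes "finite F"
  shows "(\<Sum>g\<in>F. (l2_apply x g)\<^sup>2) \<le> (norm x)\<^sup>2"
proof -
  have "(\<Sum>g\<in>F. (l2_apply x g)\<^sup>2) \<le> infsum (\<lambda>g. (l2_apply x g)\<^sup>2) UNIV"
    by (rule finite_sum_le_infsum) (use assms l2_square_summable in auto)
  then show ?thesis by (simp only: l2_norm_square)
qed

lemma l2_apply_le_norm: "\<bar>l2_apply x g\<bar> \<le> norm x"
  using l2_sum_le_norm[of "{g}" x] by (simp add: abs_le_square_iff[symmetric])

lemma l2_norm_le:
  assumes "\<And>F. finite F \<Longrightarrow> (\<Sum>g\<in>F. (l2_apply x g)\<^sup>2) \<le> c\<^sup>2" "c \<ge> 0"
  shows "norm x \<le> c"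
proof (rule power2_le_imp_le)
  have "infsum (\<lambda>g. (l2_apply x g)\<^sup>2) UNIV \<le> c\<^sup>2"
    by (rule infsum_le_finite_sums) (use assms l2_square_summable in auto)
  then show "(norm x)\<^sup>2 \<le> c\<^sup>2" by (simp only: l2_norm_square)
qed fact

text \<open>
  Coordinates converge, and the finite partial sums of \<open>(X m - f)\<^sup>2\<close> inherit the Cauchy bound.
\<close>

lemma complete_l2_space: "complete (l2_space G)"
proof (rule completeI)
  fix X :: "nat \<Rightarrow> 'a l2" assume mem: "\<forall>n. X n \<in> l2_space G" and C: "Cauchy X"
  have coord: "\<bar>l2_apply (X m) g - l2_apply (X n) g\<bar> \<le> dist (X m) (X n)" for m n g
    using l2_apply_le_norm[of "X m - X n" g] by (simp add: dist_norm l2_apply_simps)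
  have "Cauchy (\<lambda>n. l2_apply (X n) g)" for g
  proof (rule metric_CauchyI)
    fix e :: real assume "e > 0"
    then obtain M where "\<forall>m\<ge>M. \<forall>n\<ge>M. dist (X m) (X n) < e" using metric_CauchyD[OF C] by blast
    then show "\<exists>M. \<forall>m\<ge>M. \<forall>n\<ge>M. dist (l2_apply (X m) g) (l2_apply (X n) g) < e"
      using coord unfolding dist_real_def by (meson le_less_trans)
  qed
  then have "convergent (\<lambda>n. l2_apply (X n) g)" for g by (simp add: Cauchy_convergent_iff)
  then have "\<forall>g. \<exists>l. (\<lambda>n. l2_apply (X n) g) \<longlonglongrightarrow> l" by (simp add: convergent_def)
  from choice[OF this] obtain f where f: "\<forall>g. (\<lambda>n. l2_apply (X n) g) \<longlonglongrightarrow> f g" ..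
  have bound: "(\<Sum>g\<in>F. (l2_apply (X m) g - f g)\<^sup>2) \<le> e\<^sup>2"
    if F: "finite F" and N: "\<forall>n\<ge>N. dist (X m) (X n) < e" for F m N e
  proof (rule LIMSEQ_le_const2)
    show "(\<lambda>n. \<Sum>g\<in>F. (l2_apply (X m) g - l2_apply (X n) g)\<^sup>2) \<longlonglongrightarrow> (\<Sum>g\<in>F. (l2_apply (X m) g - f g)\<^sup>2)"
      by (intro tendsto_intros) (use f in blast)
    show "\<exists>N. \<forall>n\<ge>N. (\<Sum>g\<in>F. (l2_apply (X m) g - l2_apply (X n) g)\<^sup>2) \<le> e\<^sup>2"
    proof (intro exI[of _ N] allI impI)
      fix n assume "n \<ge> N"
      then have "(norm (X m - X n))\<^sup>2 \<le> e\<^sup>2" using N by (intro power_mono) (auto simp: dist_norm less_imp_le)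
      then show "(\<Sum>g\<in>F. (l2_apply (X m) g - l2_apply (X n) g)\<^sup>2) \<le> e\<^sup>2"
        using l2_sum_le_norm[OF F, of "X m - X n"] by (simp add: l2_apply_simps)
    qed
  qed
  obtain N where N: "\<forall>m\<ge>N. \<forall>n\<ge>N. dist (X m) (X n) < 1"
    using metric_CauchyD[OF C zero_less_one] by blast
  have "(\<lambda>g. (l2_apply (X N) g - f g)\<^sup>2) summable_on UNIV"
  proof (rule nonneg_bdd_above_summable_on)
    show "bdd_above (sum (\<lambda>g. (l2_apply (X N) g - f g)\<^sup>2) ` {F. F \<subseteq> UNIV \<and> finite F})"
      using bound[of _ N N 1] N by (intro bdd_aboveI2[where M = 1]) auto
  qed simp
  then have diff: "l2_apply (Abs_l2 (\<lambda>g. l2_apply (X N) g - f g)) = (\<lambda>g. l2_apply (X N) g - f g)"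
    by (simp add: Abs_l2_inverse)
  \<comment> \<open>The limit is obtained from \<open>X N\<close> because the family \<open>f\<close> itself is not yet known to be square-summable.\<close>
  define x where "x = X N - Abs_l2 (\<lambda>g. l2_apply (X N) g - f g)"
  have x: "l2_apply x g = f g" for g by (simp add: x_def l2_apply_simps diff)
  have "X \<longlonglongrightarrow> x"
  proof (rule metric_LIMSEQ_I)
    fix e :: real assume e: "e > 0"
    then obtain M where M: "\<forall>m\<ge>M. \<forall>n\<ge>M. dist (X m) (X n) < e / 2"
      using metric_CauchyD[OF C, of "e / 2"] by auto
    have "norm (X m - x) \<le> e / 2" if "m \<ge> M" for m
      by (rule l2_norm_le) (use bound[of _ M m "e / 2"] M that e in \<open>simp_all add: l2_apply_simps x\<close>)
    then show "\<exists>M. \<forall>n\<ge>M. dist (X n) x < e" using e unfolding dist_norm by (intro exI[of _ M]) fastforce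
  qed
  moreover have "x \<in> l2_space G"
    unfolding l2_space_def
  proof (intro CollectI allI impI)
    fix h assume "h \<notin> carrier G"
    then have "l2_apply (X n) h = 0" for n using mem by (simp add: l2_space_def)
    then have "(\<lambda>n. l2_apply (X n) h) \<longlonglongrightarrow> 0" by simp
    then show "l2_apply x h = 0" using LIMSEQ_unique f x by metis
  qed
  ultimately show "\<exists>l\<in>l2_space G. X \<longlonglongrightarrow> l" by blast
qed

lemma subspace_l2_space: "subspace (l2_space G)"
  by (auto simp: subspace_def l2_space_def l2_apply_simps)

lemma l2_delta:
  fixes a :: 'a
  obtains d :: "'a l2" where "\<And>h. h \<noteq> a \<Longrightarrow> l2_apply d h = 0" "norm d = 1"
proof -
  let ?f = "\<lambda>h. if h = a then 1 else 0 :: real"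
  have "(\<lambda>h. (?f h)\<^sup>2) summable_on UNIV"
    by (rule finite_nonzero_values_imp_summable_on) (rule finite_subset[of _ "{a}"], auto)
  then have d: "l2_apply (Abs_l2 ?f) = ?f" by (simp add: Abs_l2_inverse)
  have "infsum (\<lambda>h. ?f h * ?f h) UNIV = infsum (\<lambda>h. ?f h * ?f h) {a}"
    by (rule infsum_cong_neutral) auto
  then have "infsum (\<lambda>h. ?f h * ?f h) UNIV = 1" by simp
  then have "norm (Abs_l2 ?f) = 1" by (simp add: norm_l2_def inner_l2_def d)
  then show ?thesis using that[of "Abs_l2 ?f"] d by simp
qed

lemma finite_l2_large:
  assumes "\<delta> > 0"
  shows "finite {g. \<delta> < \<bar>l2_apply x g\<bar>}"
proof -
  have "card F \<le> nat \<lfloor>(norm x)\<^sup>2 / \<delta>\<^sup>2\<rfloor>" if F: "F \<subseteq> {g. \<delta> < \<bar>l2_apply x g\<bar>}" "finite F" for F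
  proof -
    have "real (card F) * \<delta>\<^sup>2 = (\<Sum>g\<in>F. \<delta>\<^sup>2)" by simp
    also have "\<dots> \<le> (\<Sum>g\<in>F. (l2_apply x g)\<^sup>2)"
      using F(1) assms by (intro sum_mono) (auto simp: abs_le_square_iff[symmetric])
    also have "\<dots> \<le> (norm x)\<^sup>2" by (rule l2_sum_le_norm[OF F(2)])
    finally have "real (card F) \<le> (norm x)\<^sup>2 / \<delta>\<^sup>2" using assms by (simp add: field_simps)
    then show ?thesis by (simp add: le_nat_iff le_floor_iff)
  qed
  then show ?thesis using finite_if_finite_subsets_card_bdd by blast
qed

context group begin

lemma translate_inner:
  assumes g: "g \<in> carrier G"
  shows "inner (translate G g x) (translate G g y) = infsum (\<lambda>h. l2_apply x h * l2_apply y h) (carrier G)"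
proof -
  have "inner (translate G g x) (translate G g y)
      = infsum (\<lambda>h. l2_apply x (h \<otimes> g) * l2_apply y (h \<otimes> g)) (carrier G)"
    unfolding inner_l2_def by (rule infsum_cong_neutral) (auto simp: l2_apply_translate[OF group_axioms g])
  also have "\<dots> = infsum (\<lambda>h. l2_apply x h * l2_apply y h) (carrier G)"
  proof (rule infsum_reindex_bij_betw)
    show "bij_betw (\<lambda>h. h \<otimes> g) (carrier G) (carrier G)"
      by (rule bij_betw_byWitness[where f' = "\<lambda>h. h \<otimes> inv g"]) (use g in \<open>auto simp: m_assoc\<close>)
  qed
  finally show ?thesis .
qed

lemma translate_inner_l2_space:
  assumes "g \<in> carrier G" "x \<in> l2_space G"
  shows "inner (translate G g x) (translate G g y) = inner x y"
  unfolding translate_inner[OF assms(1)]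
  unfolding inner_l2_def
  by (rule infsum_cong_neutral) (use assms(2) in \<open>auto simp: l2_space_def\<close>)

lemma translate_bounded_linear:
  assumes g: "g \<in> carrier G"
  shows "bounded_linear (translate G g)"
proof (rule bounded_linear_intro[where K = 1])
  show "translate G g (x + y) = translate G g x + translate G g y" for x y
    by (rule l2_eqI) (simp add: l2_apply_translate[OF group_axioms g] l2_apply_simps)
  show "translate G g (r *\<^sub>R x) = r *\<^sub>R translate G g x" for r x
    by (rule l2_eqI) (simp add: l2_apply_translate[OF group_axioms g] l2_apply_simps)
  show "norm (translate G g x) \<le> norm x * 1" for x
  proof -
    have "infsum (\<lambda>h. l2_apply x h * l2_apply x h) (carrier G) \<le> infsum (\<lambda>h. l2_apply x h * l2_apply x h) UNIV"
      by (rule infsum_mono2) (use l2_mult_summable[of x x] summable_on_subset_banach in \<open>auto intro: summable_on_subset_banach\<close>)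
    then have "inner (translate G g x) (translate G g x) \<le> inner x x"
      unfolding translate_inner[OF g] unfolding inner_l2_def .
    then show ?thesis by (simp add: norm_eq_sqrt_inner)
  qed
qed

text \<open>
  If \<open>y h \<noteq> 0\<close>, then near translates force \<open>x\<close> to be large at \<open>h \<otimes> g\<close>, which happens at finitely many
  places; and \<open>g\<close> is determined by \<open>h \<otimes> g\<close>.
\<close>

lemma finite_translates_near:
  assumes y: "y \<in> l2_space G" "y \<noteq> 0"
  shows "\<exists>\<delta>>0. finite {g \<in> carrier G. dist (translate G g x) y < \<delta>}"
proof -
  obtain h where h: "l2_apply y h \<noteq> 0" using y(2) l2_eqI[of y 0] by (auto simp: l2_apply_simps)
  then have hG: "h \<in> carrier G" using y(1) by (auto simp: l2_space_def)
  let ?\<delta> = "\<bar>l2_apply y h\<bar> / 2"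
  let ?A = "{g \<in> carrier G. dist (translate G g x) y < ?\<delta>}"
  have \<delta>: "?\<delta> > 0" using h by simp
  have "(\<lambda>g. h \<otimes> g) ` ?A \<subseteq> {k. ?\<delta> < \<bar>l2_apply x k\<bar>}"
  proof (rule image_subsetI, rule CollectI)
    fix g assume "g \<in> ?A"
    then have g: "g \<in> carrier G" "dist (translate G g x) y < ?\<delta>" by simp_all
    have "\<bar>l2_apply (translate G g x - y) h\<bar> < ?\<delta>"
      using l2_apply_le_norm[of "translate G g x - y" h] g(2) by (simp add: dist_norm)
    then have "\<bar>l2_apply x (h \<otimes> g) - l2_apply y h\<bar> < ?\<delta>"
      by (simp add: l2_apply_simps l2_apply_translate[OF group_axioms g(1)] hG)
    then show "?\<delta> < \<bar>l2_apply x (h \<otimes> g)\<bar>" by linarith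
  qed
  then have "finite ((\<lambda>g. h \<otimes> g) ` ?A)" using finite_l2_large[OF \<delta>] by (rule finite_subset)
  moreover have "inj_on (\<lambda>g. h \<otimes> g) ?A" using hG by (auto intro!: inj_onI)
  ultimately have "finite ?A" by (rule finite_imageD)
  then show ?thesis using \<delta> by blast
qed

lemma translates_separated:
  assumes "y \<in> l2_space G" "y \<noteq> 0"
  shows "\<exists>d>0. \<forall>g\<in>carrier G. translate G g x \<noteq> y \<longrightarrow> d \<le> dist (translate G g x) y"
proof -
  obtain \<delta> where \<delta>: "\<delta> > 0" "finite {g \<in> carrier G. dist (translate G g x) y < \<delta>}"
    using finite_translates_near[OF assms] by blast
  let ?D = "insert \<delta> ((\<lambda>g. dist (translate G g x) y) ` {g \<in> carrier G. dist (translate G g x) y < \<delta>} - {0})"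
  have fin: "finite ?D" using \<delta>(2) by simp
  show ?thesis
  proof (intro exI[of _ "Min ?D"] conjI ballI impI)
    show "0 < Min ?D" using fin \<delta>(1) by (subst Min_gr_iff) auto
    fix g assume g: "g \<in> carrier G" "translate G g x \<noteq> y"
    show "Min ?D \<le> dist (translate G g x) y"
    proof (cases "dist (translate G g x) y < \<delta>")
      case True
      then show ?thesis using g by (intro Min_le fin) auto
    next
      case False
      have "Min ?D \<le> \<delta>" by (rule Min_le[OF fin]) simp
      then show ?thesis using False by simp
    qed
  qed
qed

lemma translate_mult:
  assumes "g \<in> carrier G" "h \<in> carrier G"
  shows "translate G (g \<otimes> h) x = translate G g (translate G h x)"
  by (rule l2_eqI) (use assms in \<open>simp add: l2_apply_translate[OF group_axioms] m_assoc\<close>)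

lemma translate_one: "x \<in> l2_space G \<Longrightarrow> translate G \<one> x = x"
  by (rule l2_eqI) (auto simp: l2_apply_translate[OF group_axioms] l2_space_def)

lemma translate_in: "g \<in> carrier G \<Longrightarrow> translate G g x \<in> l2_space G"
  by (simp add: l2_space_def l2_apply_translate[OF group_axioms])

text \<open>
  A stabilizer is finite by \<open>finite_translates_near\<close>, and it contains all powers of its elements, which
  are distinct for an element of infinite order.
\<close>

lemma translate_free:
  assumes tf: "\<forall>g\<in>carrier G. g \<noteq> \<one> \<longrightarrow> (\<forall>n::nat. n > 0 \<longrightarrow> g [^] n \<noteq> \<one>)"
    and g: "g \<in> carrier G" and x: "x \<in> l2_space G" "x \<noteq> 0" and fixed: "translate G g x = x"
  shows "g = \<one>"
proof (rule ccontr)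
  assume ne: "g \<noteq> \<one>"
  obtain \<delta> where \<delta>: "\<delta> > 0" "finite {g \<in> carrier G. dist (translate G g x) x < \<delta>}"
    using finite_translates_near[OF x] by blast
  have pow: "translate G (g [^] n) x = x" for n :: nat
    by (induction n) (simp_all add: translate_one x translate_mult g fixed)
  have "inj (\<lambda>n::nat. g [^] n)"
  proof (rule linorder_injI)
    fix m n :: nat assume "m < n"
    then have "g [^] (n - m) \<noteq> \<one>" using tf g ne by simp
    then show "g [^] m \<noteq> g [^] n" using pow_eq_div2[OF g, of n m] by auto
  qed
  moreover have "range (\<lambda>n::nat. g [^] n) \<subseteq> {g \<in> carrier G. dist (translate G g x) x < \<delta>}"
    using pow \<delta>(1) g by auto
  then have "finite (range (\<lambda>n::nat. g [^] n))" using \<delta>(2) by (rule finite_subset)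
  ultimately have "finite (UNIV :: nat set)" by (rule finite_imageD[rotated])
  then show False by simp
qed

end

section \<open>The unit sphere of the square-summable families\<close>

theorem theorem2:
  fixes G :: "('a, 'b) monoid_scheme"
  assumes "group G"
    and "\<forall>g\<in>carrier G. g \<noteq> \<one>\<^bsub>G\<^esub> \<longrightarrow> (\<forall>n::nat. n > 0 \<longrightarrow> g [^]\<^bsub>G\<^esub> n \<noteq> \<one>\<^bsub>G\<^esub>)"
  defines "S \<equiv> top_of_set (l2_sphere G)"
    and "\<pi> \<equiv> orbit G (sphere_action G)"
  defines "Q \<equiv> quotient_topology S \<pi>"
  shows "properly_discontinuous G S (sphere_action G) \<and>
    (\<exists>(E :: 'a l2 set) A.
       hilbert_manifold S E (submanifold_atlas (l2_sphere G) E) \<and>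
       hilbert_manifold Q E A \<and>
       covering_map S Q \<pi> \<and>
       local_diffeomorphism S (submanifold_atlas (l2_sphere G) E) Q A \<pi> \<and>
       (\<exists>g. riemannian_metric E A g \<and> riemannian_complete Q A g \<and>
            constant_sectional_curvature E A g 1))"
proof -
  interpret group G by fact
  obtain e :: "'a l2" where e: "\<And>h. h \<noteq> \<one>\<^bsub>G\<^esub> \<Longrightarrow> l2_apply e h = 0" "norm e = 1"
    using l2_delta[of "\<one>\<^bsub>G\<^esub>"] by blast
  interpret A: free_isometric_action G "translate G" "l2_space G" e
  proof (intro free_isometric_action.intro free_isometric_action_axioms.intro)
    show "group G" by fact
    have "h \<noteq> \<one>\<^bsub>G\<^esub>" if "h \<notin> carrier G" for h using that by auto
    then show "e \<in> l2_space G" using e(1) by (simp add: l2_space_def)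
    show "\<exists>d>0. \<forall>g\<in>carrier G. translate G g x \<noteq> y \<longrightarrow> d \<le> dist (translate G g x) y"
      if "y \<in> l2_space G" "norm y = 1" for x y
      using that by (intro translates_separated) auto
    show "g = \<one>\<^bsub>G\<^esub>" if "g \<in> carrier G" "x \<in> l2_space G" "norm x = 1" "translate G g x = x" for g x
      using that by (intro translate_free[OF assms(2)]) auto
  qed (simp_all add: subspace_l2_space complete_l2_space e(2) translate_bounded_linear translate_in
      translate_inner_l2_space translate_mult translate_one)
  have S: "A.S = l2_sphere G" by (simp add: A.S_def l2_sphere_def)
  have act: "A.act = sphere_action G" by (simp add: fun_eq_iff A.act_def sphere_action_def S)
  have \<pi>: "A.proj = \<pi>" by (simp add: A.proj_def \<pi>_def act)
  have Q: "A.Q = Q" by (simp add: A.Q_def Q_def S_def S \<pi>)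
  show ?thesis
    using A.properly_discontinuous_act A.hilbert_manifold_S A.hilbert_manifold_Q A.covering_map_proj
      A.local_diffeomorphism_proj A.riemannian_metric_Q A.riemannian_complete_Q A.constant_curvature_Q
    unfolding S act \<pi> Q S_def by blast
qed

end
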